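(* The mapping $\mathcal{A}\mathcal{F}$ (the Fourier transformation $\mathcal{F}$ followed by $\mathcal{A}$, the entire extension map) establishes an isomorphism between the spaces $G(\mathcal{H})$ and $E(\varPhi)$.
   Context: Notation: $n\in\mathbb{N}$ is fixed, $\|\cdot\|$ is the Euclidean norm, $\langle u,v\rangle=u_1v_1+\cdots+u_nv_n$; for multi-indices $\alpha\in\mathbb{Z}_+^n$: $|\alpha|=\alpha_1+\cdots+\alpha_n$, $\alpha!=\alpha_1!\cdots\alpha_n!$, $x^\alpha=x_1^{\alpha_1}\cdots x_n^{\alpha_n}$, $D^\alpha=\partial^{|\alpha|}/\partial x_1^{\alpha_1}\cdots\partial x_n^{\alpha_n}$. $H(\mathbb{C}^n)$ is the space of entire functions on $\mathbb{C}^n$. For $g\colon\mathbb{R}^n\to[-\infty,+\infty]$, $g^*(x)=\sup_{y\in\mathbb{R}^n}(\langle x,y\rangle-g(y))$. $\mathcal{H}=\{h_\nu\}_{\nu=1}^\infty$ is a fixed family of convex functions $h_\nu\colon\mathbb{R}^n\to\mathbb{R}$ such that for each $\nu\in\mathbb{N}$: 1) $h_\nu(x)=h_\nu(|x_1|,\ldots,|x_n|)$ for $x\in\mathbb{R}^n$; 2) the restriction of $h_\nu$ to $[0,\infty)^n$ is nondecreasing in each variable; 3) $\lim_{x\to\infty} h_\nu(x)/\|x\|=+\infty$; 4) for each $M>0$ there exists a constant $A_{\nu,M}>0$ such that $h_\nu(x)\le\sum_{1\le j\le n:\,x_j\ne0}x_j\ln\frac{x_j}{M}+A_{\nu,M}$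 for $x\in[0,\infty)^n$; 5) there is a constant $\gamma_\nu$ with $h_\nu(x)-h_{\nu+1}(x)\ge\ln2\cdot\sum_{j=1}^n x_j-\gamma_\nu$ for $x\in[0,\infty)^n$; 6) there is a constant $l_\nu$ with $h_{\nu+1}(x+y)\le h_\nu(x)+h_\nu(y)+l_\nu$ for $x,y\in[0,\infty)^n$. For $\nu\in\mathbb{N}$, $m\in\mathbb{Z}_+$, let $$G_m(h_\nu)=\Big\{f\in C^m(\mathbb{R}^n):\ \|f\|_{m,h_\nu}=\sup_{x\in\mathbb{R}^n,\ \beta\in\mathbb{Z}_+^n,\ |\alpha|\le m}\frac{|x^\beta(D^\alpha f)(x)|}{\beta!\,e^{-h_\nu(\beta)}}<\infty\Big\},$$ $G(h_\nu)=\bigcap_{m\ge0}G_m(h_\nu)$ with the topology defined by the norms $\|\cdot\|_{m,h_\nu}$ ($m\in\mathbb{Z}_+$), and $G(\mathcal{H})=\bigcup_{\nu\ge1}G(h_\nu)$ with the inductive limit topology of the spaces $G(h_\nu)$. For $\nu\in\mathbb{N}$, $m\in\mathbb{Z}_+$, let $$\mathcal{E}_m(h_\nu)=\Big\{f\in C^\infty(\mathbb{R}^n):\ \rho_{m,\nu}(f)=\sup_{x\in\mathbb{R}^n,\ \alpha\in\mathbb{Z}_+^n}\frac{(1+\|x\|)^m|(D^\alpha f)(x)|}{\alpha!\,e^{-h_\nu(\alpha)}}<\infty\Big\},$$ $\mathcal{E}(h_\nu)=\bigcap_{m\ge0}\mathcal{E}_m(h_\nu)$ with the topology defined by the norms $\rho_{m,\nu}$,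 and $\mathcal{E}(\mathcal{H})=\bigcup_{\nu\ge1}\mathcal{E}(h_\nu)$ with the inductive limit topology. Each $f\in\mathcal{E}(\mathcal{H})$ has a unique extension to an entire function $F_f$ on $\mathbb{C}^n$, namely $F_f(z)=\sum_{|\alpha|\ge0}\frac{(D^\alpha f)(0)}{\alpha!}z^\alpha$; $\mathcal{A}$ is the map $f\in\mathcal{E}(\mathcal{H})\mapsto F_f$. $\mathcal{F}$ is the Fourier transformation $f\in G(\mathcal{H})\mapsto\hat f$, $\hat f(x)=\frac{1}{(\sqrt{2\pi})^n}\int_{\mathbb{R}^n}f(\xi)e^{i\langle x,\xi\rangle}\,d\xi$, $x\in\mathbb{R}^n$; it maps $G(\mathcal{H})$ into $\mathcal{E}(\mathcal{H})$. For $\nu\in\mathbb{N}$ let $\varphi_\nu(x)=h_\nu^*(\ln(1+|x_1|),\ldots,\ln(1+|x_n|))$, $x\in\mathbb{R}^n$, and $\varPhi=\{\varphi_\nu\}_{\nu=1}^\infty$. For $m\in\mathbb{Z}_+$ let $$E_m(\varphi_\nu)=\Big\{f\in H(\mathbb{C}^n):\ p_{\nu,m}(f)=\sup_{z\in\mathbb{C}^n}\frac{|f(z)|(1+\|z\|)^m}{e^{\varphi_\nu(\operatorname{Im}z)}}<\infty\Big\},$$ $E(\varphi_\nu)=\bigcap_{m\ge0}E_m(\varphi_\nu)$ with the projective limit topology of the spaces $E_m(\varphi_\nu)$ (i.e. defined by the norms $p_{\nu,m}$), and $E(\varPhi)=\bigcup_{\nu\ge1}E(\varphi_\nu)$ with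 the inductive limit topology of the spaces $E(\varphi_\nu)$. "Isomorphism" means isomorphism of topological vector spaces; inductive limits are taken in the locally convex sense. *)

theory Defs
  imports "HOL-Analysis.Analysis"
begin

text \<open>Multi-indices are functions \<open>'n \<Rightarrow> nat\<close> on the finite index type of the coordinates.\<close>

definition mi_abs :: "('n::finite \<Rightarrow> nat) \<Rightarrow> nat" where
  "mi_abs \<alpha> = (\<Sum>j\<in>UNIV. \<alpha> j)"

definition mi_fact :: "('n::finite \<Rightarrow> nat) \<Rightarrow> real" where
  "mi_fact \<alpha> = (\<Prod>j\<in>UNIV. fact (\<alpha> j))"

definition mi_vec :: "('n::finite \<Rightarrow> nat) \<Rightarrow> real^'n" where
  "mi_vec \<alpha> = (\<chi> j. real (\<alpha> j))"

definition mi_power :: "('a::comm_monoid_mult)^'n \<Rightarrow> ('n::finite \<Rightarrow> nat) \<Rightarrow> 'a" where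
  "mi_power x \<alpha> = (\<Prod>j\<in>UNIV. (x $ j) ^ \<alpha> j)"

definition partial_deriv :: "'n::finite \<Rightarrow> (real^'n \<Rightarrow> complex) \<Rightarrow> real^'n \<Rightarrow> complex" where
  "partial_deriv j f x = vector_derivative (\<lambda>t. f (x + t *\<^sub>R axis j 1)) (at 0)"

text \<open>\<open>C_diff m f\<close> says \<open>f \<in> C\<^sup>m(\<real>\<^sup>n)\<close>: all partial derivatives of order at most \<open>m\<close>,
  taken in any order, exist everywhere and are continuous.\<close>

primrec C_diff :: "nat \<Rightarrow> (real^'n::finite \<Rightarrow> complex) \<Rightarrow> bool" where
  "C_diff 0 f \<longleftrightarrow> continuous_on UNIV f"
| "C_diff (Suc m) f \<longleftrightarrow> continuous_on UNIV f \<and>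
     (\<forall>j. (\<forall>x. (\<lambda>t. f (x + t *\<^sub>R axis j 1)) differentiable (at (0::real))) \<and>
          C_diff m (partial_deriv j f))"

text \<open>An index type of class \<open>finite\<close> carries no canonical order, so some list containing each
  coordinate \<open>j\<close> exactly \<open>\<alpha> j\<close> times is picked. By Schwarz' theorem the choice is immaterial
  for functions of class \<open>C\<^sup>m\<close> with \<open>m \<ge> \<bar>\<alpha>\<bar>\<close>, the only ones the operator is used for.\<close>

definition mderiv :: "('n::finite \<Rightarrow> nat) \<Rightarrow> (real^'n \<Rightarrow> complex) \<Rightarrow> real^'n \<Rightarrow> complex" where
  "mderiv \<alpha> f = fold partial_deriv (SOME js. \<forall>j. count_list js j = \<alpha> j) f"

definition tvs :: "('a \<Rightarrow> complex) topology \<Rightarrow> bool" where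
  "tvs T \<longleftrightarrow> (\<lambda>_. 0) \<in> topspace T \<and>
     continuous_map (prod_topology T T) T (\<lambda>(f, g). \<lambda>x. f x + g x) \<and>
     continuous_map (prod_topology euclidean T) T (\<lambda>(c, f). \<lambda>x. c * f x)"

definition fun_convex :: "('a \<Rightarrow> complex) set \<Rightarrow> bool" where
  "fun_convex C \<longleftrightarrow> (\<forall>f\<in>C. \<forall>g\<in>C. \<forall>t::real. 0 \<le> t \<and> t \<le> 1 \<longrightarrow>
     (\<lambda>x. of_real (1 - t) * f x + of_real t * g x) \<in> C)"

definition locally_convex_tvs :: "('a \<Rightarrow> complex) topology \<Rightarrow> bool" where
  "locally_convex_tvs T \<longleftrightarrow> tvs T \<and>
     (\<forall>U. openin T U \<and> (\<lambda>_. 0) \<in> U \<longrightarrow>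
        (\<exists>W C. openin T W \<and> (\<lambda>_. 0) \<in> W \<and> W \<subseteq> C \<and> C \<subseteq> U \<and> fun_convex C))"

definition seminorm_topology ::
  "('a \<Rightarrow> complex) set \<Rightarrow> (nat \<Rightarrow> ('a \<Rightarrow> complex) \<Rightarrow> ennreal) \<Rightarrow> ('a \<Rightarrow> complex) topology" where
  "seminorm_topology V p = topology_generated_by
     {{g \<in> V. p m (\<lambda>x. g x - f x) < ennreal \<epsilon>} | m f \<epsilon>. f \<in> V \<and> 0 < \<epsilon>}"

text \<open>The finest locally convex vector topology on the union for which all inclusions are
  continuous, obtained as the supremum of all such topologies; see
  \<open>lc_inductive_limit_finest\<close> below.\<close>

definition lc_inductive_limit ::
  "'i set \<Rightarrow> ('i \<Rightarrow> ('a \<Rightarrow> complex) topology) \<Rightarrow> ('a \<Rightarrow> complex) topology" where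
  "lc_inductive_limit I X = topology_generated_by
     {U. \<exists>T. locally_convex_tvs T \<and> topspace T = (\<Union>i\<in>I. topspace (X i)) \<and>
           (\<forall>i\<in>I. continuous_map (X i) T id) \<and> openin T U}"

definition tvs_isomorphism ::
  "('a \<Rightarrow> complex) topology \<Rightarrow> ('b \<Rightarrow> complex) topology \<Rightarrow>
   (('a \<Rightarrow> complex) \<Rightarrow> 'b \<Rightarrow> complex) \<Rightarrow> bool" where
  "tvs_isomorphism X Y L \<longleftrightarrow> tvs X \<and> tvs Y \<and>
     (\<forall>f\<in>topspace X. \<forall>g\<in>topspace X. L (\<lambda>x. f x + g x) = (\<lambda>z. L f z + L g z)) \<and>
     (\<forall>c. \<forall>f\<in>topspace X. L (\<lambda>x. c * f x) = (\<lambda>z. c * L f z)) \<and>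
     homeomorphic_map X Y L"

lemma locally_convex_tvs_indiscrete:
  assumes "(\<lambda>_. 0) \<in> V"
    and "\<And>f g. f \<in> V \<Longrightarrow> g \<in> V \<Longrightarrow> (\<lambda>x. f x + g x) \<in> V"
    and "\<And>c f. f \<in> V \<Longrightarrow> (\<lambda>x. c * f x) \<in> V"
  shows "locally_convex_tvs (topology_generated_by {V})"
    and "topspace (topology_generated_by {V}) = V"
proof -
  let ?T = "topology_generated_by {V}"
  show top: "topspace ?T = V" by simp
  have op: "U = V" if "openin ?T U" "U \<noteq> {}" for U
  proof -
    have "generate_topology_on {V} U" using that(1) by (simp add: openin_topology_generated_by_iff)
    then have "U = {} \<or> U = V" by induction auto
    with that(2) show ?thesis by blast
  qed
  have cm: "continuous_map Z ?T h" if "\<And>z. z \<in> topspace Z \<Longrightarrow> h z \<in> V"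
    for Z :: "'z topology" and h
  proof (rule continuous_on_generated_topo)
    show "h ` topspace Z \<subseteq> \<Union>{V}" using that by auto
    fix U assume "U \<in> {V}"
    then have "h -` U \<inter> topspace Z = topspace Z" using that by auto
    then show "openin Z (h -` U \<inter> topspace Z)" by simp
  qed
  have "fun_convex V"
    unfolding fun_convex_def using assms by blast
  then show "locally_convex_tvs ?T"
    unfolding locally_convex_tvs_def tvs_def
  proof (intro conjI allI impI)
    show "(\<lambda>_. 0) \<in> topspace ?T" using assms(1) top by simp
    show "continuous_map (prod_topology ?T ?T) ?T (\<lambda>(f, g). \<lambda>x. f x + g x)"
      by (rule cm) (use assms(2) top in auto)
    show "continuous_map (prod_topology euclidean ?T) ?T (\<lambda>(c, f). \<lambda>x. c * f x)"
      by (rule cm) (use assms(3) top in auto)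
    fix U assume "openin ?T U \<and> (\<lambda>_. 0) \<in> U"
    moreover from this have "U = V" using op by blast
    ultimately show "\<exists>W C. openin ?T W \<and> (\<lambda>_. 0) \<in> W \<and> W \<subseteq> C \<and> C \<subseteq> U \<and> fun_convex C"
      using \<open>fun_convex V\<close> by blast
  qed
qed

lemma lc_inductive_limit_finest:
  assumes V: "V = (\<Union>i\<in>I. topspace (X i))"
    and sub: "(\<lambda>_. 0) \<in> V"
      "\<And>f g. f \<in> V \<Longrightarrow> g \<in> V \<Longrightarrow> (\<lambda>x. f x + g x) \<in> V"
      "\<And>c f. f \<in> V \<Longrightarrow> (\<lambda>x. c * f x) \<in> V"
  shows "topspace (lc_inductive_limit I X) = V"
    and "locally_convex_tvs (lc_inductive_limit I X)"
    and "\<And>i. i \<in> I \<Longrightarrow> continuous_map (X i) (lc_inductive_limit I X) id"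
    and "\<And>T U. locally_convex_tvs T \<Longrightarrow> topspace T = V \<Longrightarrow>
           (\<And>i. i \<in> I \<Longrightarrow> continuous_map (X i) T id) \<Longrightarrow> openin T U \<Longrightarrow>
           openin (lc_inductive_limit I X) U"
proof -
  define good where "good T \<longleftrightarrow> locally_convex_tvs T \<and> topspace T = V \<and>
           (\<forall>i\<in>I. continuous_map (X i) T id)" for T
  define S where "S = {U. \<exists>T. good T \<and> openin T U}"
  define L where "L = lc_inductive_limit I X"
  have L: "L = topology_generated_by S"
    unfolding L_def lc_inductive_limit_def S_def good_def V by (simp add: conj_assoc)
  have fin: "openin L U" if "good T" "openin T U" for T U
    unfolding L by (rule topology_generated_by_Basis) (use that S_def in blast)
  let ?N = "topology_generated_by {V}"
  have N: "locally_convex_tvs ?N" "topspace ?N = V"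
    using locally_convex_tvs_indiscrete[OF sub] by blast+
  have "continuous_map (X i) ?N id" if "i \<in> I" for i
  proof (rule continuous_on_generated_topo)
    have sV: "topspace (X i) \<subseteq> V" using that V by blast
    then show "id ` topspace (X i) \<subseteq> \<Union>{V}" by auto
    fix U assume "U \<in> {V}"
    then have "id -` U \<inter> topspace (X i) = topspace (X i)" using sV by auto
    then show "openin (X i) (id -` U \<inter> topspace (X i))" by simp
  qed
  then have "good ?N" using N good_def by blast
  moreover have "openin ?N V" using N(2) openin_topspace by metis
  ultimately have "V \<in> S" unfolding S_def by blast
  moreover have "U \<subseteq> V" if "U \<in> S" for U
    using that openin_subset unfolding S_def good_def by blast
  ultimately have US: "\<Union>S = V" by blast
  then have topL: "topspace L = V" unfolding L by simp
  then show "topspace (lc_inductive_limit I X) = V" unfolding L_def .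
  have cid: "continuous_map L T id" if "good T" for T
  proof -
    have "{x \<in> topspace L. id x \<in> U} = U" if "openin T U" for U
      using openin_subset[OF that] \<open>good T\<close> topL unfolding good_def by auto
    then show ?thesis
      unfolding continuous_map_def using that fin[OF that] topL by (auto simp: good_def)
  qed
  have cmI: "continuous_map Z L h" if "\<And>T. good T \<Longrightarrow> continuous_map Z T h"
    for Z :: "'z topology" and h
    unfolding L
  proof (rule continuous_on_generated_topo)
    have "continuous_map Z ?N h" using that \<open>good ?N\<close> by blast
    then show "h ` topspace Z \<subseteq> \<Union>S"
      unfolding US continuous_map_def N(2) by blast
    fix U assume "U \<in> S"
    then obtain T where T: "good T" "openin T U" unfolding S_def by blast
    have "{x \<in> topspace Z. h x \<in> U} = h -` U \<inter> topspace Z" by blast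
    then show "openin Z (h -` U \<inter> topspace Z)"
      using that[OF T(1)] T(2) unfolding continuous_map_def by metis
  qed
  have add: "continuous_map (prod_topology L L) L (\<lambda>(f, g). \<lambda>x. f x + g x)"
  proof (rule cmI)
    fix T assume T: "good T"
    have "continuous_map (prod_topology L L) (prod_topology T T) (\<lambda>(f, g). (id f, id g))"
      using cid[OF T] by (simp only: continuous_map_prod_top) blast
    moreover have "continuous_map (prod_topology T T) T (\<lambda>(f, g). \<lambda>x. f x + g x)"
      using T unfolding good_def locally_convex_tvs_def tvs_def by blast
    ultimately have "continuous_map (prod_topology L L) T
        ((\<lambda>(f, g). \<lambda>x. f x + g x) \<circ> (\<lambda>(f, g). (id f, id g)))"
      by (rule continuous_map_compose)
    moreover have "((\<lambda>(f, g). \<lambda>x. f x + g x) \<circ> (\<lambda>(f, g). (id f, id g)))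
        = (\<lambda>(f, g). \<lambda>x. f x + (g x :: complex))" by (auto simp: fun_eq_iff)
    ultimately show "continuous_map (prod_topology L L) T (\<lambda>(f, g). \<lambda>x. f x + g x)" by metis
  qed
  have scl: "continuous_map (prod_topology euclidean L) L (\<lambda>(c, f). \<lambda>x. c * f x)"
  proof (rule cmI)
    fix T assume T: "good T"
    have "continuous_map (prod_topology euclidean L) (prod_topology euclidean T)
        (\<lambda>(c::complex, f). (id c, id f))"
      using cid[OF T] continuous_map_id by (simp only: continuous_map_prod_top) blast
    moreover have "continuous_map (prod_topology euclidean T) T (\<lambda>(c, f). \<lambda>x. c * f x)"
      using T unfolding good_def locally_convex_tvs_def tvs_def by blast
    ultimately have "continuous_map (prod_topology euclidean L) T
        ((\<lambda>(c, f). \<lambda>x. c * f x) \<circ> (\<lambda>(c, f). (id c, id f)))"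
      by (rule continuous_map_compose)
    moreover have "((\<lambda>(c, f). \<lambda>x. c * f x) \<circ> (\<lambda>(c, f). (id c, id f)))
        = (\<lambda>(c, f). \<lambda>x. c * (f x :: complex))" by (auto simp: fun_eq_iff)
    ultimately show "continuous_map (prod_topology euclidean L) T (\<lambda>(c, f). \<lambda>x. c * f x)" by metis
  qed
  define nb where "nb U \<longleftrightarrow> (\<exists>W C. openin L W \<and> (\<lambda>_. 0) \<in> W \<and> W \<subseteq> C \<and> C \<subseteq> U \<and>
      fun_convex C)" for U
  have lc: "(\<lambda>_. 0) \<in> U \<longrightarrow> nb U" if "generate_topology_on S U" for U
    using that
  proof induction
    case (Int A B)
    show ?case
    proof
      assume "(\<lambda>_. 0) \<in> A \<inter> B"
      then obtain W C W' C' where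
        "openin L W" "(\<lambda>_. 0) \<in> W" "W \<subseteq> C" "C \<subseteq> A" "fun_convex C"
        "openin L W'" "(\<lambda>_. 0) \<in> W'" "W' \<subseteq> C'" "C' \<subseteq> B" "fun_convex C'"
        using Int unfolding nb_def by auto
      moreover from this have "fun_convex (C \<inter> C')" unfolding fun_convex_def by blast
      ultimately show "nb (A \<inter> B)"
        unfolding nb_def by (intro exI[of _ "W \<inter> W'"] exI[of _ "C \<inter> C'"]) auto
    qed
  next
    case (UN K)
    show ?case
    proof
      assume "(\<lambda>_. 0) \<in> \<Union>K"
      then obtain k where "k \<in> K" "nb k" using UN by blast
      then show "nb (\<Union>K)" unfolding nb_def by (meson Union_upper order_trans)
    qed
  next
    case (Basis U)
    then obtain T where T: "good T" "openin T U" unfolding S_def by blast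
    then show ?case
      unfolding nb_def using fin[OF T(1)] unfolding good_def locally_convex_tvs_def by meson
  qed simp
  show "locally_convex_tvs (lc_inductive_limit I X)"
    unfolding locally_convex_tvs_def tvs_def L_def[symmetric]
    using add scl topL sub(1) lc unfolding nb_def L openin_topology_generated_by_iff by blast
  show "continuous_map (X i) (lc_inductive_limit I X) id" if "i \<in> I" for i
    unfolding L_def[symmetric] by (rule cmI) (use that good_def in blast)
  show "openin (lc_inductive_limit I X) U" if "locally_convex_tvs T" "topspace T = V"
    "\<And>i. i \<in> I \<Longrightarrow> continuous_map (X i) T id" "openin T U" for T U
    unfolding L_def[symmetric] using fin[of T U] that good_def by blast
qed

text \<open>All suprema of norms are formed in \<open>[0,\<infinity>]\<close>.\<close>

definition G_norm :: "nat \<Rightarrow> (real^'n::finite \<Rightarrow> real) \<Rightarrow> (real^'n \<Rightarrow> complex) \<Rightarrow> ennreal" where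
  "G_norm m h f = Sup {ennreal (cmod (of_real (mi_power x \<beta>) * mderiv \<alpha> f x) /
       (mi_fact \<beta> * exp (- h (mi_vec \<beta>)))) | x \<beta> \<alpha>. mi_abs \<alpha> \<le> m}"

definition G_m :: "nat \<Rightarrow> (real^'n::finite \<Rightarrow> real) \<Rightarrow> (real^'n \<Rightarrow> complex) set" where
  "G_m m h = {f. C_diff m f \<and> G_norm m h f < \<infinity>}"

definition G_top :: "(real^'n::finite \<Rightarrow> real) \<Rightarrow> (real^'n \<Rightarrow> complex) topology" where
  "G_top h = seminorm_topology (\<Inter>m. G_m m h) (\<lambda>m. G_norm m h)"

definition G_lim_top :: "(nat \<Rightarrow> real^'n::finite \<Rightarrow> real) \<Rightarrow> (real^'n \<Rightarrow> complex) topology" where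
  "G_lim_top h = lc_inductive_limit {1..} (\<lambda>\<nu>. G_top (h \<nu>))"

definition E_rho :: "nat \<Rightarrow> (real^'n::finite \<Rightarrow> real) \<Rightarrow> (real^'n \<Rightarrow> complex) \<Rightarrow> ennreal" where
  "E_rho m h f = Sup {ennreal ((1 + norm x) ^ m * cmod (mderiv \<alpha> f x) /
       (mi_fact \<alpha> * exp (- h (mi_vec \<alpha>)))) | x \<alpha>. True}"

definition E_smooth_m :: "nat \<Rightarrow> (real^'n::finite \<Rightarrow> real) \<Rightarrow> (real^'n \<Rightarrow> complex) set" where
  "E_smooth_m m h = {f. (\<forall>k. C_diff k f) \<and> E_rho m h f < \<infinity>}"

definition E_smooth_union :: "(nat \<Rightarrow> real^'n::finite \<Rightarrow> real) \<Rightarrow> (real^'n \<Rightarrow> complex) set" where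
  "E_smooth_union h = (\<Union>\<nu>\<in>{1..}. \<Inter>m. E_smooth_m m (h \<nu>))"

definition fenchel_conj :: "(real^'n::finite \<Rightarrow> ereal) \<Rightarrow> real^'n \<Rightarrow> ereal" where
  "fenchel_conj g x = (SUP y. ereal (x \<bullet> y) - g y)"

text \<open>For a convex function \<open>h\<close> on \<open>\<real>\<^sup>n\<close> growing faster than the norm the conjugate is finite
  everywhere, so that \<open>real_of_ereal\<close> loses nothing.\<close>

definition phi :: "(real^'n::finite \<Rightarrow> real) \<Rightarrow> real^'n \<Rightarrow> real" where
  "phi h x = real_of_ereal (fenchel_conj (\<lambda>y. ereal (h y)) (\<chi> j. ln (1 + \<bar>x $ j\<bar>)))"

definition entire :: "(complex^'n::finite \<Rightarrow> complex) \<Rightarrow> bool" where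
  "entire f \<longleftrightarrow> (\<forall>z. \<exists>f'. (f has_derivative f') (at z) \<and> (\<forall>c v. f' (c *s v) = c * f' v))"

definition E_norm :: "nat \<Rightarrow> (real^'n::finite \<Rightarrow> real) \<Rightarrow> (complex^'n \<Rightarrow> complex) \<Rightarrow> ennreal" where
  "E_norm m \<phi> f = Sup {ennreal (cmod (f z) * (1 + norm z) ^ m /
       exp (\<phi> (\<chi> j. Im (z $ j)))) | z. True}"

definition E_m :: "nat \<Rightarrow> (real^'n::finite \<Rightarrow> real) \<Rightarrow> (complex^'n \<Rightarrow> complex) set" where
  "E_m m \<phi> = {f. entire f \<and> E_norm m \<phi> f < \<infinity>}"

definition E_top :: "(real^'n::finite \<Rightarrow> real) \<Rightarrow> (complex^'n \<Rightarrow> complex) topology" where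
  "E_top \<phi> = seminorm_topology (\<Inter>m. E_m m \<phi>) (\<lambda>m. E_norm m \<phi>)"

definition E_lim_top :: "(nat \<Rightarrow> real^'n::finite \<Rightarrow> real) \<Rightarrow> (complex^'n \<Rightarrow> complex) topology" where
  "E_lim_top \<phi> = lc_inductive_limit {1..} (\<lambda>\<nu>. E_top (\<phi> \<nu>))"

definition fourier :: "(real^'n::finite \<Rightarrow> complex) \<Rightarrow> real^'n \<Rightarrow> complex" where
  "fourier f x = of_real (1 / sqrt (2 * pi) ^ CARD('n)) *
     (LINT \<xi>|lborel. f \<xi> * exp (\<i> * of_real (x \<bullet> \<xi>)))"

text \<open>The extension map is only specified on its domain \<open>E_smooth_union h\<close>: a statement about its
  values on Fourier transforms therefore includes that these belong to that space.\<close>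

definition entire_extension ::
  "(nat \<Rightarrow> real^'n::finite \<Rightarrow> real) \<Rightarrow> (real^'n \<Rightarrow> complex) \<Rightarrow> complex^'n \<Rightarrow> complex" where
  "entire_extension h = restrict
     (\<lambda>f z. \<Sum>\<^sub>\<infinity>\<alpha>\<in>UNIV. mderiv \<alpha> f 0 / of_real (mi_fact \<alpha>) * mi_power z \<alpha>)
     (E_smooth_union h)"

definition nonneg_orthant :: "(real^'n::finite) set" where
  "nonneg_orthant = {x. \<forall>j. 0 \<le> x $ j}"

end

theory Submission
  imports Defs "HOL-Probability.Characteristic_Functions" "HOL-Probability.Sinc_Integral"
    "HOL-Complex_Analysis.Conformal_Mappings"
begin

text \<open>Write \<open>AF f z = c \<integral> f(x) e\<^bsup>i\<langle>z,x\<rangle>\<^esup> dx\<close> and \<open>BT F \<xi> = c \<integral> F(x) e\<^bsup>-i\<langle>x,\<xi>\<rangle>\<^esup> dx\<close>. Comparing the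
  bounds \<open>\<bar>x\<^sup>\<beta> f(x)\<bar> \<le> K \<beta>! e\<^bsup>-h(\<beta>)\<^esup>\<close> with one dominant term of the exponential series controls \<open>\<bar>f(x)\<bar> e\<^bsup>\<langle>\<bar>y\<bar>,\<bar>x\<bar>\<rangle>\<^esup>\<close> by
  \<open>e\<^bsup>\<phi>(y)\<^esup>\<close>, and integration by parts gives the polynomial decay, so \<open>AF\<close> maps the \<open>\<nu>\<close>-th step
  continuously into the \<open>(\<nu>+2)\<close>-nd. Conversely, shifting the contour of \<open>BT F\<close> to imaginary part
  \<open>\<eta>\<^sub>j = - r\<^sub>j sgn \<xi>\<^sub>j\<close> bounds \<open>\<bar>\<xi>\<^sup>\<beta> D\<^sup>\<alpha> BT F(\<xi>)\<bar>\<close> by \<open>\<beta>! r\<^bsup>-\<beta>\<^esup> e\<^bsup>\<phi>(r)\<^esup>\<close>; optimising over \<open>r\<close>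
  (biconjugation of the convex weight) yields \<open>\<beta>! e\<^bsup>-h(\<beta>)\<^esup>\<close> at the cost of one step. Fourier
  inversion and the identity theorem make the two maps mutually inverse, and expanding the exponential
  shows that \<open>AF f\<close> is the Taylor series of the Fourier transform of \<open>f\<close>. Only pure powers of a single partial
  derivative of \<open>f\<close> and derivatives of explicit Fourier integrals occur, so Schwarz' theorem is never needed.\<close>

section \<open>Locally convex inductive limits\<close>

text \<open>The estimates lose something at several places: a geometric factor
  \<open>2 ^ mi_abs k\<close> when a supremum is turned into an integrable bound or an exponential
  is replaced by one term of its series, and a doubled radius when \<open>ln r\<close> is compared
  with \<open>ln (1 + r)\<close>. Condition 5 pays for each loss: passing from \<nu> to \<nu> + 1
  absorbs a factor 2 per unit of each index, up to a constant. Moving along the family is harmless,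
  because only the unions and their limit topologies matter, not the individual steps. The constants
  in the resulting estimates between norms depend on the weights and on \<open>m\<close>, never on
  the function, so each of them proves continuity as well as membership. The limit topology is a
  supremum of topologies, which gives no direct handle on its open sets. Continuity out of it is
  obtained by exhibiting a pulled-back topology among those over which the supremum is
  taken.\<close>

definition fun_subspace :: "('a \<Rightarrow> complex) set \<Rightarrow> bool" where
  "fun_subspace V \<longleftrightarrow> (\<lambda>_. 0) \<in> V \<and> (\<forall>f\<in>V. \<forall>g\<in>V. (\<lambda>x. f x + g x) \<in> V) \<and>
     (\<forall>c. \<forall>f\<in>V. (\<lambda>x. c * f x) \<in> V)"

definition linear_map_on :: "('a \<Rightarrow> complex) set \<Rightarrow> (('a \<Rightarrow> complex) \<Rightarrow> 'b \<Rightarrow> complex) \<Rightarrow> bool" where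
  "linear_map_on V L \<longleftrightarrow> (\<forall>f\<in>V. \<forall>g\<in>V. L (\<lambda>x. f x + g x) = (\<lambda>z. L f z + L g z)) \<and>
     (\<forall>c. \<forall>f\<in>V. L (\<lambda>x. c * f x) = (\<lambda>z. c * L f z))"

lemma fun_subspace_zero: "fun_subspace V \<Longrightarrow> (\<lambda>_. 0) \<in> V"
  and fun_subspace_add: "fun_subspace V \<Longrightarrow> f \<in> V \<Longrightarrow> g \<in> V \<Longrightarrow> (\<lambda>x. f x + g x) \<in> V"
  and fun_subspace_scale: "fun_subspace V \<Longrightarrow> f \<in> V \<Longrightarrow> (\<lambda>x. c * f x) \<in> V"
  unfolding fun_subspace_def by blast+

lemma fun_subspace_diff:
  assumes "fun_subspace V" "f \<in> V" "g \<in> V"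
  shows "(\<lambda>x. f x - g x) \<in> V"
  using fun_subspace_add[OF assms(1,2) fun_subspace_scale[OF assms(1,3), of "-1"]] by simp

lemma linear_map_on_add: "linear_map_on V L \<Longrightarrow> f \<in> V \<Longrightarrow> g \<in> V \<Longrightarrow>
    L (\<lambda>x. f x + g x) = (\<lambda>z. L f z + L g z)"
  and linear_map_on_scale: "linear_map_on V L \<Longrightarrow> f \<in> V \<Longrightarrow> L (\<lambda>x. c * f x) = (\<lambda>z. c * L f z)"
  unfolding linear_map_on_def by blast+

lemma linear_map_on_diff:
  assumes "fun_subspace V" "linear_map_on V L" "f \<in> V" "g \<in> V"
  shows "L (\<lambda>x. f x - g x) = (\<lambda>z. L f z - L g z)"
  using linear_map_on_add[OF assms(2,3) fun_subspace_scale[OF assms(1,4), of "-1"]]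
    linear_map_on_scale[OF assms(2,4), of "-1"] by simp

lemma linear_map_on_zero:
  assumes "fun_subspace V" "linear_map_on V L"
  shows "L (\<lambda>_. 0) = (\<lambda>_. 0)"
  using linear_map_on_scale[OF assms(2) fun_subspace_zero[OF assms(1)], of 0] by simp

text \<open>Transfers linearity from \<open>AF\<close>, where it is visible from the integral, to
  \<open>entire_extension h \<circ> fourier\<close>, which is known to agree with it only on the
  domain. Closure of \<open>V\<close> under sums and multiples permits the rewriting of
  \<open>L\<close> at those arguments.\<close>

lemma linear_map_on_cong:
  assumes V: "fun_subspace V" and L: "linear_map_on V L" and eq: "\<And>f. f \<in> V \<Longrightarrow> L f = M f"
  shows "linear_map_on V M"
  unfolding linear_map_on_def
proof (intro conjI ballI allI)
  fix f g assume f: "f \<in> V" and g: "g \<in> V"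
  show "M (\<lambda>x. f x + g x) = (\<lambda>z. M f z + M g z)"
    unfolding eq[OF fun_subspace_add[OF V f g], symmetric] eq[OF f, symmetric] eq[OF g, symmetric]
    by (rule linear_map_on_add[OF L f g])
next
  fix c f assume f: "f \<in> V"
  show "M (\<lambda>x. c * f x) = (\<lambda>z. c * M f z)"
    unfolding eq[OF fun_subspace_scale[OF V f], symmetric] eq[OF f, symmetric]
    by (rule linear_map_on_scale[OF L f])
qed

text \<open>The open sets are preimages under \<open>L\<close>. Since \<open>L\<close> is linear,
  addition and scaling followed by \<open>L\<close> are addition and scaling in \<open>Y\<close>
  preceded by \<open>L\<close>, hence continuous, and preimages of convex sets are convex. The
  pullback is thus a competitor in the supremum that defines a locally convex inductive
  limit.\<close>

lemma locally_convex_tvs_pullback: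
  assumes V: "fun_subspace V" and L: "linear_map_on V L"
    and Y: "locally_convex_tvs Y" and LV: "L ` V \<subseteq> topspace Y"
  shows "locally_convex_tvs (pullback_topology V L Y)"
proof -
  let ?T = "pullback_topology V L Y"
  have top: "topspace ?T = V" using LV by (auto simp: topspace_pullback_topology)
  have cL: "continuous_map ?T Y L"
    using continuous_map_pullback[OF continuous_map_id, of V L Y] by simp
  have Lz: "L (\<lambda>_. 0) = (\<lambda>_. 0)" by (rule linear_map_on_zero[OF V L])
  have Yadd: "continuous_map (prod_topology Y Y) Y (\<lambda>(f, g). \<lambda>x. f x + g x)"
    and Yscl: "continuous_map (prod_topology euclidean Y) Y (\<lambda>(c, f). \<lambda>x. c * f x)"
    using Y unfolding locally_convex_tvs_def tvs_def by blast+
  have add: "continuous_map (prod_topology ?T ?T) ?T (\<lambda>(f, g). \<lambda>x. f x + g x)"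
  proof (rule continuous_map_pullback')
    have "continuous_map (prod_topology ?T ?T) (prod_topology Y Y) (\<lambda>(f, g). (L f, L g))"
      using cL by (simp only: continuous_map_prod_top) blast
    from continuous_map_compose[OF this Yadd]
    show "continuous_map (prod_topology ?T ?T) Y (L \<circ> (\<lambda>(f, g). \<lambda>x. f x + g x))"
      by (rule continuous_map_eq) (clarsimp simp: top linear_map_on_add[OF L])
    show "topspace (prod_topology ?T ?T) \<subseteq> (\<lambda>(f, g). \<lambda>x. f x + g x) -` V"
      by (auto simp: top intro!: fun_subspace_add[OF V])
  qed
  have scl: "continuous_map (prod_topology euclidean ?T) ?T (\<lambda>(c, f). \<lambda>x. c * f x)"
  proof (rule continuous_map_pullback')
    have "continuous_map (prod_topology euclidean ?T) (prod_topology euclidean Y)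
        (\<lambda>(c::complex, f). (id c, L f))"
      using cL continuous_map_id by (simp only: continuous_map_prod_top) blast
    from continuous_map_compose[OF this Yscl]
    show "continuous_map (prod_topology euclidean ?T) Y (L \<circ> (\<lambda>(c, f). \<lambda>x. c * f x))"
      by (rule continuous_map_eq) (clarsimp simp: top linear_map_on_scale[OF L])
    show "topspace (prod_topology euclidean ?T) \<subseteq> (\<lambda>(c, f). \<lambda>x. c * f x) -` V"
      by (auto simp: top intro!: fun_subspace_scale[OF V])
  qed
  have "\<exists>W C. openin ?T W \<and> (\<lambda>_. 0) \<in> W \<and> W \<subseteq> C \<and> C \<subseteq> U \<and> fun_convex C"
    if U: "openin ?T U" "(\<lambda>_. 0) \<in> U" for U
  proof -
    obtain U' where U': "openin Y U'" "U = L -` U' \<inter> V"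
      using U by (auto simp: openin_pullback_topology)
    then have "(\<lambda>_. 0) \<in> U'" using U Lz by auto
    then obtain W C where W: "openin Y W" "(\<lambda>_. 0) \<in> W" "W \<subseteq> C" "C \<subseteq> U'" "fun_convex C"
      using Y U'(1) unfolding locally_convex_tvs_def by meson
    have "fun_convex (L -` C \<inter> V)"
      unfolding fun_convex_def
    proof (intro ballI allI impI)
      fix f g and t :: real
      assume fg: "f \<in> L -` C \<inter> V" "g \<in> L -` C \<inter> V" and t: "0 \<le> t \<and> t \<le> 1"
      let ?f = "\<lambda>x. of_real (1 - t) * f x" and ?g = "\<lambda>x. of_real t * g x"
      have m: "?f \<in> V" "?g \<in> V" using fg fun_subspace_scale[OF V] by blast+
      have "L (\<lambda>x. ?f x + ?g x) = (\<lambda>z. of_real (1 - t) * L f z + of_real t * L g z)"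
        using linear_map_on_add[OF L m] linear_map_on_scale[OF L, of f] linear_map_on_scale[OF L, of g] fg
        by simp
      also have "\<dots> \<in> C" using W(5) fg t unfolding fun_convex_def by blast
      finally show "(\<lambda>x. ?f x + ?g x) \<in> L -` C \<inter> V" using fun_subspace_add[OF V m] by blast
    qed
    moreover have "openin ?T (L -` W \<inter> V)" using W(1) by (auto simp: openin_pullback_topology)
    ultimately show ?thesis
      using W U' Lz fun_subspace_zero[OF V]
      by (intro exI[of _ "L -` W \<inter> V"] exI[of _ "L -` C \<inter> V"]) auto
  qed
  then show ?thesis
    unfolding locally_convex_tvs_def tvs_def using top add scl fun_subspace_zero[OF V] by blast
qed

lemma lc_inductive_limit_facts:
  assumes "V = (\<Union>i\<in>I. topspace (X i))" "fun_subspace V"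
  shows "topspace (lc_inductive_limit I X) = V"
    and "locally_convex_tvs (lc_inductive_limit I X)"
    and "\<And>i. i \<in> I \<Longrightarrow> continuous_map (X i) (lc_inductive_limit I X) id"
  using lc_inductive_limit_finest[OF assms(1)] assms(2) unfolding fun_subspace_def by blast+

text \<open>The universal property. The pullback of \<open>Y\<close> along \<open>L\<close> is a
  locally convex topology on the union for which all inclusions are continuous, so the limit
  topology is finer; for the pullback, \<open>L\<close> is continuous by construction.\<close>

lemma continuous_map_lc_inductive_limit:
  assumes V: "V = (\<Union>i\<in>I. topspace (X i))" "fun_subspace V"
    and L: "linear_map_on V L" and Y: "locally_convex_tvs Y"
    and cont: "\<And>i. i \<in> I \<Longrightarrow> continuous_map (X i) Y L"
  shows "continuous_map (lc_inductive_limit I X) Y L"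
proof -
  have LV: "L ` V \<subseteq> topspace Y"
    using cont V(1) unfolding continuous_map_def by auto
  let ?T = "pullback_topology V L Y"
  have T: "locally_convex_tvs ?T" by (rule locally_convex_tvs_pullback[OF V(2) L Y LV])
  have top: "topspace ?T = V" using LV by (auto simp: topspace_pullback_topology)
  have ci: "continuous_map (X i) ?T id" if "i \<in> I" for i
    by (rule continuous_map_pullback') (use cont[OF that] V(1) that in auto)
  have "openin (lc_inductive_limit I X) {f \<in> topspace (lc_inductive_limit I X). L f \<in> U}"
    if "openin Y U" for U
  proof -
    have "openin ?T (L -` U \<inter> V)" using that by (auto simp: openin_pullback_topology)
    then have "openin (lc_inductive_limit I X) (L -` U \<inter> V)"
      by (rule lc_inductive_limit_finest(4)[OF V(1) _ _ _ T top ci, rotated -1])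
        (use V(2) in \<open>unfold fun_subspace_def, blast+\<close>)
    moreover have "{f \<in> topspace (lc_inductive_limit I X). L f \<in> U} = L -` U \<inter> V"
      using lc_inductive_limit_facts(1)[OF V] by auto
    ultimately show ?thesis by simp
  qed
  then show ?thesis
    using LV lc_inductive_limit_facts(1)[OF V] unfolding continuous_map_def by auto
qed

section \<open>Topologies generated by a sequence of norms\<close>

lemma topspace_seminorm_topology:
  assumes "\<And>m. p m (\<lambda>_. 0) = 0"
  shows "topspace (seminorm_topology V p) = V"
proof -
  let ?S = "{{g \<in> V. p m (\<lambda>x. g x - f x) < ennreal \<epsilon>} | m f \<epsilon>. f \<in> V \<and> 0 < \<epsilon>}"
  have sub: "\<Union>?S \<subseteq> V" by blast
  \<comment> \<open>Each point lies in a ball about itself; this uses that the zero function has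
    norm 0.\<close>
  have sup: "f \<in> \<Union>?S" if "f \<in> V" for f
  proof (rule UnionI)
    show "{g \<in> V. p 0 (\<lambda>x. g x - f x) < ennreal 1} \<in> ?S" using that zero_less_one by blast
    show "f \<in> {g \<in> V. p 0 (\<lambda>x. g x - f x) < ennreal 1}" using that assms by simp
  qed
  show ?thesis
    unfolding seminorm_topology_def topology_generated_by_topspace
    by (rule subset_antisym[OF sub]) (rule subsetI, rule sup)
qed

text \<open>The usual criterion for linear maps, by norm estimates. The generating balls may be
  centred anywhere in \<open>W\<close>, so the preimage of a ball is shown to be open around each of
  its points \<open>g0\<close>, by applying the estimate to the difference from
  \<open>g0\<close>.\<close>

lemma continuous_map_seminorm_topology:
  assumes V: "fun_subspace V" and W: "fun_subspace W" and L: "linear_map_on V L"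
    and LV: "L ` V \<subseteq> W"
    and p0: "\<And>m. p m (\<lambda>_. 0) = 0" and q0: "\<And>m. q m (\<lambda>_. 0) = 0"
    and tri: "\<And>m f g. f \<in> W \<Longrightarrow> g \<in> W \<Longrightarrow> q m (\<lambda>x. f x + g x) \<le> q m f + q m g"
    and bd: "\<And>m. \<exists>k. \<exists>C>0. \<forall>f\<in>V. q m (L f) \<le> ennreal C * p k f"
  shows "continuous_map (seminorm_topology V p) (seminorm_topology W q) L"
proof -
  note [simp] = topspace_seminorm_topology[where p=p, OF p0]
  have "openin (seminorm_topology V p) (L -` {g \<in> W. q m (\<lambda>x. g x - w x) < ennreal \<epsilon>} \<inter> V)"
    if w: "w \<in> W" and \<epsilon>: "0 < \<epsilon>" for m w \<epsilon>
  proof (subst openin_subopen, intro ballI)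
    fix g0 assume "g0 \<in> L -` {g \<in> W. q m (\<lambda>x. g x - w x) < ennreal \<epsilon>} \<inter> V"
    then have g0: "g0 \<in> V" "L g0 \<in> W" "q m (\<lambda>x. L g0 x - w x) < ennreal \<epsilon>" by auto
    then obtain a where a: "q m (\<lambda>x. L g0 x - w x) = ennreal a" "0 \<le> a"
      by (cases "q m (\<lambda>x. L g0 x - w x)") auto
    have a\<epsilon>: "a < \<epsilon>" using g0(3) a by (simp add: ennreal_less_iff)
    obtain k C where C: "C > 0" "\<And>f. f \<in> V \<Longrightarrow> q m (L f) \<le> ennreal C * p k f"
      using bd by blast
    \<comment> \<open>\<open>L g0\<close> lies at distance \<open>a < \<epsilon>\<close> from the
      centre; the remaining slack, divided by the constant of the estimate, is an admissible radius
      about \<open>g0\<close>.\<close>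
    define \<delta> where "\<delta> = (\<epsilon> - a) / C"
    have \<delta>: "\<delta> > 0" using a\<epsilon> C by (simp add: \<delta>_def)
    let ?B = "{g \<in> V. p k (\<lambda>x. g x - g0 x) < ennreal \<delta>}"
    have "openin (seminorm_topology V p) ?B"
      unfolding seminorm_topology_def
      by (rule topology_generated_by_Basis) (use g0 \<delta> in blast)
    moreover have "g0 \<in> ?B" using g0 p0 \<delta> by simp
    moreover have "?B \<subseteq> L -` {g \<in> W. q m (\<lambda>x. g x - w x) < ennreal \<epsilon>} \<inter> V"
    proof
      fix g assume g: "g \<in> ?B"
      then have Lg: "L g \<in> W" and gV: "g \<in> V" using LV by auto
      obtain b where b: "p k (\<lambda>x. g x - g0 x) = ennreal b" "0 \<le> b" "b < \<delta>"
        using g by (cases "p k (\<lambda>x. g x - g0 x)") (auto simp: ennreal_less_iff)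
      have Ld: "L (\<lambda>x. g x - g0 x) = (\<lambda>z. L g z - L g0 z)"
        by (rule linear_map_on_diff[OF V L gV g0(1)])
      have "q m (\<lambda>x. L g x - w x) = q m (\<lambda>x. (L g x - L g0 x) + (L g0 x - w x))" by simp
      also have "\<dots> \<le> q m (\<lambda>x. L g x - L g0 x) + q m (\<lambda>x. L g0 x - w x)"
        by (rule tri) (use fun_subspace_diff[OF W] Lg g0 w in blast)+
      also have "\<dots> \<le> ennreal C * p k (\<lambda>x. g x - g0 x) + ennreal a"
        using C(2)[OF fun_subspace_diff[OF V gV g0(1)]] a(1) Ld by (auto intro: add_right_mono)
      also have "\<dots> = ennreal (C * b + a)"
        using b a C(1) by (simp add: ennreal_mult ennreal_plus)
      also have "\<dots> < ennreal \<epsilon>"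
      proof -
        have "C * b < C * \<delta>" using b C(1) by simp
        also have "C * \<delta> = \<epsilon> - a" using C(1) by (simp add: \<delta>_def)
        finally have "C * b + a < \<epsilon>" by simp
        moreover have "C * b + a \<ge> 0" using a b C(1) by simp
        ultimately show ?thesis by (simp only: ennreal_less_iff)
      qed
      finally show "g \<in> L -` {g \<in> W. q m (\<lambda>x. g x - w x) < ennreal \<epsilon>} \<inter> V"
        using Lg gV by simp
    qed
    ultimately show "\<exists>T. openin (seminorm_topology V p) T \<and> g0 \<in> T \<and>
        T \<subseteq> L -` {g \<in> W. q m (\<lambda>x. g x - w x) < ennreal \<epsilon>} \<inter> V" by blast
  qed
  moreover have "\<Union>{{g \<in> W. q m (\<lambda>x. g x - f x) < ennreal \<epsilon>} | m f \<epsilon>. f \<in> W \<and> 0 < \<epsilon>} = W"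
    using topspace_seminorm_topology[where p=q and V=W, OF q0]
    unfolding seminorm_topology_def topology_generated_by_topspace .
  ultimately show ?thesis
    unfolding seminorm_topology_def[of W]
    using LV by (intro continuous_on_generated_topo) auto
qed

section \<open>Conjugates of the weights\<close>

text \<open>A subgradient is the slope of a hyperplane separating \<open>(b, h b)\<close> from the
  strict epigraph. Strictness keeps the point outside the convex set; that the epigraph lies over
  the whole space excludes a vertical hyperplane.\<close>

lemma convex_on_subgradient:
  fixes h :: "'a::euclidean_space \<Rightarrow> real"
  assumes "convex_on UNIV h"
  obtains t where "\<And>y. h y \<ge> h b + t \<bullet> (y - b)"
proof -
  let ?T = "{(y, s). h y < s}"
  have cT: "convex ?T"
  proof (rule convexI)
    fix p q and u v :: real
    assume pq: "p \<in> ?T" "q \<in> ?T" and uv: "0 \<le> u" "0 \<le> v" "u + v = 1"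
    obtain y s y' s' where eq: "p = (y, s)" "q = (y', s')" by (metis surj_pair)
    with pq uv have *: "h y < s" "h y' < s'" "0 \<le> u" "0 \<le> v" "u + v = 1" by auto
    have "h (u *\<^sub>R y + v *\<^sub>R y') \<le> u * h y + v * h y'"
      using assms * by (simp add: convex_on_def)
    also have "\<dots> < u * s + v * s'"
    proof (cases "u = 0")
      case True then show ?thesis using * by simp
    next
      case False
      then have "u * h y < u * s" using * by simp
      moreover have "v * h y' \<le> v * s'" using * by (intro mult_left_mono) auto
      ultimately show ?thesis by linarith
    qed
    finally show "u *\<^sub>R p + v *\<^sub>R q \<in> ?T" by (simp add: eq)
  qed
  have "(b, h b + 1) \<in> ?T" by simp
  then have ne: "?T \<noteq> {}" by blast
  obtain a d where ad: "a \<noteq> 0" "\<forall>x\<in>{(b, h b)}. a \<bullet> x \<le> d" "\<forall>x\<in>?T. a \<bullet> x \<ge> d"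
    using separating_hyperplane_sets[of "{(b, h b)}" ?T] cT ne by auto
  obtain u c where a: "a = (u, c)" by (cases a)
  have ineq: "u \<bullet> b + c * h b \<le> u \<bullet> y + c * s" if "h y < s" for y s
    using ad(2) ad(3) that a by (force simp: inner_Pair)
  have c0: "c \<ge> 0" using ineq[of b "h b + 1"] by (simp add: algebra_simps)
  have "c \<noteq> 0"
  proof
    assume "c = 0"
    then have "u \<bullet> b \<le> u \<bullet> y" for y using ineq[of y "h y + 1"] by simp
    from this[of "b - u"] have "u \<bullet> u \<le> 0" by (simp add: inner_diff_right)
    then have "u = 0" by (metis inner_gt_zero_iff not_le)
    with \<open>c = 0\<close> a ad(1) show False by (simp add: zero_prod_def)
  qed
  with c0 have c: "c > 0" by simp
  have "h y \<ge> h b + ((- 1 / c) *\<^sub>R u) \<bullet> (y - b)" for y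
  proof (rule field_le_epsilon)
    \<comment> \<open>Only points strictly above the graph may be inserted, so
      \<open>h y + e\<close> is used and \<open>e\<close> is then removed.\<close>
    fix e :: real assume "e > 0"
    then have "u \<bullet> b + c * h b \<le> u \<bullet> y + c * (h y + e)" by (intro ineq) simp
    then have "(u \<bullet> b + c * h b) / c \<le> (u \<bullet> y + c * (h y + e)) / c"
      using c by (intro divide_right_mono) auto
    then show "h b + ((- 1 / c) *\<^sub>R u) \<bullet> (y - b) \<le> h y + e"
      using c by (simp add: inner_diff_right add_divide_distrib diff_divide_distrib algebra_simps)
  qed
  with that show ?thesis by blast
qed

section \<open>Weights, their conjugates and biconjugation\<close>

definition vabs :: "real^'n \<Rightarrow> real^'n::finite" where
  "vabs x = (\<chi> j. \<bar>x $ j\<bar>)"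

lemma vabs_nth [simp]: "vabs x $ j = \<bar>x $ j\<bar>"
  by (simp add: vabs_def)

lemma vabs_orthant [simp]: "vabs x \<in> nonneg_orthant"
  by (simp add: nonneg_orthant_def)

lemma inner_le_vabs: "x \<bullet> y \<le> vabs x \<bullet> vabs y"
  by (auto simp: inner_vec_def vabs_def abs_mult[symmetric] intro!: sum_mono)

locale weight =
  fixes h :: "real^'n::finite \<Rightarrow> real"
  assumes convex: "convex_on UNIV h"
    and even: "\<And>x. h x = h (vabs x)"
    and nondecreasing: "\<And>x j t. x \<in> nonneg_orthant \<Longrightarrow> x $ j \<le> t \<Longrightarrow>
          h x \<le> h (\<chi> i. if i = j then t else x $ i)"
    and superlinear: "filterlim (\<lambda>x. h x / norm x) at_top at_infinity"
begin

text \<open>The hypothesis changes one coordinate at a time; induction over the set of coordinates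
  already raised reaches \<open>y\<close>, and every intermediate vector stays in the
  orthant.\<close>

lemma mono:
  assumes "x \<in> nonneg_orthant" "\<And>j. x $ j \<le> y $ j"
  shows "h x \<le> h y"
proof -
  have "h x \<le> h (\<chi> i. if i \<in> S then y $ i else x $ i)" if "finite S" for S
    using that
  proof induction
    case empty then show ?case by simp
  next
    case (insert k S)
    let ?z = "\<chi> i. if i \<in> S then y $ i else x $ i"
    have "?z \<in> nonneg_orthant"
      using assms by (auto simp: nonneg_orthant_def intro: order_trans)
    then have "h ?z \<le> h (\<chi> i. if i = k then y $ k else ?z $ i)"
      by (rule nondecreasing) (use insert assms in auto)
    also have "(\<chi> i. if i = k then y $ k else ?z $ i) = (\<chi> i. if i \<in> insert k S then y $ i else x $ i)"
      by (auto simp: vec_eq_iff)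
    finally show ?case using insert by simp
  qed
  from this[of UNIV] show ?thesis by simp
qed

lemma mono_vabs: "(\<And>j. \<bar>x $ j\<bar> \<le> \<bar>y $ j\<bar>) \<Longrightarrow> h x \<le> h y"
  by (subst (1 2) even) (intro mono; simp)

definition conj :: "real^'n \<Rightarrow> real" where
  "conj t = real_of_ereal (fenchel_conj (\<lambda>y. ereal (h y)) t)"

lemma phi_eq: "phi h y = conj (\<chi> j. ln (1 + \<bar>y $ j\<bar>))"
  by (simp add: phi_def conj_def)

text \<open>Outside a ball superlinear growth gives \<open>h y \<ge> norm t * norm y\<close>, so the
  expression is at most 0; inside it the Cauchy-Schwarz inequality and the minimum
  \<open>h 0\<close> bound it.\<close>

lemma conj_bdd: "\<exists>c. \<forall>y. t \<bullet> y - h y \<le> c"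
proof -
  have "eventually (\<lambda>x. h x / norm x \<ge> norm t) at_infinity"
    using superlinear by (simp add: filterlim_at_top)
  then obtain b where b: "\<And>x. norm x \<ge> b \<Longrightarrow> h x / norm x \<ge> norm t"
    by (auto simp: eventually_at_infinity)
  \<comment> \<open>The radius \<open>max b 1\<close> keeps \<open>norm y\<close> positive for the
    division, and the absolute value lets one bound serve both cases, since the first yields only
    0.\<close>
  have "t \<bullet> y - h y \<le> \<bar>norm t * max b 1 - h 0\<bar>" for y
  proof (cases "norm y \<ge> max b 1")
    case True
    then have y: "norm y > 0" by linarith
    have "norm t \<le> h y / norm y" using b[of y] True by linarith
    then have "norm t * norm y \<le> h y" using y by (simp add: le_divide_eq)
    moreover have "t \<bullet> y \<le> norm t * norm y" by (rule norm_cauchy_schwarz)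
    ultimately show ?thesis by linarith
  next
    case False
    have "h 0 \<le> h y" by (rule mono_vabs) simp
    moreover have "t \<bullet> y \<le> norm t * norm y" by (rule norm_cauchy_schwarz)
    moreover have "norm t * norm y \<le> norm t * max b 1" using False by (intro mult_left_mono) auto
    ultimately show ?thesis by linarith
  qed
  then show ?thesis by blast
qed

lemma fenchel_conj_eq: "fenchel_conj (\<lambda>y. ereal (h y)) t = ereal (conj t)"
proof -
  obtain c where c: "\<And>y. t \<bullet> y - h y \<le> c" using conj_bdd by blast
  have "fenchel_conj (\<lambda>y. ereal (h y)) t \<le> ereal c"
    unfolding fenchel_conj_def by (rule SUP_least) (use c in simp)
  moreover have "ereal (t \<bullet> 0 - h 0) \<le> fenchel_conj (\<lambda>y. ereal (h y)) t"
    unfolding fenchel_conj_def by (rule SUP_upper2[of 0]) auto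
  ultimately show ?thesis
    unfolding conj_def by (cases "fenchel_conj (\<lambda>y. ereal (h y)) t") auto
qed

lemma conj_upper: "t \<bullet> y - h y \<le> conj t"
proof -
  have "ereal (t \<bullet> y - h y) \<le> fenchel_conj (\<lambda>y. ereal (h y)) t"
    unfolding fenchel_conj_def by (rule SUP_upper2[of y]) auto
  then show ?thesis by (simp add: fenchel_conj_eq)
qed

text \<open>The supremum may be tested on the orthant: for \<open>t\<close> with nonnegative
  entries, replacing \<open>y\<close> by \<open>vabs y\<close> keeps \<open>h\<close> and does not
  decrease the inner product.\<close>

lemma conj_least:
  assumes "\<And>y. y \<in> nonneg_orthant \<Longrightarrow> t \<bullet> y - h y \<le> c" "t \<in> nonneg_orthant"
  shows "conj t \<le> c"
proof -
  have "t \<bullet> y - h y \<le> c" for y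
  proof -
    have "t \<bullet> y \<le> t \<bullet> vabs y"
      using inner_le_vabs[of t y] assms(2) by (simp add: nonneg_orthant_def vabs_def)
    then show ?thesis using assms(1)[of "vabs y"] even[of y] by simp
  qed
  then have "fenchel_conj (\<lambda>y. ereal (h y)) t \<le> ereal c"
    unfolding fenchel_conj_def by (intro SUP_least) simp
  then show ?thesis by (simp add: fenchel_conj_eq)
qed

lemma conj_mono:
  assumes "t \<in> nonneg_orthant" "\<And>j. t $ j \<le> s $ j"
  shows "conj t \<le> conj s"
proof (rule conj_least[OF _ assms(1)])
  fix y :: "real^'n" assume "y \<in> nonneg_orthant"
  then have "t \<bullet> y \<le> s \<bullet> y"
    using assms(2) by (auto simp: inner_vec_def nonneg_orthant_def intro!: sum_mono mult_right_mono)
  with conj_upper[of s y] show "t \<bullet> y - h y \<le> conj s" by simp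
qed

lemma phi_mono: "(\<And>j. \<bar>x $ j\<bar> \<le> \<bar>y $ j\<bar>) \<Longrightarrow> phi h x \<le> phi h y"
  unfolding phi_eq by (rule conj_mono) (auto simp: nonneg_orthant_def)

text \<open>Biconjugation restricted to the orthant: evenness and monotonicity allow one to drop the
  negative components of a subgradient.\<close>

lemma conj_attained:
  assumes b: "b \<in> nonneg_orthant"
  obtains t where "t \<in> nonneg_orthant" "conj t = t \<bullet> b - h b"
proof -
  obtain t where t: "\<And>y. h y \<ge> h b + t \<bullet> (y - b)" using convex_on_subgradient[OF convex] by blast
  \<comment> \<open>Lowering coordinate \<open>j\<close> of \<open>b\<close> to 0 cannot raise
    \<open>h\<close>, so the subgradient inequality forces this sign.\<close>
  have pos: "t $ j \<ge> 0" if "b $ j > 0" for j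
  proof -
    let ?y = "\<chi> i. if i = j then 0 else b $ i"
    have "h ?y \<le> h b" using b by (intro mono) (auto simp: nonneg_orthant_def)
    with t[of ?y] have "t \<bullet> (?y - b) \<le> 0" by linarith
    also have "t \<bullet> (?y - b) = (\<Sum>i\<in>UNIV. if i = j then t $ i * (- b $ i) else 0)"
      unfolding inner_vec_def by (rule sum.cong) auto
    finally show ?thesis using that by (simp add: mult_le_0_iff zero_le_mult_iff)
  qed
  define t' where "t' = (\<chi> j. max 0 (t $ j))"
  have "conj t' \<le> t' \<bullet> b - h b"
  proof (rule conj_least)
    show "t' \<in> nonneg_orthant" by (simp add: t'_def nonneg_orthant_def)
    fix y :: "real^'n" assume y: "y \<in> nonneg_orthant"
    \<comment> \<open>Where \<open>t $ j < 0\<close>, \<open>pos\<close> gives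
      \<open>b $ j = 0\<close>, so \<open>y'\<close> lies below \<open>y\<close> and has no larger
      weight; the coordinate then drops out of \<open>t \<bullet> (y' - b)\<close>, which matches
      the truncation of \<open>t\<close> to \<open>t'\<close>.\<close>
    define y' where "y' = (\<chi> j. if t $ j < 0 then b $ j else y $ j)"
    have "h y' \<le> h y"
    proof (rule mono)
      show "y' \<in> nonneg_orthant" using b y by (auto simp: y'_def nonneg_orthant_def)
      fix j
      have "b $ j \<le> y $ j" if "t $ j < 0"
        using pos[of j] that b y by (cases "b $ j > 0") (auto simp: nonneg_orthant_def intro: order_trans[of _ 0])
      then show "y' $ j \<le> y $ j" by (simp add: y'_def)
    qed
    moreover have "t \<bullet> (y' - b) = t' \<bullet> (y - b)"
      unfolding inner_vec_def by (rule sum.cong) (auto simp: t'_def y'_def)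
    ultimately show "t' \<bullet> y - h y \<le> t' \<bullet> b - h b"
      using t[of y'] by (simp add: inner_diff_right)
  qed
  moreover have "t' \<bullet> b - h b \<le> conj t'" by (rule conj_upper)
  ultimately show ?thesis using that[of t'] by (auto simp: t'_def nonneg_orthant_def)
qed

text \<open>Young's inequality for \<open>h\<close> and its conjugate, at the lattice point
  \<open>mi_vec k\<close>. Enlarging the radius to \<open>1 + \<bar>s $ j\<bar>\<close> keeps the
  logarithm defined and nonnegative when a radius vanishes.\<close>

lemma prod_power_le_exp_phi:
  assumes r: "\<And>j. \<bar>r $ j\<bar> \<le> s $ j"
  shows "(\<Prod>j\<in>UNIV. \<bar>r $ j\<bar> ^ k j) * exp (- h (mi_vec k)) \<le> exp (phi h s)"
proof -
  have s0: "s $ j \<ge> 0" for j using r[of j] by (rule order_trans[OF abs_ge_zero])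
  have "(\<Prod>j\<in>UNIV. \<bar>r $ j\<bar> ^ k j) \<le> (\<Prod>j\<in>UNIV. exp (ln (1 + \<bar>s $ j\<bar>) * real (k j)))"
  proof (intro prod_mono conjI)
    fix j
    have "\<bar>r $ j\<bar> ^ k j \<le> (1 + \<bar>s $ j\<bar>) ^ k j" using r[of j] s0[of j] by (intro power_mono) auto
    also have "\<dots> = exp (ln (1 + \<bar>s $ j\<bar>) * real (k j))"
      by (simp add: exp_of_nat2_mult add_pos_nonneg)
    finally show "\<bar>r $ j\<bar> ^ k j \<le> exp (ln (1 + \<bar>s $ j\<bar>) * real (k j))" .
  qed auto
  also have "\<dots> = exp ((\<chi> j. ln (1 + \<bar>s $ j\<bar>)) \<bullet> mi_vec k)"
    by (simp add: inner_vec_def mi_vec_def exp_sum)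
  finally have "(\<Prod>j\<in>UNIV. \<bar>r $ j\<bar> ^ k j) * exp (- h (mi_vec k))
      \<le> exp ((\<chi> j. ln (1 + \<bar>s $ j\<bar>)) \<bullet> mi_vec k) * exp (- h (mi_vec k))"
    by (intro mult_right_mono) auto
  also have "\<dots> = exp ((\<chi> j. ln (1 + \<bar>s $ j\<bar>)) \<bullet> mi_vec k - h (mi_vec k))"
    by (simp add: exp_diff exp_minus field_simps)
  also have "\<dots> \<le> exp (phi h s)"
    unfolding phi_eq using conj_upper by simp
  finally show ?thesis .
qed

end

section \<open>Consecutive weights and the price of a factor two\<close>

lemma mi_vec_orthant [simp]: "mi_vec k \<in> nonneg_orthant"
  by (simp add: mi_vec_def nonneg_orthant_def)

locale weight_pair = A: weight h + B: weight h'
  for h h' :: "real^'n::finite \<Rightarrow> real" +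
  fixes \<gamma> :: real
  assumes decrease: "\<And>x. x \<in> nonneg_orthant \<Longrightarrow> h x - h' x \<ge> ln 2 * (\<Sum>j\<in>UNIV. x $ j) - \<gamma>"
begin

text \<open>Doubling a radius adds \<open>ln 2\<close> to its logarithm. In the supremum this costs
  \<open>ln 2\<close> times the sum of the coordinates of \<open>y\<close>, and \<open>h\<close>
  exceeds \<open>h'\<close> by at least that amount, up to \<open>\<gamma>\<close>.\<close>

lemma conj_shift:
  assumes "t \<in> nonneg_orthant"
  shows "A.conj (\<chi> j. t $ j + ln 2) \<le> B.conj t + \<gamma>"
proof (rule A.conj_least)
  show "(\<chi> j. t $ j + ln 2) \<in> nonneg_orthant"
    using assms by (simp add: nonneg_orthant_def)
  fix y :: "real^'n" assume "y \<in> nonneg_orthant"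
  moreover have "(\<chi> j. t $ j + ln 2) \<bullet> y = t \<bullet> y + ln 2 * (\<Sum>j\<in>UNIV. y $ j)"
    by (simp add: inner_vec_def distrib_right sum.distrib sum_distrib_left)
  ultimately show "(\<chi> j. t $ j + ln 2) \<bullet> y - h y \<le> B.conj t + \<gamma>"
    using decrease[of y] B.conj_upper[of t y] by simp
qed

lemma weight_le: "x \<in> nonneg_orthant \<Longrightarrow> h' x \<le> h x + \<gamma>"
proof -
  assume x: "x \<in> nonneg_orthant"
  then have "ln 2 * (\<Sum>j\<in>UNIV. x $ j) \<ge> 0"
    by (intro mult_nonneg_nonneg sum_nonneg) (auto simp: nonneg_orthant_def)
  with decrease[OF x] show ?thesis by linarith
qed

lemma phi_le: "phi h y \<le> phi h' y + \<gamma>"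
proof -
  have "(\<chi> j. ln (1 + \<bar>y $ j\<bar>)) \<in> nonneg_orthant" (is "?t \<in> _") by (auto simp: nonneg_orthant_def)
  moreover from this have "A.conj ?t \<le> A.conj (\<chi> j. ?t $ j + ln 2)"
    by (rule A.conj_mono) simp
  ultimately show ?thesis using conj_shift[of ?t] by (simp add: A.phi_eq B.phi_eq)
qed

text \<open>The form in which condition 5 is spent on multi-indices: one step of the family absorbs
  one geometric factor.\<close>

lemma exp_weight_le: "2 ^ mi_abs k * exp (- h (mi_vec k)) \<le> exp \<gamma> * exp (- h' (mi_vec k))"
proof -
  have "(2::real) ^ mi_abs k = exp (ln 2 * (\<Sum>j\<in>UNIV. mi_vec k $ j))"
    by (simp add: mi_vec_def mi_abs_def exp_of_nat2_mult flip: of_nat_sum)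
  then have "2 ^ mi_abs k * exp (- h (mi_vec k)) = exp (ln 2 * (\<Sum>j\<in>UNIV. mi_vec k $ j) - h (mi_vec k))"
    by (simp add: exp_diff exp_minus field_simps)
  also have "\<dots> \<le> exp (\<gamma> - h' (mi_vec k))" using decrease[of "mi_vec k"] by simp
  also have "\<dots> = exp \<gamma> * exp (- h' (mi_vec k))" by (simp add: exp_diff exp_minus field_simps)
  finally show ?thesis .
qed

text \<open>The optimal radii \<open>r = exp t\<close> come from a point \<open>t\<close> at which the conjugate of \<open>h'\<close> is
  attained at \<open>k\<close>; shifting from \<open>exp t - 1\<close> to \<open>exp t\<close> costs the factor 2 in the argument of
  the logarithm.\<close>

lemma optimal_radii:
  obtains r :: "real^'n" where "\<And>j. r $ j \<ge> 1"
    "exp (phi h r) / (\<Prod>j\<in>UNIV. (r $ j) ^ k j) \<le> exp \<gamma> * exp (- h' (mi_vec k))"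
proof -
  obtain t where t: "t \<in> nonneg_orthant" "B.conj t = t \<bullet> mi_vec k - h' (mi_vec k)"
    using B.conj_attained[OF mi_vec_orthant] by blast
  define r :: "real^'n" where "r = (\<chi> j. exp (t $ j))"
  have r1: "r $ j \<ge> 1" for j using t(1) by (simp add: r_def nonneg_orthant_def)
  have "phi h r \<le> A.conj (\<chi> j. t $ j + ln 2)"
    unfolding A.phi_eq
  proof (rule A.conj_mono)
    fix j
    \<comment> \<open>From \<open>r $ j \<ge> 1\<close> follows
      \<open>1 + r $ j \<le> 2 * r $ j\<close>.\<close>
    have "ln (1 + \<bar>r $ j\<bar>) \<le> ln (2 * exp (t $ j))"
      using r1[of j] by (intro ln_mono) (auto simp: r_def add_pos_pos)
    then show "(\<chi> j. ln (1 + \<bar>r $ j\<bar>)) $ j \<le> (\<chi> j. t $ j + ln 2) $ j"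
      by (simp add: ln_mult)
  qed (auto simp: nonneg_orthant_def)
  with conj_shift[OF t(1)] t(2) have *: "phi h r \<le> t \<bullet> mi_vec k - h' (mi_vec k) + \<gamma>" by simp
  have "(\<Prod>j\<in>UNIV. (r $ j) ^ k j) = exp (t \<bullet> mi_vec k)"
    by (simp add: r_def inner_vec_def mi_vec_def exp_sum exp_of_nat2_mult)
  then have "exp (phi h r) / (\<Prod>j\<in>UNIV. (r $ j) ^ k j) = exp (phi h r - t \<bullet> mi_vec k)"
    by (simp add: exp_diff)
  also have "\<dots> \<le> exp (\<gamma> - h' (mi_vec k))" using * by simp
  also have "\<dots> = exp \<gamma> * exp (- h' (mi_vec k))" by (simp add: exp_diff exp_minus field_simps)
  finally show ?thesis using that r1 by blast
qed

end

section \<open>Fourier inversion\<close>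

text \<open>Dominated convergence for a continuous parameter, tested on sequences. The bound is
  assumed only near \<open>a\<close>, so an initial segment of the sequence is dropped before the
  theorem for sequences is applied.\<close>

lemma integral_dominated_tendsto_at:
  fixes s :: "'p::metric_space \<Rightarrow> 'a \<Rightarrow> 'b::{banach,second_countable_topology}"
  assumes f: "f \<in> borel_measurable M" and s: "\<And>t. s t \<in> borel_measurable M"
    and w: "integrable M w"
    and lim: "\<And>x. ((\<lambda>t. s t x) \<longlongrightarrow> f x) (at a)"
    and d: "d > 0" and bound: "\<And>t x. t \<noteq> a \<Longrightarrow> dist t a < d \<Longrightarrow> norm (s t x) \<le> w x"
  shows "((\<lambda>t. integral\<^sup>L M (s t)) \<longlongrightarrow> integral\<^sup>L M f) (at a)"
  unfolding tendsto_at_iff_sequentially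
proof (intro allI impI)
  fix X :: "nat \<Rightarrow> 'p" assume X: "\<forall>i. X i \<in> UNIV - {a}" "X \<longlonglongrightarrow> a"
  then have "eventually (\<lambda>n. dist (X n) a < d) sequentially"
    using d by (simp add: tendsto_iff)
  then obtain N where N: "\<And>n. n \<ge> N \<Longrightarrow> dist (X n) a < d"
    by (auto simp: eventually_sequentially)
  have "(\<lambda>n. integral\<^sup>L M (s (X (n + N)))) \<longlonglongrightarrow> integral\<^sup>L M f"
  proof (rule integral_dominated_convergence[OF f s w])
    show "AE x in M. (\<lambda>i. s (X (i + N)) x) \<longlonglongrightarrow> f x"
    proof (rule AE_I2)
      fix x
      have "(\<lambda>i. s (X i) x) \<longlonglongrightarrow> f x"
        using lim[of x] X unfolding tendsto_at_iff_sequentially comp_def by blast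
      then show "(\<lambda>i. s (X (i + N)) x) \<longlonglongrightarrow> f x" by (rule LIMSEQ_ignore_initial_segment)
    qed
    show "AE x in M. norm (s (X (i + N)) x) \<le> w x" for i
      using bound X N by (intro AE_I2) auto
  qed
  then show "((\<lambda>t. integral\<^sup>L M (s t)) \<circ> X) \<longlonglongrightarrow> integral\<^sup>L M f"
    unfolding comp_def by (rule LIMSEQ_offset)
qed

lemma borel_measurable_vec_nth [measurable]: "(\<lambda>x::real^'n::finite. x $ j) \<in> borel_measurable borel"
  by (intro borel_measurable_continuous_onI continuous_intros)

text \<open>Lebesgue measure on \<open>real^'n\<close> is the image of a product measure indexed by
  \<open>Basis\<close>. As \<open>Basis\<close> consists of the vectors \<open>axis j 1\<close>,
  reindexing turns a product over coordinates into one over \<open>Basis\<close>, to which the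
  theorems on product measures apply.\<close>

lemma
  fixes g :: "'n::finite \<Rightarrow> real \<Rightarrow> 'b::{real_normed_field,banach,second_countable_topology}"
  assumes g: "\<And>j. integrable lborel (g j)"
  shows integrable_lborel_vec_prod: "integrable lborel (\<lambda>x::real^'n. \<Prod>j\<in>UNIV. g j (x $ j))"
    and integral_lborel_vec_prod:
      "(LINT x|lborel. (\<Prod>j\<in>UNIV. g j ((x::real^'n) $ j))) = (\<Prod>j\<in>UNIV. LINT t|lborel. g j t)"
proof -
  interpret product_sigma_finite "\<lambda>_::real^'n. lborel :: real measure" ..
  let ?ax = "\<lambda>j::'n. axis j (1::real)"
  have inj: "inj ?ax" by (auto simp: inj_on_def axis_eq_axis)
  have B: "(Basis :: (real^'n) set) = ?ax ` UNIV" by (auto simp: Basis_vec_def)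
  have [measurable]: "g j \<in> borel_measurable borel" for j
    using borel_measurable_integrable[OF g[of j]] by simp
  let ?S = "\<lambda>f. \<Sum>b\<in>(Basis :: (real^'n) set). f b *\<^sub>R b"
  let ?G = "\<lambda>b. g (inv ?ax b)"
  have S: "?S f $ j = f (?ax j)" for f j
  proof -
    have "?S f $ j = ?S f \<bullet> ?ax j" by (simp add: inner_axis)
    also have "\<dots> = f (?ax j)"
      by (rule inner_sum_left_Basis) (simp add: B)
    finally show ?thesis .
  qed
  have eq: "(\<Prod>j\<in>UNIV. g j (?S f $ j)) = (\<Prod>b\<in>Basis. ?G b (f b))" for f
    unfolding S unfolding B by (subst prod.reindex[OF inj]) (simp add: inv_f_f[OF inj])
  have Gi: "integrable lborel (?G b)" for b by (rule g)
  have "integrable (\<Pi>\<^sub>M b\<in>(Basis::(real^'n) set). lborel) (\<lambda>f. \<Prod>b\<in>Basis. ?G b (f b))"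
    by (rule product_integrable_prod[OF finite_Basis Gi])
  then have int: "integrable (\<Pi>\<^sub>M b\<in>(Basis::(real^'n) set). lborel) (\<lambda>f. \<Prod>j\<in>UNIV. g j (?S f $ j))"
    by (simp only: eq)
  have mS: "?S \<in> measurable (\<Pi>\<^sub>M b\<in>(Basis::(real^'n) set). lborel) borel" by measurable
  have mg: "(\<lambda>x::real^'n. \<Prod>j\<in>UNIV. g j (x $ j)) \<in> borel_measurable borel" by measurable
  show "integrable lborel (\<lambda>x::real^'n. \<Prod>j\<in>UNIV. g j (x $ j))"
    unfolding lborel_eq[where 'a="real^'n"] using int by (simp only: integrable_distr_eq[OF mS mg])
  have "(LINT x|lborel. (\<Prod>j\<in>UNIV. g j ((x::real^'n) $ j))) =
      (LINT f|(\<Pi>\<^sub>M b\<in>(Basis::(real^'n) set). lborel). (\<Prod>b\<in>Basis. ?G b (f b)))"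
    unfolding lborel_eq[where 'a="real^'n"] by (simp only: integral_distr[OF mS mg] eq)
  also have "\<dots> = (\<Prod>b\<in>Basis. LINT t|lborel. ?G b t)"
    by (rule product_integral_prod[OF finite_Basis Gi])
  also have "\<dots> = (\<Prod>j\<in>UNIV. LINT t|lborel. g j t)"
    unfolding B by (subst prod.reindex[OF inj]) (simp add: inv_f_f[OF inj])
  finally show "(LINT x|lborel. (\<Prod>j\<in>UNIV. g j ((x::real^'n) $ j))) = (\<Prod>j\<in>UNIV. LINT t|lborel. g j t)" .
qed

text \<open>An integrable majorant of product form: its integrability reduces to dimension one,
  bounded translations change it at most by a factor, and it can be extracted from bounds on powers
  of single coordinates.\<close>

definition cweight :: "real^'n::finite \<Rightarrow> real" where
  "cweight x = (\<Prod>j\<in>UNIV. inverse (1 + (x $ j)\<^sup>2))"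

lemma cweight_pos: "cweight x > 0"
  unfolding cweight_def by (intro prod_pos) (auto intro!: add_pos_nonneg)

lemma integrable_cweight: "integrable lborel (cweight :: real^'n::finite \<Rightarrow> real)"
proof -
  have "integrable lborel (\<lambda>x::real. inverse (1 + x\<^sup>2))"
    using integrable_inverse_1_plus_square by (simp add: set_integrable_def)
  then show ?thesis unfolding cweight_def[abs_def] by (rule integrable_lborel_vec_prod)
qed

lemma cweight_shift:
  fixes x a :: "real^'n::finite"
  shows "cweight (x + a) \<le> (\<Prod>j\<in>UNIV. 2 * (1 + (a $ j)\<^sup>2)) * cweight x"
  unfolding cweight_def prod.distrib[symmetric]
proof (intro prod_mono conjI)
  fix j
  let ?x = "x $ j" and ?a = "a $ j"
  have "1 + ?x\<^sup>2 \<le> 2 * (1 + ?a\<^sup>2) * (1 + (?x + ?a)\<^sup>2)"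
  proof -
    \<comment> \<open>The right side of the claim minus its left side, written as 1 plus
      squares.\<close>
    have "0 \<le> (?x + 2 * ?a)\<^sup>2 + 1 + 2 * (?a * (?x + ?a))\<^sup>2" by simp
    then show ?thesis by (simp add: power2_eq_square algebra_simps)
  qed
  then show "inverse (1 + ((x + a) $ j)\<^sup>2) \<le> 2 * (1 + ?a\<^sup>2) * inverse (1 + ?x\<^sup>2)"
    by (simp add: field_simps add_pos_nonneg)
  show "0 \<le> inverse (1 + ((x + a) $ j)\<^sup>2)" by (simp add: add_nonneg_nonneg)
qed

lemma lborel_integrable_translate:
  fixes f :: "'a::euclidean_space \<Rightarrow> 'b::{banach,second_countable_topology}"
  assumes "integrable lborel f"
  shows "integrable lborel (\<lambda>x. f (a + x))"
proof -
  have [measurable]: "f \<in> borel_measurable borel" using borel_measurable_integrable[OF assms] by simp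
  show ?thesis
    using assms by (subst (asm) lborel_distr_plus[of a, symmetric]) (simp add: integrable_distr_eq)
qed

lemma lborel_integral_translate:
  fixes f :: "'a::euclidean_space \<Rightarrow> 'b::{banach,second_countable_topology}"
  assumes "f \<in> borel_measurable borel"
  shows "(LINT x|lborel. f (a + x)) = (LINT x|lborel. f x)"
  using assms by (subst (2) lborel_distr_plus[of a, symmetric]) (simp add: integral_distr)

lemma lborel_integral_scale:
  fixes f :: "'a::euclidean_space \<Rightarrow> 'b::{banach,second_countable_topology}"
  assumes [measurable]: "f \<in> borel_measurable borel" and c: "c \<noteq> 0"
  shows "(LINT x|lborel. f x) = \<bar>c\<bar> ^ DIM('a) *\<^sub>R (LINT x|lborel. f (t + c *\<^sub>R x))"
  by (subst lborel_affine[OF c, of t]) (simp add: integral_density integral_distr)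

section \<open>Gaussians and their Fourier transforms\<close>

definition gauss :: "real^'n::finite \<Rightarrow> real" where
  "gauss x = (\<Prod>j\<in>UNIV. exp (- (x $ j)\<^sup>2 / 2))"

lemma gauss_pos: "gauss x > 0"
  unfolding gauss_def by (intro prod_pos) auto

lemma gauss_le_1: "gauss x \<le> 1"
  unfolding gauss_def by (intro prod_le_1 conjI) (simp_all add: exp_le_one_iff)

lemma continuous_gauss: "continuous_on UNIV gauss"
  unfolding gauss_def by (intro continuous_intros) simp_all

lemma borel_measurable_gauss [measurable]: "gauss \<in> borel_measurable borel"
  by (intro borel_measurable_continuous_onI continuous_gauss)

lemma gauss_zero [simp]: "gauss 0 = 1"
  by (simp add: gauss_def)

text \<open>Up to the normalisation \<open>sqrt (2 * pi)\<close> this is the characteristic function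
  of the standard normal distribution.\<close>

lemma
  fixes t :: real
  shows integrable_iexp_gauss_real: "integrable lborel (\<lambda>x. iexp (t * x) * of_real (exp (- x\<^sup>2 / 2)))"
    and integral_iexp_gauss_real: "(LINT x|lborel. iexp (t * x) * of_real (exp (- x\<^sup>2 / 2)))
          = of_real (sqrt (2 * pi) * exp (- t\<^sup>2 / 2))"
proof -
  have i: "integrable lborel (\<lambda>x::real. exp (- x\<^sup>2 / 2))"
  proof -
    have "integrable lborel (\<lambda>x. sqrt (2 * pi) * normal_density 0 1 x)"
      by (intro integrable_mult_right integrable_normal_density) simp
    then show ?thesis by (simp add: normal_density_def)
  qed
  show "integrable lborel (\<lambda>x. iexp (t * x) * of_real (exp (- x\<^sup>2 / 2)))"
    by (rule Bochner_Integration.integrable_bound[OF i]) (auto simp: norm_mult)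
  have "of_real (exp (- t\<^sup>2 / 2)) = (LINT x|lborel. normal_density 0 1 x *\<^sub>R iexp (t * x))"
    using fun_cong[OF char_std_normal_distribution, of t]
    by (simp add: char_def integral_density normal_density_nonneg)
  also have "\<dots> = (LINT x|lborel. of_real (1 / sqrt (2 * pi)) * (iexp (t * x) * of_real (exp (- x\<^sup>2 / 2))))"
    by (simp add: normal_density_def scaleR_conv_of_real mult_ac)
  also have "\<dots> = of_real (1 / sqrt (2 * pi)) * (LINT x|lborel. iexp (t * x) * of_real (exp (- x\<^sup>2 / 2)))"
    by (rule integral_mult_right_zero)
  finally show "(LINT x|lborel. iexp (t * x) * of_real (exp (- x\<^sup>2 / 2)))
          = of_real (sqrt (2 * pi) * exp (- t\<^sup>2 / 2))"
    by (simp add: field_simps)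
qed

lemma
  fixes t :: "real^'n::finite"
  shows integrable_iexp_gauss: "integrable lborel (\<lambda>x. iexp (t \<bullet> x) * of_real (gauss x))"
    and integral_iexp_gauss: "(LINT x|lborel. iexp (t \<bullet> x) * of_real (gauss x))
          = of_real (sqrt (2 * pi) ^ CARD('n) * gauss t)"
proof -
  have eq: "iexp (t \<bullet> x) * of_real (gauss x) =
      (\<Prod>j\<in>UNIV. iexp (t $ j * x $ j) * of_real (exp (- (x $ j)\<^sup>2 / 2)))" for x
    by (simp add: gauss_def prod.distrib inner_vec_def sum_distrib_left exp_sum)
  show "integrable lborel (\<lambda>x. iexp (t \<bullet> x) * of_real (gauss x))"
    unfolding eq by (intro integrable_lborel_vec_prod integrable_iexp_gauss_real)
  show "(LINT x|lborel. iexp (t \<bullet> x) * of_real (gauss x))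
          = of_real (sqrt (2 * pi) ^ CARD('n) * gauss t)"
    unfolding eq integral_lborel_vec_prod[OF integrable_iexp_gauss_real] integral_iexp_gauss_real
    by (simp add: prod.distrib gauss_def)
qed

lemma integrable_gauss: "integrable lborel (gauss :: real^'n::finite \<Rightarrow> real)"
proof -
  have "integrable lborel (\<lambda>x::real^'n. Re (iexp (0 \<bullet> x) * of_real (gauss x)))"
    by (rule integrable_Re[OF integrable_iexp_gauss])
  then show ?thesis by simp
qed

lemma integral_gauss: "(LINT x|lborel. gauss (x::real^'n::finite)) = sqrt (2 * pi) ^ CARD('n)"
proof -
  have "complex_of_real (LINT x|lborel. gauss (x::real^'n)) = of_real (sqrt (2 * pi) ^ CARD('n))"
    using integral_iexp_gauss[of "0::real^'n"] by simp
  then show ?thesis by (simp only: of_real_eq_iff)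
qed

text \<open>Proved by Gaussian regularisation; the sign \<open>s\<close> covers both the transform and
  the inverse transform.\<close>

lemma fourier_inversion:
  fixes g :: "real^'n::finite \<Rightarrow> complex" and s :: real
  assumes s: "s\<^sup>2 = 1" and g: "continuous_on UNIV g" "integrable lborel g"
    and B: "\<And>x. norm (g x) \<le> B"
    and ghat: "integrable lborel ghat"
    and ghat_eq: "\<And>\<xi>. ghat \<xi> = (LINT x|lborel. g x * iexp (s * (x \<bullet> \<xi>)))"
  shows "(LINT \<xi>|lborel. ghat \<xi> * iexp (- s * (x \<bullet> \<xi>))) = of_real ((2 * pi) ^ CARD('n)) * g x"
proof -
  let ?c = "sqrt (2 * pi) ^ CARD('n)"
  have [measurable]: "g \<in> borel_measurable borel" using g(1) by (rule borel_measurable_continuous_onI)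
  have [measurable]: "ghat \<in> borel_measurable borel" using borel_measurable_integrable[OF ghat] by simp
  \<comment> \<open>The factor \<open>gauss (\<epsilon> *\<^sub>R \<xi>)\<close> makes the double
    integral absolutely convergent and tends to 1 with \<epsilon> to 0. As \<open>ghat\<close> is
    integrable, \<open>I\<close> tends to the left side of the claim.\<close>
  define I where "I = (\<lambda>\<epsilon>. LINT \<xi>|lborel. ghat \<xi> * iexp (- s * (x \<bullet> \<xi>)) * of_real (gauss (\<epsilon> *\<^sub>R \<xi>)))"
  define X where "X = (\<lambda>k::nat. 1 / real (Suc k))"
  have X0: "X k > 0" for k by (simp add: X_def)
  have Xlim: "X \<longlonglongrightarrow> 0" unfolding X_def by (rule lim_1_over_n[THEN LIMSEQ_Suc])
  have glim: "(\<lambda>k. gauss (X k *\<^sub>R \<xi>)) \<longlonglongrightarrow> 1" for \<xi> :: "real^'n"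
  proof -
    have "(\<lambda>k. X k *\<^sub>R \<xi>) \<longlonglongrightarrow> 0 *\<^sub>R \<xi>" by (intro tendsto_intros Xlim)
    moreover have "isCont gauss (0 *\<^sub>R \<xi>)"
      by (rule continuous_on_interior[OF continuous_gauss]) simp
    ultimately have "(\<lambda>k. gauss (X k *\<^sub>R \<xi>)) \<longlonglongrightarrow> gauss (0 *\<^sub>R \<xi>)"
      by (rule isCont_tendsto_compose[rotated])
    then show ?thesis by simp
  qed
  have lim1: "(\<lambda>k. I (X k)) \<longlonglongrightarrow> (LINT \<xi>|lborel. ghat \<xi> * iexp (- s * (x \<bullet> \<xi>)))"
    unfolding I_def
  proof (rule integral_dominated_convergence)
    show "integrable lborel (\<lambda>\<xi>. norm (ghat \<xi>))" using ghat by (rule integrable_norm)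
    show "AE \<xi> in lborel. (\<lambda>k. ghat \<xi> * iexp (- s * (x \<bullet> \<xi>)) * of_real (gauss (X k *\<^sub>R \<xi>)))
        \<longlonglongrightarrow> ghat \<xi> * iexp (- s * (x \<bullet> \<xi>))"
    proof (rule AE_I2)
      fix \<xi>
      have "(\<lambda>k. ghat \<xi> * iexp (- s * (x \<bullet> \<xi>)) * of_real (gauss (X k *\<^sub>R \<xi>)))
        \<longlonglongrightarrow> ghat \<xi> * iexp (- s * (x \<bullet> \<xi>)) * of_real 1"
        by (intro tendsto_intros glim)
      then show "(\<lambda>k. ghat \<xi> * iexp (- s * (x \<bullet> \<xi>)) * of_real (gauss (X k *\<^sub>R \<xi>)))
        \<longlonglongrightarrow> ghat \<xi> * iexp (- s * (x \<bullet> \<xi>))" by simp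
    qed
    show "AE \<xi> in lborel. norm (ghat \<xi> * iexp (- s * (x \<bullet> \<xi>)) * of_real (gauss (X k *\<^sub>R \<xi>)))
        \<le> norm (ghat \<xi>)" for k
      by (intro AE_I2) (simp add: norm_mult abs_of_pos[OF gauss_pos] mult_left_le gauss_le_1)
  qed measurable
  have I_eq: "I \<epsilon> = of_real ?c * (LINT u|lborel. g (x + \<epsilon> *\<^sub>R u) * of_real (gauss u))" if \<epsilon>: "\<epsilon> > 0" for \<epsilon>
  proof -
    let ?f = "\<lambda>y \<xi>. g y * (iexp (s * ((y - x) \<bullet> \<xi>)) * of_real (gauss (\<epsilon> *\<^sub>R \<xi>)))"
    have gi: "integrable lborel (\<lambda>\<xi>::real^'n. gauss (\<epsilon> *\<^sub>R \<xi>))"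
    proof -
      have "integrable (density (distr lborel borel (\<lambda>x::real^'n. 0 + \<epsilon> *\<^sub>R x)) (\<lambda>_. \<bar>\<epsilon>\<bar>^DIM(real^'n))) gauss"
        using integrable_gauss \<epsilon> by (subst lborel_affine[symmetric]) auto
      then show ?thesis
        using \<epsilon> by (simp add: integrable_density integrable_distr_eq)
    qed
    \<comment> \<open>Scaling \<xi> by \<open>1 / \<epsilon>\<close> reduces this to the transform
      of the standard Gaussian; the sign \<open>s\<close> disappears because the Gaussian contains
      only squares and \<open>s\<^sup>2 = 1\<close>.\<close>
    have K: "(LINT \<xi>|lborel. iexp (s * ((\<epsilon> *\<^sub>R u) \<bullet> \<xi>)) * of_real (gauss (\<epsilon> *\<^sub>R \<xi>)))
        = of_real ((1 / \<epsilon>) ^ CARD('n) * ?c * gauss u)" for u :: "real^'n"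
    proof -
      have "(LINT \<xi>|lborel. iexp (s * ((\<epsilon> *\<^sub>R u) \<bullet> \<xi>)) * of_real (gauss (\<epsilon> *\<^sub>R \<xi>)))
        = (1 / \<epsilon>) ^ CARD('n) *\<^sub>R (LINT \<xi>|lborel. iexp (s * ((\<epsilon> *\<^sub>R u) \<bullet> (0 + (1 / \<epsilon>) *\<^sub>R \<xi>)))
            * of_real (gauss (\<epsilon> *\<^sub>R (0 + (1 / \<epsilon>) *\<^sub>R \<xi>))))"
        using \<epsilon> by (subst lborel_integral_scale[of _ "1 / \<epsilon>" 0]) auto
      also have "\<dots> = (1 / \<epsilon>) ^ CARD('n) *\<^sub>R (LINT \<xi>|lborel. iexp ((s *\<^sub>R u) \<bullet> \<xi>) * of_real (gauss \<xi>))"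
        using \<epsilon> by simp
      also have "\<dots> = of_real ((1 / \<epsilon>) ^ CARD('n) * ?c * gauss (s *\<^sub>R u))"
        unfolding integral_iexp_gauss by (simp add: scaleR_conv_of_real)
      also have "gauss (s *\<^sub>R u) = gauss u"
        using s by (simp add: gauss_def power_mult_distrib)
      finally show ?thesis .
    qed
    have int2: "integrable lborel (?f y)" for y
      by (rule Bochner_Integration.integrable_bound[OF integrable_mult_right[OF gi, of "norm (g y)"]])
        (auto simp: norm_mult abs_mult)
    have nf: "(LINT \<xi>|lborel. norm (?f y \<xi>)) = norm (g y) * (LINT \<xi>|lborel. gauss (\<epsilon> *\<^sub>R (\<xi>::real^'n)))" for y
      by (simp add: norm_mult abs_of_pos[OF gauss_pos])
    have int: "integrable (lborel \<Otimes>\<^sub>M lborel) (case_prod ?f)"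
    proof (rule lborel_pair.Fubini_integrable)
      show "integrable lborel (\<lambda>y. LINT \<xi>|lborel. norm (case_prod ?f (y, \<xi>)))"
        using g(2) by (simp only: case_prod_conv nf) (intro integrable_mult_left integrable_norm)
      show "AE y in lborel. integrable lborel (\<lambda>\<xi>. case_prod ?f (y, \<xi>))"
        using int2 by simp
    qed measurable
    have "I \<epsilon> = (LINT \<xi>|lborel. (LINT y|lborel. ?f y \<xi>))"
      unfolding I_def
    proof (rule Bochner_Integration.integral_cong[OF refl])
      fix \<xi> :: "real^'n"
      have "ghat \<xi> * iexp (- s * (x \<bullet> \<xi>)) * of_real (gauss (\<epsilon> *\<^sub>R \<xi>)) =
        (LINT y|lborel. (g y * iexp (s * (y \<bullet> \<xi>))) * (iexp (- s * (x \<bullet> \<xi>)) * of_real (gauss (\<epsilon> *\<^sub>R \<xi>))))"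
        unfolding ghat_eq integral_mult_left_zero by (simp add: mult.assoc)
      also have "\<dots> = (LINT y|lborel. ?f y \<xi>)"
        by (intro Bochner_Integration.integral_cong refl)
          (simp add: inner_diff_left exp_add[symmetric] algebra_simps flip: exp_add)
      finally show "ghat \<xi> * iexp (- s * (x \<bullet> \<xi>)) * of_real (gauss (\<epsilon> *\<^sub>R \<xi>)) = (LINT y|lborel. ?f y \<xi>)" .
    qed
    also have "\<dots> = (LINT y|lborel. (LINT \<xi>|lborel. ?f y \<xi>))"
      by (rule lborel_pair.Fubini_integral[OF int])
    also have "\<dots> = (LINT y|lborel. g y * (LINT \<xi>|lborel. iexp (s * ((y - x) \<bullet> \<xi>)) * of_real (gauss (\<epsilon> *\<^sub>R \<xi>))))"
      by simp
    \<comment> \<open>Substitution \<open>y = x + \<epsilon> *\<^sub>R u\<close>. Its Jacobian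
      cancels the power of \<open>1 / \<epsilon>\<close> in \<open>K\<close>, which leaves an
      average of \<open>g\<close> around \<open>x\<close> against a fixed Gaussian.\<close>
    also have "\<dots> = \<epsilon> ^ CARD('n) *\<^sub>R (LINT u|lborel. g (x + \<epsilon> *\<^sub>R u) * (LINT \<xi>|lborel. iexp (s * ((\<epsilon> *\<^sub>R u) \<bullet> \<xi>)) * of_real (gauss (\<epsilon> *\<^sub>R \<xi>))))"
      using \<epsilon> by (subst lborel_integral_scale[of _ \<epsilon> x]) auto
    also have "\<dots> = \<epsilon> ^ CARD('n) *\<^sub>R (LINT u|lborel. of_real ((1 / \<epsilon>) ^ CARD('n) * ?c) * (g (x + \<epsilon> *\<^sub>R u) * of_real (gauss u)))"
      unfolding K by (simp add: mult_ac)
    also have "\<dots> = of_real ?c * (LINT u|lborel. g (x + \<epsilon> *\<^sub>R u) * of_real (gauss u))"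
      unfolding integral_mult_right_zero using \<epsilon>
      by (simp add: scaleR_conv_of_real power_divide)
    finally show ?thesis .
  qed
  \<comment> \<open>Continuity of \<open>g\<close> gives the pointwise limit, its bound
    \<open>B\<close> the domination.\<close>
  have "(\<lambda>k. LINT u|lborel. g (x + X k *\<^sub>R u) * of_real (gauss u)) \<longlonglongrightarrow> (LINT u|lborel. g x * of_real (gauss (u::real^'n)))"
  proof (rule integral_dominated_convergence)
    show "integrable lborel (\<lambda>u::real^'n. B * gauss u)" by (intro integrable_mult_right integrable_gauss)
    show "AE u in lborel. (\<lambda>k. g (x + X k *\<^sub>R u) * of_real (gauss u)) \<longlonglongrightarrow> g x * of_real (gauss u)"
    proof (rule AE_I2)
      fix u :: "real^'n"
      have "(\<lambda>k. x + X k *\<^sub>R u) \<longlonglongrightarrow> x + 0 *\<^sub>R u" by (intro tendsto_intros Xlim)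
      moreover have "isCont g (x + 0 *\<^sub>R u)"
        by (rule continuous_on_interior[OF g(1)]) simp
      ultimately have "(\<lambda>k. g (x + X k *\<^sub>R u)) \<longlonglongrightarrow> g (x + 0 *\<^sub>R u)"
        by (rule isCont_tendsto_compose[rotated])
      then show "(\<lambda>k. g (x + X k *\<^sub>R u) * of_real (gauss u)) \<longlonglongrightarrow> g x * of_real (gauss u)"
        by (intro tendsto_mult tendsto_const) simp
    qed
    show "AE u in lborel. norm (g (x + X k *\<^sub>R u) * of_real (gauss u)) \<le> B * gauss u" for k
      using B by (intro AE_I2) (simp add: norm_mult abs_of_pos[OF gauss_pos] mult_right_mono less_imp_le[OF gauss_pos])
  qed measurable
  then have "(\<lambda>k. I (X k)) \<longlonglongrightarrow> of_real ?c * (LINT u|lborel. g x * of_real (gauss (u::real^'n)))"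
    unfolding I_eq[OF X0] by (intro tendsto_mult tendsto_const)
  then have "(LINT \<xi>|lborel. ghat \<xi> * iexp (- s * (x \<bullet> \<xi>)))
      = of_real ?c * (LINT u|lborel. g x * of_real (gauss (u::real^'n)))"
    by (rule LIMSEQ_unique[OF lim1])
  also have "\<dots> = of_real ?c * (g x * of_real ?c)"
    by (simp add: integral_gauss)
  also have "\<dots> = of_real (?c * ?c) * g x" by (simp add: mult_ac)
  also have "?c * ?c = (sqrt (2 * pi) * sqrt (2 * pi)) ^ CARD('n)" by (rule power_mult_distrib[symmetric])
  also have "sqrt (2 * pi) * sqrt (2 * pi) = 2 * pi" by simp
  finally show ?thesis .
qed

section \<open>Derivatives of Fourier integrals\<close>

text \<open>Difference quotients are the form to which dominated convergence under the integral sign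
  applies.\<close>

lemma has_vector_derivative_at_0_iff:
  fixes f :: "real \<Rightarrow> 'a::real_normed_vector"
  shows "(f has_vector_derivative D) (at 0) \<longleftrightarrow> ((\<lambda>t. (1 / t) *\<^sub>R (f t - f 0)) \<longlongrightarrow> D) (at 0)"
proof -
  have eq: "norm ((1 / t) *\<^sub>R (f t - f 0) - D) = norm (f t - f 0 - t *\<^sub>R D) / norm t" if "t \<noteq> 0" for t
  proof -
    have "(1 / t) *\<^sub>R (f t - f 0) - D = (1 / t) *\<^sub>R (f t - f 0 - t *\<^sub>R D)"
      using that by (simp add: scaleR_diff_right)
    then show ?thesis by simp
  qed
  have "(f has_vector_derivative D) (at 0) \<longleftrightarrow> ((\<lambda>t. norm (f t - f 0 - t *\<^sub>R D) / norm t) \<longlongrightarrow> 0) (at 0)"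
    unfolding has_vector_derivative_def has_derivative_at by (simp add: bounded_linear_scaleR_left)
  also have "\<dots> \<longleftrightarrow> ((\<lambda>t. norm ((1 / t) *\<^sub>R (f t - f 0) - D)) \<longlongrightarrow> 0) (at 0)"
    by (intro filterlim_cong refl) (auto simp: eventually_at_filter eq)
  also have "\<dots> \<longleftrightarrow> ((\<lambda>t. (1 / t) *\<^sub>R (f t - f 0)) \<longlongrightarrow> D) (at 0)"
    unfolding tendsto_norm_zero_iff by (rule Lim_null[symmetric])
  finally show ?thesis .
qed

lemma norm_iexp_diff_le: "norm (exp (\<i> * of_real a) - exp (\<i> * of_real b)) \<le> \<bar>a - b\<bar>"
proof -
  have "exp (\<i> * of_real a) - exp (\<i> * of_real b) = exp (\<i> * of_real b) * (iexp (a - b) - 1)"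
    by (simp add: right_diff_distrib algebra_simps flip: exp_add)
  moreover have "norm (iexp (a - b) - 1) \<le> \<bar>a - b\<bar>"
    using iexp_approx1[of "a - b" 0] by simp
  ultimately show ?thesis by (simp add: norm_mult)
qed

section \<open>Partial derivatives and multi-index derivatives\<close>

lemma partial_deriv_eqI:
  "((\<lambda>t. f (x + t *\<^sub>R axis j 1)) has_vector_derivative D) (at 0) \<Longrightarrow> partial_deriv j f x = D"
  unfolding partial_deriv_def by (rule vector_derivative_at)

lemma C_diff_imp_continuous: "C_diff m f \<Longrightarrow> continuous_on UNIV f"
  by (cases m) auto

lemma C_diff_SucD: "C_diff (Suc m) f \<Longrightarrow> C_diff m (partial_deriv j f)"
  by simp

lemma C_diff_has_partial_deriv_0:
  assumes "C_diff (Suc m) f"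
  shows "((\<lambda>t. f (x + t *\<^sub>R axis j 1)) has_vector_derivative partial_deriv j f x) (at 0)"
  unfolding partial_deriv_def using assms by (simp add: vector_derivative_works[symmetric])

text \<open>\<open>C_diff\<close> speaks of the parameter 0 at every base point; moving the base
  point along the axis gives the derivative at every parameter, as the mean value theorem will
  require.\<close>

lemma C_diff_has_partial_deriv:
  assumes "C_diff (Suc m) f"
  shows "((\<lambda>t. f (x + t *\<^sub>R axis j 1)) has_vector_derivative partial_deriv j f (x + t *\<^sub>R axis j 1)) (at t)"
proof -
  have "((\<lambda>s. s - t) has_vector_derivative 1) (at t)"
    by (auto intro!: derivative_eq_intros)
  from vector_diff_chain_at[OF this, of "\<lambda>s. f (x + t *\<^sub>R axis j 1 + s *\<^sub>R axis j 1)"]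
    C_diff_has_partial_deriv_0[OF assms, of "x + t *\<^sub>R axis j 1" j]
  show ?thesis by (simp add: comp_def algebra_simps flip: scaleR_add_left)
qed

lemma partial_deriv_add:
  assumes "C_diff (Suc m) f" "C_diff (Suc m) g"
  shows "partial_deriv j (\<lambda>x. f x + g x) = (\<lambda>x. partial_deriv j f x + partial_deriv j g x)"
  using assms by (intro ext partial_deriv_eqI has_vector_derivative_add C_diff_has_partial_deriv_0)

lemma partial_deriv_scale:
  assumes "C_diff (Suc m) f"
  shows "partial_deriv j (\<lambda>x. c * f x) = (\<lambda>x. c * partial_deriv j f x)"
  using assms
  by (intro ext partial_deriv_eqI bounded_linear.has_vector_derivative[OF bounded_linear_mult_right]
      C_diff_has_partial_deriv_0)

lemma C_diff_add: "C_diff m f \<Longrightarrow> C_diff m g \<Longrightarrow> C_diff m (\<lambda>x. f x + g x)"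
proof (induction m arbitrary: f g)
  case 0 then show ?case by (auto intro: continuous_intros)
next
  case (Suc m)
  then have "C_diff m (partial_deriv j (\<lambda>x. f x + g x))" for j
    unfolding partial_deriv_add[OF Suc.prems] by simp
  then show ?case
    using Suc.prems by (auto intro!: continuous_intros)
qed

lemma C_diff_scale: "C_diff m f \<Longrightarrow> C_diff m (\<lambda>x. c * f x)"
proof (induction m arbitrary: f)
  case 0 then show ?case by (auto intro: continuous_intros)
next
  case (Suc m)
  then have "C_diff m (partial_deriv j (\<lambda>x. c * f x))" for j
    unfolding partial_deriv_scale[OF Suc.prems] by simp
  then show ?case
    using Suc.prems by (auto intro!: continuous_intros)
qed

lemma fold_partial_deriv_add:
  "C_diff m f \<Longrightarrow> C_diff m g \<Longrightarrow> length js \<le> m \<Longrightarrow>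
   fold partial_deriv js (\<lambda>x. f x + g x) = (\<lambda>x. fold partial_deriv js f x + fold partial_deriv js g x)"
proof (induction js arbitrary: f g m)
  case (Cons j js)
  then obtain k where k: "m = Suc k" "length js \<le> k" by (cases m) auto
  then show ?case
    using Cons.IH[of k "partial_deriv j f" "partial_deriv j g"] Cons.prems
    by (simp add: partial_deriv_add[of k])
qed simp

lemma fold_partial_deriv_scale:
  "C_diff m f \<Longrightarrow> length js \<le> m \<Longrightarrow>
   fold partial_deriv js (\<lambda>x. c * f x) = (\<lambda>x. c * fold partial_deriv js f x)"
proof (induction js arbitrary: f m)
  case (Cons j js)
  then obtain k where k: "m = Suc k" "length js \<le> k" by (cases m) auto
  then show ?case
    using Cons.IH[of k "partial_deriv j f"] Cons.prems
    by (simp add: partial_deriv_scale[of k])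
qed simp

lemma length_eq_sum_count_list: "length js = (\<Sum>j\<in>UNIV. count_list js (j::'n::finite))"
proof (induction js)
  case (Cons a js)
  have "(\<Sum>j\<in>UNIV. count_list (a # js) j) = (\<Sum>j\<in>UNIV. (if j = a then 1 else 0) + count_list js j)"
    by (intro sum.cong) auto
  then show ?case using Cons by (simp add: sum.distrib)
qed simp

text \<open>The choice in \<open>mderiv\<close> is made from a nonempty set: on a finite type every
  function to \<open>nat\<close> is the multiplicity function of a multiset, hence of a list. Later
  arguments use only the counts and the length of that list.\<close>

lemma mderiv_eq_fold:
  fixes \<alpha> :: "'n::finite \<Rightarrow> nat"
  obtains js where "mderiv \<alpha> = fold partial_deriv js" "\<And>j. count_list js j = \<alpha> j" "length js = mi_abs \<alpha>"
proof -
  let ?P = "\<lambda>js. \<forall>j. count_list js j = \<alpha> j"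
  obtain xs where "mset xs = Abs_multiset \<alpha>" using ex_mset by blast
  then have "count (mset xs) = \<alpha>" by (simp add: Abs_multiset_inverse)
  then have "?P xs" by (auto simp: count_mset fun_eq_iff)
  then have P: "?P (SOME js. ?P js)" by (rule someI)
  then show ?thesis
    using that[of "SOME js. ?P js"] by (auto simp: mderiv_def fun_eq_iff length_eq_sum_count_list mi_abs_def)
qed

definition mi_single :: "'n \<Rightarrow> nat \<Rightarrow> 'n \<Rightarrow> nat" where
  "mi_single j k = (\<lambda>i. if i = j then k else 0)"

lemma mi_abs_single [simp]: "mi_abs (mi_single j k) = k"
  by (simp add: mi_abs_def mi_single_def)

text \<open>Here the counts force the chosen list to be \<open>replicate k j\<close>, so these
  derivatives are iterates and the next one arises by differentiating once more in the same
  direction.\<close>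

lemma mderiv_single: "mderiv (mi_single j k) f = (partial_deriv j ^^ k) f"
proof -
  obtain js where js: "mderiv (mi_single j k) = fold partial_deriv js"
      "\<And>i. count_list js i = mi_single j k i" "length js = k"
    by (metis mderiv_eq_fold mi_abs_single)
  have "set js \<subseteq> {j}"
  proof
    fix i assume "i \<in> set js"
    then have "mi_single j k i \<noteq> 0" using js(2)[of i] by (metis count_list_0_iff)
    then show "i \<in> {j}" by (auto simp: mi_single_def split: if_splits)
  qed
  then have "js = replicate k j" using js(3) by (intro replicate_eqI) auto
  then show ?thesis by (simp add: js(1))
qed

lemma mderiv_add:
  "C_diff m f \<Longrightarrow> C_diff m g \<Longrightarrow> mi_abs \<alpha> \<le> m \<Longrightarrow>
    mderiv \<alpha> (\<lambda>x. f x + g x) = (\<lambda>x. mderiv \<alpha> f x + mderiv \<alpha> g x)"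
  by (rule mderiv_eq_fold[of \<alpha>]) (simp add: fold_partial_deriv_add)

lemma mderiv_scale:
  "C_diff m f \<Longrightarrow> mi_abs \<alpha> \<le> m \<Longrightarrow> mderiv \<alpha> (\<lambda>x. c * f x) = (\<lambda>x. c * mderiv \<alpha> f x)"
  by (rule mderiv_eq_fold[of \<alpha>]) (simp add: fold_partial_deriv_scale)

lemma C_diff_iterate: "C_diff (k + m) f \<Longrightarrow> C_diff m ((partial_deriv j ^^ k) f)"
proof (induction k arbitrary: m)
  case (Suc k)
  then have "C_diff (Suc m) ((partial_deriv j ^^ k) f)" by (metis add_Suc_shift)
  from C_diff_SucD[OF this, of j] show ?case by simp
qed simp

lemma prod_list_count: "prod_list (map f js) = (\<Prod>j\<in>UNIV. f j ^ count_list js j)"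
  for f :: "'n::finite \<Rightarrow> 'b::comm_monoid_mult"
proof (induction js)
  case (Cons a js)
  have "(\<Prod>j\<in>UNIV. f j ^ count_list (a # js) j) = (\<Prod>j\<in>UNIV. (if j = a then f j else 1) * f j ^ count_list js j)"
    by (intro prod.cong) auto
  then show ?case using Cons by (simp add: prod.distrib)
qed simp

text \<open>The sign \<open>s\<close> is 1 for the transform and -1 for its inverse; normalising
  constants are put into \<open>g\<close>.\<close>

definition FT :: "real \<Rightarrow> (real^'n::finite \<Rightarrow> complex) \<Rightarrow> real^'n \<Rightarrow> complex" where
  "FT s g \<xi> = (LINT x|lborel. g x * iexp (s * (x \<bullet> \<xi>)))"

lemma FT_scale: "FT s (\<lambda>x. c * g x) \<xi> = c * FT s g \<xi>"
  by (simp add: FT_def mult.assoc)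

lemma FT_integrable:
  assumes "integrable lborel g"
  shows "integrable lborel (\<lambda>x. g x * iexp (s * (x \<bullet> \<xi>)))"
proof -
  have [measurable]: "g \<in> borel_measurable borel" using borel_measurable_integrable[OF assms] by simp
  show ?thesis
    by (rule Bochner_Integration.integrable_bound[OF integrable_norm[OF assms]]) (auto simp: norm_mult)
qed

lemma FT_bound:
  assumes "integrable lborel g"
  shows "norm (FT s g \<xi>) \<le> (LINT x|lborel. norm (g x))"
  using integral_norm_bound[of lborel "\<lambda>x. g x * iexp (s * (x \<bullet> \<xi>))"]
  by (simp add: FT_def norm_mult)

lemma continuous_FT:
  assumes g: "integrable lborel g"
  shows "continuous_on UNIV (FT s g)"
proof -
  have [measurable]: "g \<in> borel_measurable borel" using borel_measurable_integrable[OF g] by simp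
  have "(FT s g \<longlongrightarrow> FT s g a) (at a)" for a
    unfolding FT_def
  proof (rule integral_dominated_tendsto_at[OF _ _ integrable_norm[OF g] _ zero_less_one])
    show "((\<lambda>t. g x * iexp (s * (x \<bullet> t))) \<longlongrightarrow> g x * iexp (s * (x \<bullet> a))) (at a)" for x
      by (intro tendsto_intros)
  qed (auto simp: norm_mult)
  then show ?thesis by (simp add: continuous_on_def)
qed

text \<open>Differentiation under the integral sign: a chord of the unit circle is no longer than
  its arc, so the difference quotients are dominated by
  \<open>\<bar>s * x $ j\<bar> * norm (g x)\<close>.\<close>

lemma FT_has_partial_deriv:
  assumes g: "integrable lborel g" and gj: "integrable lborel (\<lambda>x. of_real (x $ j) * g x)"
  shows "((\<lambda>t. FT s g (\<xi> + t *\<^sub>R axis j 1)) has_vector_derivative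
          FT s (\<lambda>x. \<i> * of_real (s * x $ j) * g x) \<xi>) (at 0)"
  unfolding has_vector_derivative_at_0_iff
proof -
  have [measurable]: "g \<in> borel_measurable borel" using borel_measurable_integrable[OF g] by simp
  let ?e = "\<lambda>t x. iexp (s * (x \<bullet> (\<xi> + t *\<^sub>R axis j 1)))"
  have ip: "x \<bullet> (\<xi> + t *\<^sub>R axis j 1) = x \<bullet> \<xi> + t * x $ j" for x t
    by (simp add: inner_add_right inner_axis)
  have eq: "(1 / t) *\<^sub>R (FT s g (\<xi> + t *\<^sub>R axis j 1) - FT s g (\<xi> + 0 *\<^sub>R axis j 1))
      = (LINT x|lborel. g x * ((1 / t) *\<^sub>R (?e t x - ?e 0 x)))" for t
    unfolding FT_def
    by (subst Bochner_Integration.integral_diff[OF FT_integrable[OF g] FT_integrable[OF g], symmetric],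
        subst integral_scaleR_right[symmetric]) (simp add: right_diff_distrib scaleR_diff_right)
  have "((\<lambda>t. LINT x|lborel. g x * ((1 / t) *\<^sub>R (?e t x - ?e 0 x))) \<longlongrightarrow>
      (LINT x|lborel. g x * ((\<i> * of_real (s * x $ j)) * ?e 0 x))) (at 0)"
  proof (rule integral_dominated_tendsto_at[OF _ _ integrable_norm[OF integrable_mult_right[OF gj, of "of_real s"]] _ zero_less_one])
    fix x :: "real^'a"
    have "((\<lambda>t. ?e t x) has_vector_derivative (\<i> * of_real (s * x $ j)) * ?e 0 x) (at 0)"
    proof -
      have "((\<lambda>z. exp (\<i> * (of_real s * (of_real (x \<bullet> \<xi>) + z * of_real (x $ j))))) has_field_derivative
          (\<i> * of_real (s * x $ j)) * ?e 0 x) (at (of_real 0))"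
        unfolding ip by (auto intro!: derivative_eq_intros simp: algebra_simps)
      from has_vector_derivative_real_field[OF this] show ?thesis
        unfolding ip by simp
    qed
    then show "((\<lambda>t. g x * ((1 / t) *\<^sub>R (?e t x - ?e 0 x))) \<longlongrightarrow> g x * ((\<i> * of_real (s * x $ j)) * ?e 0 x)) (at 0)"
      unfolding has_vector_derivative_at_0_iff by (intro tendsto_intros)
    fix t :: real assume t: "t \<noteq> 0"
    have "norm (?e t x - ?e 0 x) \<le> \<bar>t\<bar> * \<bar>s * x $ j\<bar>"
      using norm_iexp_diff_le[of "s * (x \<bullet> (\<xi> + t *\<^sub>R axis j 1))" "s * (x \<bullet> (\<xi> + 0 *\<^sub>R axis j 1))"]
      unfolding ip by (simp add: algebra_simps abs_mult)
    then have "\<bar>1 / t\<bar> * norm (?e t x - ?e 0 x) \<le> \<bar>1 / t\<bar> * (\<bar>t\<bar> * \<bar>s * x $ j\<bar>)"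
      by (rule mult_left_mono) simp
    then have "norm ((1 / t) *\<^sub>R (?e t x - ?e 0 x)) \<le> \<bar>s * x $ j\<bar>"
      unfolding norm_scaleR using t by simp
    then have "norm (g x) * norm ((1 / t) *\<^sub>R (?e t x - ?e 0 x)) \<le> norm (g x) * \<bar>s * x $ j\<bar>"
      by (rule mult_left_mono) simp
    then show "norm (g x * ((1 / t) *\<^sub>R (?e t x - ?e 0 x))) \<le> norm (of_real s * (of_real (x $ j) * g x))"
      by (simp only: norm_mult norm_of_real abs_mult mult_ac)
  qed auto
  also have "(LINT x|lborel. g x * ((\<i> * of_real (s * x $ j)) * ?e 0 x)) = FT s (\<lambda>x. \<i> * of_real (s * x $ j) * g x) \<xi>"
    by (simp add: FT_def mult_ac)
  finally show "((\<lambda>t. (1 / t) *\<^sub>R (FT s g (\<xi> + t *\<^sub>R axis j 1) - FT s g (\<xi> + 0 *\<^sub>R axis j 1)))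
      \<longlongrightarrow> FT s (\<lambda>x. \<i> * of_real (s * x $ j) * g x) \<xi>) (at 0)"
    unfolding eq .
qed

text \<open>What repeated differentiation of \<open>FT s g\<close> consumes: the class is closed
  under multiplication by coordinates.\<close>

definition rapid :: "(real^'n::finite \<Rightarrow> complex) \<Rightarrow> bool" where
  "rapid g \<longleftrightarrow> (\<forall>\<beta>. integrable lborel (\<lambda>x. of_real (mi_power x \<beta>) * g x))"

lemma mi_power_zero [simp]: "mi_power x (\<lambda>_. 0) = 1"
  by (simp add: mi_power_def)

lemma mi_power_Suc: "mi_power x (\<beta>(j := Suc (\<beta> j))) = x $ j * mi_power x \<beta>"
proof -
  have "mi_power x (\<beta>(j := Suc (\<beta> j))) = (\<Prod>i\<in>UNIV. (if i = j then x $ i else 1) * x $ i ^ \<beta> i)"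
    unfolding mi_power_def by (intro prod.cong) auto
  then show ?thesis by (simp add: prod.distrib mi_power_def)
qed

lemma rapid_integrable: "rapid g \<Longrightarrow> integrable lborel g"
  unfolding rapid_def by (drule spec[of _ "\<lambda>_. 0"]) simp

lemma rapid_coord:
  assumes "rapid g"
  shows "rapid (\<lambda>x. c * of_real (x $ j) * g x)"
  unfolding rapid_def
proof
  fix \<beta>
  have "integrable lborel (\<lambda>x. c * (of_real (mi_power x (\<beta>(j := Suc (\<beta> j)))) * g x))"
    using assms unfolding rapid_def by (intro integrable_mult_right) blast
  then show "integrable lborel (\<lambda>x. of_real (mi_power x \<beta>) * (c * of_real (x $ j) * g x))"
    unfolding mi_power_Suc by (simp add: mult_ac)
qed

lemma rapid_scale: "rapid g \<Longrightarrow> rapid (\<lambda>x. c * g x)"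
  unfolding rapid_def by (simp add: mult.left_commute)

lemma rapid_FT_has_partial_deriv:
  assumes "rapid g"
  shows "((\<lambda>t. FT s g (\<xi> + t *\<^sub>R axis j 1)) has_vector_derivative
          FT s (\<lambda>x. \<i> * of_real (s * x $ j) * g x) \<xi>) (at 0)"
  using FT_has_partial_deriv[OF rapid_integrable[OF assms], of j] rapid_integrable[OF rapid_coord[OF assms, of 1 j]]
  by simp

lemma rapid_partial_deriv_FT:
  "rapid g \<Longrightarrow> partial_deriv j (FT s g) = FT s (\<lambda>x. \<i> * of_real (s * x $ j) * g x)"
  by (intro ext partial_deriv_eqI rapid_FT_has_partial_deriv)

lemma rapid_coord':
  "rapid g \<Longrightarrow> rapid (\<lambda>x. \<i> * of_real (s * x $ j) * g x)"
  using rapid_coord[of g "\<i> * of_real s" j] by (simp add: mult.assoc)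

lemma C_diff_FT: "rapid g \<Longrightarrow> C_diff m (FT s g)"
proof (induction m arbitrary: g)
  case 0 then show ?case by (simp add: continuous_FT rapid_integrable)
next
  case (Suc m)
  then show ?case
    using differentiableI_vector[OF rapid_FT_has_partial_deriv[OF Suc.prems]] Suc.IH[OF rapid_coord'[OF Suc.prems]]
    by (simp add: continuous_FT rapid_integrable rapid_partial_deriv_FT del: of_real_mult)
qed

lemma fold_partial_deriv_FT:
  "rapid g \<Longrightarrow> fold partial_deriv js (FT s g) =
     FT s (\<lambda>x. prod_list (map (\<lambda>j. \<i> * of_real (s * x $ j)) js) * g x)"
proof (induction js arbitrary: g)
  case (Cons j js)
  then show ?case
    using Cons.IH[OF rapid_coord'[OF Cons.prems]] by (simp add: rapid_partial_deriv_FT mult_ac)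
qed simp

text \<open>Each partial derivative brings down a factor \<open>\<i> * of_real (s * x $ j)\<close>.
  These factors commute, so only the counts of the chosen list survive.\<close>

lemma mderiv_FT:
  assumes "rapid g"
  shows "mderiv \<alpha> (FT s g) = FT s (\<lambda>x. (\<Prod>j\<in>UNIV. (\<i> * of_real (s * x $ j)) ^ \<alpha> j) * g x)"
proof -
  obtain js where "mderiv \<alpha> = fold partial_deriv js" "\<And>j. count_list js j = \<alpha> j"
    using mderiv_eq_fold by blast
  then show ?thesis using fold_partial_deriv_FT[OF assms, of js s] by (simp add: prod_list_count)
qed

section \<open>Decay and integration by parts\<close>

text \<open>The l1 norm, because its exponential is a product over the coordinates.\<close>

definition asum :: "real^'n::finite \<Rightarrow> real" where
  "asum x = (\<Sum>j\<in>UNIV. \<bar>x $ j\<bar>)"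

lemma asum_nonneg: "asum x \<ge> 0"
  by (simp add: asum_def sum_nonneg)

lemma coord_le_asum: "\<bar>x $ j\<bar> \<le> asum x"
  unfolding asum_def by (rule member_le_sum) auto

lemma asum_triangle: "asum (x + y) \<le> asum x + asum y"
  unfolding asum_def sum.distrib[symmetric] by (intro sum_mono) (simp add: abs_triangle_ineq)

lemma asum_axis: "asum (t *\<^sub>R axis j 1) = \<bar>t\<bar>"
proof -
  have "asum (t *\<^sub>R axis j 1) = (\<Sum>i\<in>UNIV. if i = j then \<bar>t\<bar> else 0)"
    unfolding asum_def by (intro sum.cong) (auto simp: axis_def)
  then show ?thesis by simp
qed

lemma borel_measurable_asum [measurable]: "asum \<in> borel_measurable borel"
  unfolding asum_def[abs_def] by measurable

section \<open>Comparing the exponential with single terms of its series\<close>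

lemma power_le_fact_exp: "t \<ge> 0 \<Longrightarrow> t ^ k \<le> fact k * exp t" for t :: real
proof -
  assume t: "t \<ge> 0"
  have "t ^ k /\<^sub>R fact k \<le> exp t"
    unfolding exp_def
    using sum_le_suminf[OF summable_exp_generic[of t], of "{k}"] t by simp
  then show ?thesis by (simp add: field_simps)
qed

text \<open>If every term at \<open>2 * t\<close> were at most a third of \<open>exp t\<close>, the
  series at \<open>t\<close> would be dominated by a geometric series of ratio 1/2 with sum
  \<open>exp t * 2 / 3\<close>, which is impossible. The doubled argument creates the ratio; 3 is a
  constant above the geometric sum 2.\<close>

lemma exp_le_exp_term:
  fixes t :: real
  assumes "t \<ge> 0"
  obtains k where "exp t \<le> 3 * ((2 * t) ^ k / fact k)"
proof (rule ccontr)
  assume no: "\<not> thesis"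
  then have *: "(2 * t) ^ k / fact k \<le> exp t / 3" for k
    using that[of k] by linarith
  have "t ^ k /\<^sub>R fact k \<le> (exp t / 3) * (1 / 2) ^ k" for k
    using *[of k] by (simp add: power_mult_distrib field_simps)
  moreover have "summable (\<lambda>k. (exp t / 3) * (1 / 2 :: real) ^ k)"
    by (intro summable_mult summable_geometric) simp
  ultimately have "(\<Sum>k. t ^ k /\<^sub>R fact k) \<le> (\<Sum>k. (exp t / 3) * (1 / 2) ^ k)"
    using summable_exp_generic[of t] by (intro suminf_le) auto
  also have "\<dots> = (exp t / 3) * 2"
    using suminf_geometric[of "1/2::real"] by (subst suminf_mult) (auto intro: summable_geometric)
  finally have "exp t \<le> exp t * 2 / 3" by (simp add: exp_def)
  then show False using exp_gt_zero[of t] by linarith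
qed

lemma mi_fact_pos: "mi_fact \<beta> > 0"
  unfolding mi_fact_def by (intro prod_pos) auto

lemma abs_mi_power: "\<bar>mi_power x \<beta>\<bar> = (\<Prod>j\<in>UNIV. \<bar>x $ j\<bar> ^ \<beta> j)" for x :: "real^'n::finite"
  by (simp add: mi_power_def abs_prod power_abs)

lemma borel_measurable_mi_power [measurable]: "(\<lambda>x::real^'n::finite. mi_power x \<beta>) \<in> borel_measurable borel"
  unfolding mi_power_def by measurable

text \<open>The estimate behind \<open>G_norm\<close> for a single derivative \<open>u\<close>, with
  the denominator cleared and a real constant in place of an extended one.\<close>

definition seq_decay :: "(real^'n::finite \<Rightarrow> real) \<Rightarrow> real \<Rightarrow> (real^'n \<Rightarrow> complex) \<Rightarrow> bool" where
  "seq_decay h K u \<longleftrightarrow> (\<forall>x \<beta>. (\<Prod>j\<in>UNIV. \<bar>x $ j\<bar> ^ \<beta> j) * norm (u x) \<le> K * (mi_fact \<beta> * exp (- h (mi_vec \<beta>))))"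

text \<open>Decay faster than every exponential. As \<open>R\<close> is arbitrary, multiplication by
  a function of exponential growth only shifts \<open>R\<close>; the factor \<open>cweight\<close>
  is included so that integrability is immediate.\<close>

definition exp_decay :: "(real^'n::finite \<Rightarrow> complex) \<Rightarrow> bool" where
  "exp_decay u \<longleftrightarrow> u \<in> borel_measurable borel \<and>
     (\<forall>R\<ge>0. \<exists>C\<ge>0. \<forall>x. norm (u x) * exp (R * asum x) \<le> C * cweight x)"

lemma seq_decay_nonneg:
  fixes u :: "real^'n::finite \<Rightarrow> complex"
  assumes "seq_decay h K u"
  shows "K \<ge> 0"
proof -
  have "0 \<le> norm (u 0)" by simp
  also have "norm (u 0) \<le> K * (mi_fact (\<lambda>_::'n. 0) * exp (- h (mi_vec (\<lambda>_::'n. 0))))"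
    using assms[unfolded seq_decay_def, rule_format, of 0 "\<lambda>_::'n. 0"] by simp
  finally have "0 \<le> K * (mi_fact (\<lambda>_::'n. 0) * exp (- h (mi_vec (\<lambda>_::'n. 0))))" .
  moreover have "mi_fact (\<lambda>_::'n. 0) * exp (- h (mi_vec (\<lambda>_::'n. 0))) > 0"
    by (simp add: mi_fact_pos)
  ultimately show ?thesis by (metis mult_neg_pos not_le)
qed

context weight
begin

text \<open>Applying the hypothesis with \<open>\<beta> j + 2\<close> in place of \<open>\<beta> j\<close> in those coordinates where
  \<open>\<bar>x $ j\<bar> > 1\<close> produces the integrable factor \<open>cweight\<close>.\<close>

lemma seq_decay_cweight:
  assumes u: "seq_decay h K u"
  shows "(\<Prod>j\<in>UNIV. \<bar>x $ j\<bar> ^ \<beta> j) * norm (u x) \<le>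
    8 ^ CARD('n) * K * cweight x * (mi_fact \<beta> * 2 ^ mi_abs \<beta> * exp (- h (mi_vec \<beta>)))"
proof -
  define \<beta>' where "\<beta>' = (\<lambda>j. if \<bar>x $ j\<bar> \<le> 1 then \<beta> j else \<beta> j + 2)"
  have K: "K \<ge> 0" by (rule seq_decay_nonneg[OF u])
  have "(\<Prod>j\<in>UNIV. 1 + (x $ j)\<^sup>2) * (\<Prod>j\<in>UNIV. \<bar>x $ j\<bar> ^ \<beta> j) = (\<Prod>j\<in>UNIV. (1 + (x $ j)\<^sup>2) * \<bar>x $ j\<bar> ^ \<beta> j)"
    by (simp add: prod.distrib)
  also have "\<dots> \<le> (\<Prod>j\<in>UNIV. 2 * \<bar>x $ j\<bar> ^ \<beta>' j)"
  proof (intro prod_mono conjI)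
    fix j
    show "0 \<le> (1 + (x $ j)\<^sup>2) * \<bar>x $ j\<bar> ^ \<beta> j" by simp
    show "(1 + (x $ j)\<^sup>2) * \<bar>x $ j\<bar> ^ \<beta> j \<le> 2 * \<bar>x $ j\<bar> ^ \<beta>' j"
    proof (cases "\<bar>x $ j\<bar> \<le> 1")
      case True
      then have "(x $ j)\<^sup>2 \<le> 1" by (simp add: abs_square_le_1)
      then show ?thesis using True by (auto simp: \<beta>'_def intro!: mult_right_mono)
    next
      case False
      then have "1 \<le> (x $ j)\<^sup>2" by (metis abs_square_le_1 abs_le_square_iff abs_one linorder_linear one_power2)
      then have "(1 + (x $ j)\<^sup>2) * \<bar>x $ j\<bar> ^ \<beta> j \<le> (2 * (x $ j)\<^sup>2) * \<bar>x $ j\<bar> ^ \<beta> j"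
        by (intro mult_right_mono) auto
      then show ?thesis using False by (simp add: \<beta>'_def power2_eq_square mult_ac flip: abs_mult)
    qed
  qed
  also have "\<dots> = 2 ^ CARD('n) * (\<Prod>j\<in>UNIV. \<bar>x $ j\<bar> ^ \<beta>' j)" by (simp add: prod.distrib)
  finally have 1: "(\<Prod>j\<in>UNIV. 1 + (x $ j)\<^sup>2) * (\<Prod>j\<in>UNIV. \<bar>x $ j\<bar> ^ \<beta> j) \<le> 2 ^ CARD('n) * (\<Prod>j\<in>UNIV. \<bar>x $ j\<bar> ^ \<beta>' j)" .
  have cw: "cweight x * (\<Prod>j\<in>UNIV. 1 + (x $ j)\<^sup>2) = 1"
    unfolding cweight_def prod.distrib[symmetric]
    by (rule prod.neutral) (auto simp: add_nonneg_eq_0_iff)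
  have "mi_fact \<beta>' \<le> (\<Prod>j\<in>UNIV. fact (\<beta> j) * (4 * 2 ^ \<beta> j))"
    unfolding mi_fact_def
  proof (intro prod_mono conjI)
    fix j
    \<comment> \<open>This product is the quotient of the factorials of \<open>k + 2\<close> and
      \<open>k\<close>. The 4 per coordinate, together with the 2 spent on
      \<open>1 + (x $ j)\<^sup>2\<close>, makes up the constant 8.\<close>
    have 4: "(real k + 1) * (real k + 2) \<le> 4 * 2 ^ k" for k
    proof (induction k)
      case (Suc k)
      have "(real (Suc k) + 1) * (real (Suc k) + 2) \<le> 2 * ((real k + 1) * (real k + 2)) + 2"
        by (simp add: algebra_simps)
      show ?case
      proof (cases "k = 0")
        case False
        then have "k \<ge> 1" by simp
        then have "real k * real k \<ge> real k * 1" by (intro mult_left_mono) auto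
        moreover have "real k \<ge> 1" using \<open>k \<ge> 1\<close> by simp
        ultimately have "2 \<le> real k + real k * real k" by linarith
        then have "(real (Suc k) + 1) * (real (Suc k) + 2) \<le> 2 * ((real k + 1) * (real k + 2))"
          by (simp add: algebra_simps)
        then show ?thesis using Suc by simp
      qed simp
    qed simp
    have "fact (\<beta>' j) \<le> fact (\<beta> j) * ((real (\<beta> j) + 1) * (real (\<beta> j) + 2))"
    proof (cases "\<bar>x $ j\<bar> \<le> 1")
      case True
      have "1 * 1 \<le> (real (\<beta> j) + 1) * (real (\<beta> j) + 2)" by (intro mult_mono) auto
      then show ?thesis using True by (simp add: \<beta>'_def)
    qed (simp add: \<beta>'_def algebra_simps)
    also have "\<dots> \<le> fact (\<beta> j) * (4 * 2 ^ \<beta> j)" by (intro mult_left_mono 4) simp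
    finally show "(fact (\<beta>' j)::real) \<le> fact (\<beta> j) * (4 * 2 ^ \<beta> j)" .
  qed simp
  also have "\<dots> = 4 ^ CARD('n) * (mi_fact \<beta> * 2 ^ mi_abs \<beta>)"
    by (simp add: prod.distrib mi_fact_def mi_abs_def power_sum)
  finally have 2: "mi_fact \<beta>' \<le> 4 ^ CARD('n) * (mi_fact \<beta> * 2 ^ mi_abs \<beta>)" .
  \<comment> \<open>\<open>\<beta>'\<close> dominates \<open>\<beta>\<close> and the weight is
    monotone, so raising exponents does no harm here.\<close>
  have 3: "exp (- h (mi_vec \<beta>')) \<le> exp (- h (mi_vec \<beta>))"
    by (simp, rule mono) (auto simp: mi_vec_def \<beta>'_def nonneg_orthant_def)
  have "(\<Prod>j\<in>UNIV. \<bar>x $ j\<bar> ^ \<beta> j) * norm (u x) = cweight x * (((\<Prod>j\<in>UNIV. 1 + (x $ j)\<^sup>2) * (\<Prod>j\<in>UNIV. \<bar>x $ j\<bar> ^ \<beta> j)) * norm (u x))"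
    using cw by (simp flip: mult.assoc)
  also have "\<dots> \<le> cweight x * ((2 ^ CARD('n) * (\<Prod>j\<in>UNIV. \<bar>x $ j\<bar> ^ \<beta>' j)) * norm (u x))"
    using 1 cweight_pos[of x] by (intro mult_left_mono mult_right_mono) auto
  also have "\<dots> = cweight x * 2 ^ CARD('n) * ((\<Prod>j\<in>UNIV. \<bar>x $ j\<bar> ^ \<beta>' j) * norm (u x))"
    by simp
  also have "\<dots> \<le> cweight x * 2 ^ CARD('n) * (K * (mi_fact \<beta>' * exp (- h (mi_vec \<beta>'))))"
    using u cweight_pos[of x] unfolding seq_decay_def by (intro mult_left_mono) auto
  also have "\<dots> \<le> cweight x * 2 ^ CARD('n) * (K * ((4 ^ CARD('n) * (mi_fact \<beta> * 2 ^ mi_abs \<beta>)) * exp (- h (mi_vec \<beta>))))"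
    using 2 3 K cweight_pos[of x] mi_fact_pos[of \<beta>] by (intro mult_left_mono mult_mono) auto
  also have "\<dots> = (2 ^ CARD('n) * 4 ^ CARD('n)) * K * cweight x * (mi_fact \<beta> * 2 ^ mi_abs \<beta> * exp (- h (mi_vec \<beta>)))"
    by (simp add: mult_ac)
  also have "(2::real) ^ CARD('n) * 4 ^ CARD('n) = 8 ^ CARD('n)" by (simp flip: power_mult_distrib)
  finally show ?thesis .
qed

end

text \<open>Two steps along the family: the extraction of \<open>cweight\<close> and the doubled
  argument in \<open>exp_le_exp_term\<close> each cost one.\<close>

locale weight_triple = P: weight_pair h h' \<gamma> + Q: weight_pair h' h'' \<gamma>'
  for h h' h'' :: "real^'n::finite \<Rightarrow> real" and \<gamma> \<gamma>' :: real
begin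

text \<open>The exponents \<open>k j\<close> depend on \<open>r\<close> and \<open>x\<close>, one
  dominant term per coordinate. The hypothesis is used at the index \<open>k\<close>, so that the
  factorials cancel. Two powers of 2 remain and each consumes one step; the power of
  \<open>r\<close> times \<open>exp (- h'' (mi_vec k))\<close> is bounded through the conjugate. The
  constant is 24 = 3 * 8.\<close>

lemma seq_decay_exp:
  assumes u: "seq_decay h K u" and r: "\<And>j. r $ j \<ge> 0"
  shows "norm (u x) * exp (\<Sum>j\<in>UNIV. r $ j * \<bar>x $ j\<bar>) \<le>
    24 ^ CARD('n) * exp (\<gamma> + \<gamma>') * K * cweight x * exp (phi h'' r)"
proof -
  have "\<exists>k. exp (r $ j * \<bar>x $ j\<bar>) \<le> 3 * ((2 * (r $ j * \<bar>x $ j\<bar>)) ^ k / fact k)" for j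
    using exp_le_exp_term[of "r $ j * \<bar>x $ j\<bar>"] r[of j] by (metis abs_ge_zero mult_nonneg_nonneg)
  then obtain k where k: "\<And>j. exp (r $ j * \<bar>x $ j\<bar>) \<le> 3 * ((2 * (r $ j * \<bar>x $ j\<bar>)) ^ k j / fact (k j))"
    by metis
  have K: "K \<ge> 0" by (rule seq_decay_nonneg[OF u])
  let ?R = "\<Prod>j\<in>UNIV. \<bar>r $ j\<bar> ^ k j" and ?X = "\<Prod>j\<in>UNIV. \<bar>x $ j\<bar> ^ k j"
  have R0: "?R \<ge> 0" by (intro prod_nonneg) auto
  have "exp (\<Sum>j\<in>UNIV. r $ j * \<bar>x $ j\<bar>) = (\<Prod>j\<in>UNIV. exp (r $ j * \<bar>x $ j\<bar>))"
    by (simp add: exp_sum)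
  also have "\<dots> \<le> (\<Prod>j\<in>UNIV. 3 * ((2 * (r $ j * \<bar>x $ j\<bar>)) ^ k j / fact (k j)))"
    by (intro prod_mono conjI k) auto
  also have "\<dots> = (\<Prod>j\<in>UNIV. 3 * 2 ^ k j * (\<bar>r $ j\<bar> ^ k j * \<bar>x $ j\<bar> ^ k j) / fact (k j))"
    using r by (intro prod.cong) (auto simp: power_mult_distrib)
  also have "\<dots> = 3 ^ CARD('n) * 2 ^ mi_abs k * (?R * ?X) / mi_fact k"
    by (simp add: prod.distrib prod_dividef mi_fact_def mi_abs_def power_sum)
  finally have "norm (u x) * exp (\<Sum>j\<in>UNIV. r $ j * \<bar>x $ j\<bar>)
      \<le> norm (u x) * (3 ^ CARD('n) * 2 ^ mi_abs k * (?R * ?X) / mi_fact k)"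
    by (intro mult_left_mono) auto
  also have "\<dots> = (3 ^ CARD('n) * 2 ^ mi_abs k * ?R / mi_fact k) * (?X * norm (u x))" by simp
  also have "\<dots> \<le> (3 ^ CARD('n) * 2 ^ mi_abs k * ?R / mi_fact k) *
      (8 ^ CARD('n) * K * cweight x * (mi_fact k * 2 ^ mi_abs k * exp (- h (mi_vec k))))"
    using mi_fact_pos[of k] R0 by (intro mult_left_mono P.A.seq_decay_cweight u) auto
  also have "\<dots> = (3 ^ CARD('n) * 8 ^ CARD('n)) * K * cweight x * (?R * (2 ^ mi_abs k * (2 ^ mi_abs k * exp (- h (mi_vec k)))))"
    using mi_fact_pos[of k] by simp
  also have "\<dots> \<le> (3 ^ CARD('n) * 8 ^ CARD('n)) * K * cweight x * (?R * (2 ^ mi_abs k * (exp \<gamma> * exp (- h' (mi_vec k)))))"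
    using K R0 cweight_pos[of x] by (intro mult_left_mono P.exp_weight_le) auto
  also have "\<dots> = (3 ^ CARD('n) * 8 ^ CARD('n)) * K * cweight x * (exp \<gamma> * ?R * (2 ^ mi_abs k * exp (- h' (mi_vec k))))"
    by simp
  also have "\<dots> \<le> (3 ^ CARD('n) * 8 ^ CARD('n)) * K * cweight x * (exp \<gamma> * ?R * (exp \<gamma>' * exp (- h'' (mi_vec k))))"
    using K R0 cweight_pos[of x] by (intro mult_left_mono Q.exp_weight_le) auto
  also have "\<dots> = (3 ^ CARD('n) * 8 ^ CARD('n)) * K * cweight x * (exp (\<gamma> + \<gamma>') * (?R * exp (- h'' (mi_vec k))))"
    by (simp add: exp_add)
  also have "\<dots> \<le> (3 ^ CARD('n) * 8 ^ CARD('n)) * K * cweight x * (exp (\<gamma> + \<gamma>') * exp (phi h'' r))"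
    using K cweight_pos[of x] r by (intro mult_left_mono Q.B.prod_power_le_exp_phi) auto
  also have "(3::real) ^ CARD('n) * 8 ^ CARD('n) = 24 ^ CARD('n)" by (simp flip: power_mult_distrib)
  finally show ?thesis by (simp add: mult_ac)
qed

lemma seq_decay_imp_exp_decay:
  assumes u: "seq_decay h K u" and [measurable]: "u \<in> borel_measurable borel"
  shows "exp_decay u"
  unfolding exp_decay_def
proof (intro conjI allI impI)
  fix R :: real assume R: "R \<ge> 0"
  let ?C = "24 ^ CARD('n) * exp (\<gamma> + \<gamma>') * K * exp (phi h'' (\<chi> j. R))"
  have "norm (u x) * exp (R * asum x) \<le> ?C * cweight x" for x
    using seq_decay_exp[OF u, of "\<chi> j. R" x] R
    by (simp add: asum_def sum_distrib_left mult_ac)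
  moreover have "?C \<ge> 0" using seq_decay_nonneg[OF u] by simp
  ultimately show "\<exists>C\<ge>0. \<forall>x. norm (u x) * exp (R * asum x) \<le> C * cweight x" by blast
qed measurable

end

lemma exp_decayD:
  assumes "exp_decay u" "R \<ge> 0"
  obtains C where "C \<ge> 0" "\<And>x. norm (u x) * exp (R * asum x) \<le> C * cweight x"
  using assms unfolding exp_decay_def by blast

lemma exp_decay_measurable [measurable_dest]: "exp_decay u \<Longrightarrow> u \<in> borel_measurable borel"
  unfolding exp_decay_def by blast

lemma exp_decay_mult:
  assumes u: "exp_decay u" and [measurable]: "v \<in> borel_measurable borel"
    and v: "\<And>x. norm (v x) \<le> A * exp (B * asum x)" and AB: "A \<ge> 0" "B \<ge> 0"
  shows "exp_decay (\<lambda>x. v x * u x)"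
  unfolding exp_decay_def
proof (intro conjI allI impI)
  show "(\<lambda>x. v x * u x) \<in> borel_measurable borel" using u by measurable
  fix R :: real assume R: "R \<ge> 0"
  then obtain C where C: "C \<ge> 0" "\<And>x. norm (u x) * exp ((R + B) * asum x) \<le> C * cweight x"
    using exp_decayD[OF u, of "R + B"] AB by auto
  have "norm (v x * u x) * exp (R * asum x) \<le> (A * C) * cweight x" for x
  proof -
    have "norm (v x * u x) * exp (R * asum x) \<le> (A * exp (B * asum x)) * (norm (u x) * exp (R * asum x))"
      using v[of x] by (simp add: norm_mult mult_right_mono flip: mult.assoc)
    also have "\<dots> = A * (norm (u x) * exp ((R + B) * asum x))"
    proof -
      have "exp ((R + B) * asum x) = exp (B * asum x) * exp (R * asum x)"
        by (simp add: distrib_right add.commute flip: exp_add)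
      then show ?thesis by simp
    qed
    also have "\<dots> \<le> A * (C * cweight x)" using C(2) AB by (intro mult_left_mono) auto
    finally show ?thesis by (simp add: mult_ac)
  qed
  then show "\<exists>C\<ge>0. \<forall>x. norm (v x * u x) * exp (R * asum x) \<le> C * cweight x"
    using C(1) AB by (intro exI[of _ "A * C"]) auto
qed

lemma exp_decay_add:
  assumes u: "exp_decay u" and v: "exp_decay v"
  shows "exp_decay (\<lambda>x. u x + v x)"
  unfolding exp_decay_def
proof (intro conjI allI impI)
  show "(\<lambda>x. u x + v x) \<in> borel_measurable borel" using u v by measurable
  fix R :: real assume R: "R \<ge> 0"
  obtain C D where C: "C \<ge> 0" "\<And>x. norm (u x) * exp (R * asum x) \<le> C * cweight x"
    and D: "D \<ge> 0" "\<And>x. norm (v x) * exp (R * asum x) \<le> D * cweight x"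
    using exp_decayD[OF u R] exp_decayD[OF v R] by metis
  have "norm (u x + v x) * exp (R * asum x) \<le> (C + D) * cweight x" for x
  proof -
    have "norm (u x + v x) * exp (R * asum x) \<le> (norm (u x) + norm (v x)) * exp (R * asum x)"
      by (intro mult_right_mono norm_triangle_ineq) auto
    with C(2)[of x] D(2)[of x] show ?thesis by (simp add: distrib_right)
  qed
  then show "\<exists>C\<ge>0. \<forall>x. norm (u x + v x) * exp (R * asum x) \<le> C * cweight x"
    using C(1) D(1) by (intro exI[of _ "C + D"]) auto
qed

lemma prod_coord_le_exp: "(\<Prod>j\<in>UNIV. \<bar>x $ j\<bar> ^ \<beta> j) \<le> mi_fact \<beta> * exp (asum x)"
proof -
  have "(\<Prod>j\<in>UNIV. \<bar>x $ j\<bar> ^ \<beta> j) \<le> (\<Prod>j\<in>UNIV. fact (\<beta> j) * exp \<bar>x $ j\<bar>)"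
    by (intro prod_mono conjI power_le_fact_exp) auto
  then show ?thesis by (simp add: prod.distrib mi_fact_def asum_def exp_sum)
qed

lemma exp_decay_const: "exp_decay u \<Longrightarrow> exp_decay (\<lambda>x. c * u x)"
  by (rule exp_decay_mult[where A="norm c" and B=0]) auto

lemma exp_decay_mi_power: "exp_decay u \<Longrightarrow> exp_decay (\<lambda>x. of_real (mi_power x \<beta>) * u x)"
  by (rule exp_decay_mult[where A="mi_fact \<beta>" and B=1])
    (use mi_fact_pos[of \<beta>] prod_coord_le_exp[of _ \<beta>] in \<open>auto simp: abs_mi_power less_imp_le\<close>)

lemma exp_decay_coord: "exp_decay u \<Longrightarrow> exp_decay (\<lambda>x. of_real (x $ j) * u x)"
proof (rule exp_decay_mult[where A=1 and B=1])
  show "norm (complex_of_real (x $ j)) \<le> 1 * exp (1 * asum x)" for x :: "real^'a"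
  proof -
    have "\<bar>x $ j\<bar> \<le> exp (asum x)"
      using coord_le_asum[of x j] exp_ge_add_one_self[of "asum x"] by linarith
    then show ?thesis by simp
  qed
qed auto

lemma exp_decay_integrable:
  assumes u: "exp_decay u"
  shows "integrable lborel u"
proof -
  obtain C where C: "C \<ge> 0" "\<And>x. norm (u x) * exp (0 * asum x) \<le> C * cweight x"
    using exp_decayD[OF u, of 0] by auto
  have [measurable]: "u \<in> borel_measurable borel" using u by measurable
  show ?thesis
    by (rule Bochner_Integration.integrable_bound[OF integrable_mult_right[OF integrable_cweight, of C]])
      (use C in \<open>auto intro!: AE_I2 simp: abs_mult abs_of_pos[OF cweight_pos]\<close>)
qed

lemma exp_decay_rapid: "exp_decay u \<Longrightarrow> rapid u"
  unfolding rapid_def by (blast intro: exp_decay_integrable exp_decay_mi_power)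

section \<open>The Fourier-Laplace transform of a decaying function\<close>

definition cdot :: "complex^'n::finite \<Rightarrow> real^'n \<Rightarrow> complex" where
  "cdot z x = (\<Sum>j\<in>UNIV. z $ j * of_real (x $ j))"

lemma borel_measurable_cdot [measurable]: "cdot z \<in> borel_measurable borel"
  unfolding cdot_def[abs_def] by measurable

lemma cdot_add: "cdot z (x + y) = cdot z x + cdot z y"
  and cdot_add_left: "cdot (z + w) x = cdot z x + cdot w x"
  and cdot_scale_left: "cdot (c *s z) x = c * cdot z x"
  by (simp_all add: cdot_def algebra_simps sum.distrib sum_distrib_left)

lemma cdot_axis: "cdot z (t *\<^sub>R axis j 1) = z $ j * of_real t"
proof -
  have "cdot z (t *\<^sub>R axis j 1) = (\<Sum>i\<in>UNIV. if i = j then z $ i * of_real t else 0)"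
    unfolding cdot_def by (intro sum.cong) (auto simp: axis_def)
  then show ?thesis by simp
qed

lemma Im_cdot: "Im (cdot z x) = (\<Sum>j\<in>UNIV. Im (z $ j) * x $ j)"
  by (simp add: cdot_def Im_sum)

definition cvec :: "real^'n::finite \<Rightarrow> complex^'n" where
  "cvec x = (\<chi> j. of_real (x $ j))"

lemma cdot_cvec: "cdot (cvec \<xi>) x = of_real (x \<bullet> \<xi>)"
  by (simp add: cdot_def cvec_def inner_vec_def mult.commute)

lemma norm_cdot_le: "norm (cdot z x) \<le> norm z * asum x"
proof -
  have "norm (cdot z x) \<le> (\<Sum>j\<in>UNIV. norm z * \<bar>x $ j\<bar>)"
    unfolding cdot_def
    by (rule sum_norm_le) (auto simp: norm_mult intro!: mult_right_mono Finite_Cartesian_Product.norm_nth_le)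
  then show ?thesis by (simp add: asum_def sum_distrib_left)
qed

lemma norm_exp_cdot: "norm (exp (\<i> * cdot z x)) = exp (- Im (cdot z x))"
  by (simp add: norm_exp_eq_Re)

lemma norm_exp_cdot_le: "norm (exp (\<i> * cdot z x)) \<le> exp (\<Sum>j\<in>UNIV. \<bar>Im (z $ j)\<bar> * \<bar>x $ j\<bar>)"
proof -
  have "- Im (cdot z x) \<le> (\<Sum>j\<in>UNIV. \<bar>Im (z $ j)\<bar> * \<bar>x $ j\<bar>)"
    unfolding Im_cdot sum_negf[symmetric] by (intro sum_mono) (metis abs_ge_minus_self abs_mult)
  then show ?thesis by (simp add: norm_exp_cdot)
qed

lemma norm_exp_cdot_le': "norm (exp (\<i> * cdot z x)) \<le> exp (norm z * asum x)"
proof -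
  have "- Im (cdot z x) \<le> norm z * asum x"
    using norm_cdot_le[of z x] abs_Im_le_cmod[of "cdot z x"] by linarith
  then show ?thesis by (simp add: norm_exp_cdot)
qed

definition CT :: "(real^'n::finite \<Rightarrow> complex) \<Rightarrow> complex^'n \<Rightarrow> complex" where
  "CT u z = (LINT x|lborel. u x * exp (\<i> * cdot z x))"

lemma CT_cvec: "CT u (cvec \<xi>) = FT 1 u \<xi>"
  by (simp add: CT_def FT_def cdot_cvec)

lemma CT_scale: "CT (\<lambda>x. c * u x) z = c * CT u z"
  by (simp add: CT_def mult.assoc)

lemma exp_decay_CT: "exp_decay u \<Longrightarrow> exp_decay (\<lambda>x. u x * exp (\<i> * cdot z x))"
  unfolding mult.commute[of "u _"]
proof (rule exp_decay_mult[where A=1 and B="norm z"])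
  show "norm (exp (\<i> * cdot z x)) \<le> 1 * exp (norm z * asum x)" for x
    using norm_exp_cdot_le'[of z x] by (simp only: mult_1_left)
qed auto

lemma CT_integrable: "exp_decay u \<Longrightarrow> integrable lborel (\<lambda>x. u x * exp (\<i> * cdot z x))"
  by (intro exp_decay_integrable exp_decay_CT)

lemma CT_add: "exp_decay u \<Longrightarrow> exp_decay v \<Longrightarrow> CT (\<lambda>x. u x + v x) z = CT u z + CT v z"
  by (simp add: CT_def distrib_right CT_integrable)

text \<open>The modulus of the kernel is \<open>exp (- Im (cdot z x))\<close>; with radii
  \<open>\<bar>Im (z $ j)\<bar>\<close> this is the growth that \<open>seq_decay_exp\<close>
  allows.\<close>

lemma (in weight_triple) CT_bound:
  assumes u: "seq_decay h K u" and [measurable]: "u \<in> borel_measurable borel"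
  shows "norm (CT u z) \<le> (24 ^ CARD('n) * exp (\<gamma> + \<gamma>') * (LINT x|lborel. cweight (x::real^'n))) * K
      * exp (phi h'' (\<chi> j. Im (z $ j)))"
proof -
  let ?C = "24 ^ CARD('n) * exp (\<gamma> + \<gamma>') * K * exp (phi h'' (\<chi> j. Im (z $ j)))"
  have "norm (CT u z) \<le> (LINT x|lborel. norm (u x * exp (\<i> * cdot z x)))"
    unfolding CT_def by (rule integral_norm_bound)
  also have "\<dots> \<le> (LINT x|lborel. ?C * cweight (x::real^'n))"
  proof (rule integral_mono)
    show "integrable lborel (\<lambda>x. norm (u x * exp (\<i> * cdot z x)))"
      by (intro integrable_norm CT_integrable seq_decay_imp_exp_decay[OF u]) measurable
    show "integrable lborel (\<lambda>x::real^'n. ?C * cweight x)"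
      by (intro integrable_mult_right integrable_cweight)
    fix x :: "real^'n"
    have "norm (u x * exp (\<i> * cdot z x)) \<le> norm (u x) * exp (\<Sum>j\<in>UNIV. (\<chi> j. \<bar>Im (z $ j)\<bar>) $ j * \<bar>x $ j\<bar>)"
      using norm_exp_cdot_le[of z x] by (simp add: norm_mult mult_left_mono)
    also have "\<dots> \<le> 24 ^ CARD('n) * exp (\<gamma> + \<gamma>') * K * cweight x * exp (phi h'' (\<chi> j. \<bar>Im (z $ j)\<bar>))"
      by (rule seq_decay_exp[OF u]) simp
    also have "phi h'' (\<chi> j. \<bar>Im (z $ j)\<bar>) = phi h'' (\<chi> j. Im (z $ j))" by (simp add: phi_def)
    finally show "norm (u x * exp (\<i> * cdot z x)) \<le> ?C * cweight x" by (simp add: mult_ac)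
  qed
  finally show ?thesis by (simp add: mult_ac)
qed

text \<open>Integration by parts, obtained by differentiating the translation invariance
  \<open>\<integral> u (x + t e\<^sub>j) e\<^bsup>i\<langle>z,x\<rangle>\<^esup> dx = e\<^bsup>- i t z\<^sub>j\<^esup> CT u z\<close> at \<open>t = 0\<close>.\<close>

lemma CT_by_parts:
  assumes u: "exp_decay u" and v: "exp_decay v"
    and deriv: "\<And>x t. ((\<lambda>t. u (x + t *\<^sub>R axis j 1)) has_vector_derivative v (x + t *\<^sub>R axis j 1)) (at t)"
  shows "z $ j * CT u z = \<i> * CT v z"
proof -
  let ?e = "\<lambda>x. exp (\<i> * cdot z x)" and ?a = "axis j 1 :: real^'a"
  have [measurable]: "u \<in> borel_measurable borel" "v \<in> borel_measurable borel" using u v by measurable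
  \<comment> \<open>With this \<open>R\<close>, \<open>exp (R * asum x)\<close> dominates the
    kernel, so a bound with the factor \<open>exp (- R * asum x)\<close> survives multiplication by
    it.\<close>
  define R where "R = norm z"
  have R: "R \<ge> 0" by (simp add: R_def)
  obtain C where C: "C \<ge> 0" "\<And>x. norm (v x) * exp (R * asum x) \<le> C * cweight x"
    using exp_decayD[OF v R] by blast
  \<comment> \<open>Domination of \<open>v\<close> uniformly over shifts of length at most 1:
    \<open>cweight\<close> changes by at most \<open>2 * (1 + 1)\<close> per coordinate and
    \<open>asum\<close> by at most 1, whence \<open>4 ^ CARD('a)\<close> and
    \<open>exp R\<close>.\<close>
  have vb: "norm (v (x + s *\<^sub>R ?a)) \<le> C * exp R * 4 ^ CARD('a) * (cweight x * exp (- R * asum x))"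
    if s: "\<bar>s\<bar> \<le> 1" for x s
  proof -
    let ?y = "x + s *\<^sub>R ?a"
    have cw: "cweight ?y \<le> 4 ^ CARD('a) * cweight x"
    proof -
      have "cweight ?y \<le> (\<Prod>i\<in>UNIV. 2 * (1 + ((s *\<^sub>R ?a) $ i)\<^sup>2)) * cweight x" by (rule cweight_shift)
      also have "\<dots> \<le> (\<Prod>i\<in>(UNIV::'a set). 4) * cweight x"
      proof (intro mult_right_mono prod_mono conjI)
        fix i
        have "\<bar>(s *\<^sub>R ?a) $ i\<bar> \<le> 1" using s by (simp add: axis_def)
        then have "((s *\<^sub>R ?a) $ i)\<^sup>2 \<le> 1" by (simp only: abs_square_le_1)
        then show "2 * (1 + ((s *\<^sub>R ?a) $ i)\<^sup>2) \<le> 4" by simp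
      qed (auto simp: less_imp_le[OF cweight_pos] add_nonneg_nonneg)
      finally show ?thesis by simp
    qed
    have "asum x \<le> asum ?y + 1"
    proof -
      have "asum x = asum (?y + (- s) *\<^sub>R ?a)" by simp
      also have "\<dots> \<le> asum ?y + asum ((- s) *\<^sub>R ?a)" by (rule asum_triangle)
      finally show ?thesis using s unfolding asum_axis by simp
    qed
    then have "R * asum x \<le> R * (asum ?y + 1)" using R by (intro mult_left_mono)
    then have ex: "exp (- R * asum ?y) \<le> exp R * exp (- R * asum x)"
      by (simp add: algebra_simps flip: exp_add)
    have "norm (v ?y) = (norm (v ?y) * exp (R * asum ?y)) * exp (- R * asum ?y)"
      by (simp add: mult.assoc flip: exp_add)
    also have "\<dots> \<le> (C * cweight ?y) * exp (- R * asum ?y)" by (intro mult_right_mono C) auto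
    also have "\<dots> \<le> (C * (4 ^ CARD('a) * cweight x)) * (exp R * exp (- R * asum x))"
      using C(1) cw ex cweight_pos[of x] by (intro mult_mono mult_left_mono) auto
    finally show ?thesis by (simp add: mult_ac)
  qed
  \<comment> \<open>The mean value inequality turns the bound on the derivative \<open>v\<close>
    into one on the difference quotients of \<open>u\<close>.\<close>
  have ub: "norm ((1 / t) *\<^sub>R (u (x + t *\<^sub>R ?a) - u x)) \<le> C * exp R * 4 ^ CARD('a) * (cweight x * exp (- R * asum x))"
    if t: "t \<noteq> 0" "\<bar>t\<bar> < 1" for x t
  proof -
    let ?B = "C * exp R * 4 ^ CARD('a) * (cweight x * exp (- R * asum x))"
    let ?f = "\<lambda>t. u (x + t *\<^sub>R ?a)"
    have mvt: "norm (?f b - ?f a) \<le> ?B * (b - a)" if ab: "a < b" "-1 \<le> a" "b \<le> 1" for a b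
    proof -
      have "\<exists>s\<in>{a<..<b}. norm (?f b - ?f a) \<le> norm ((b - a) *\<^sub>R v (x + s *\<^sub>R ?a))"
      proof (rule mvt_general[OF ab(1)])
        show "continuous_on {a..b} ?f"
          by (intro continuous_at_imp_continuous_on ballI has_vector_derivative_continuous[OF deriv])
        show "\<And>s. a < s \<Longrightarrow> s < b \<Longrightarrow> (?f has_derivative (\<lambda>h. h *\<^sub>R v (x + s *\<^sub>R ?a))) (at s)"
          using deriv unfolding has_vector_derivative_def by blast
      qed
      then obtain s where s: "a < s" "s < b" "norm (?f b - ?f a) \<le> (b - a) * norm (v (x + s *\<^sub>R ?a))"
        using ab by auto
      note s(3)
      also have "(b - a) * norm (v (x + s *\<^sub>R ?a)) \<le> (b - a) * ?B"
        using s ab by (intro mult_left_mono vb) auto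
      finally show ?thesis by (simp only: mult.commute)
    qed
    have "norm (?f t - ?f 0) \<le> ?B * \<bar>t\<bar>"
    proof (cases "t > 0")
      case True
      then show ?thesis using mvt[of 0 t] t by simp
    next
      case False
      then show ?thesis using mvt[of t 0] t by (simp add: norm_minus_commute)
    qed
    then show ?thesis using t by (simp add: divide_le_eq)
  qed
  have shift: "(LINT x|lborel. u (x + t *\<^sub>R ?a) * ?e x) = exp (- \<i> * z $ j * of_real t) * CT u z" for t
  proof -
    have "(LINT x|lborel. u (x + t *\<^sub>R ?a) * ?e x) = (LINT x|lborel. u (- t *\<^sub>R ?a + x + t *\<^sub>R ?a) * ?e (- t *\<^sub>R ?a + x))"
      by (rule lborel_integral_translate[symmetric]) measurable
    also have "\<dots> = (LINT x|lborel. exp (- \<i> * z $ j * of_real t) * (u x * ?e x))"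
    proof (rule Bochner_Integration.integral_cong[OF refl])
      fix x :: "real^'a"
      have "cdot z (- t *\<^sub>R ?a + x) = - z $ j * of_real t + cdot z x"
        unfolding cdot_add cdot_axis by simp
      then have "\<i> * cdot z (- t *\<^sub>R ?a + x) = - \<i> * z $ j * of_real t + \<i> * cdot z x"
        by (simp only:) (simp add: algebra_simps)
      then have "?e (- t *\<^sub>R ?a + x) = exp (- \<i> * z $ j * of_real t) * ?e x" by (simp only: exp_add)
      moreover have "- t *\<^sub>R ?a + x + t *\<^sub>R ?a = x" by simp
      ultimately show "u (- t *\<^sub>R ?a + x + t *\<^sub>R ?a) * ?e (- t *\<^sub>R ?a + x) = exp (- \<i> * z $ j * of_real t) * (u x * ?e x)"
        by (simp only: mult.left_commute)
    qed
    finally show ?thesis by (simp add: CT_def)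
  qed
  have int_shift: "integrable lborel (\<lambda>x. u (x + t *\<^sub>R ?a) * ?e x)" for t
  proof -
    have "integrable lborel (\<lambda>x. u (t *\<^sub>R ?a + x) * ?e (t *\<^sub>R ?a + x))"
      by (intro lborel_integrable_translate CT_integrable u)
    then have "integrable lborel (\<lambda>x. exp (- \<i> * cdot z (t *\<^sub>R ?a)) * (u (t *\<^sub>R ?a + x) * ?e (t *\<^sub>R ?a + x)))"
      by (rule integrable_mult_right)
    then show ?thesis
      by (rule Bochner_Integration.integrable_cong[THEN iffD1, rotated -1])
        (auto simp: cdot_add add.commute algebra_simps simp flip: exp_add)
  qed
  have eq: "(LINT x|lborel. (1 / t) *\<^sub>R (u (x + t *\<^sub>R ?a) - u x) * ?e x)
      = ((1 / t) *\<^sub>R (exp (- \<i> * z $ j * of_real t) - exp (- \<i> * z $ j * of_real 0))) * CT u z" for t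
  proof -
    have "(LINT x|lborel. (1 / t) *\<^sub>R (u (x + t *\<^sub>R ?a) - u x) * ?e x)
      = (1 / t) *\<^sub>R ((LINT x|lborel. u (x + t *\<^sub>R ?a) * ?e x) - (LINT x|lborel. u x * ?e x))"
      by (subst Bochner_Integration.integral_diff[OF int_shift CT_integrable[OF u], symmetric],
        subst integral_scaleR_right[symmetric]) (simp add: left_diff_distrib scaleR_diff_right)
    then show ?thesis unfolding shift by (simp add: CT_def[symmetric] left_diff_distrib scaleR_diff_right)
  qed
  \<comment> \<open>By \<open>eq\<close> the same quotients have two limits: one taken under the
    integral sign, the other from differentiating \<open>exp (- \<i> * z $ j * of_real t)\<close>.
    Comparing them gives the claim.\<close>
  have "((\<lambda>t. LINT x|lborel. (1 / t) *\<^sub>R (u (x + t *\<^sub>R ?a) - u x) * ?e x) \<longlongrightarrow> CT v z) (at 0)"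
    unfolding CT_def
  proof (rule integral_dominated_tendsto_at[OF _ _ integrable_mult_right[OF integrable_cweight, of "C * exp R * 4 ^ CARD('a)"] _ zero_less_one])
    fix x :: "real^'a"
    have "((\<lambda>t. (1 / t) *\<^sub>R (u (x + t *\<^sub>R ?a) - u (x + 0 *\<^sub>R ?a))) \<longlongrightarrow> v (x + 0 *\<^sub>R ?a)) (at 0)"
      using deriv[of x 0] unfolding has_vector_derivative_at_0_iff .
    then show "((\<lambda>t. (1 / t) *\<^sub>R (u (x + t *\<^sub>R ?a) - u x) * ?e x) \<longlongrightarrow> v x * ?e x) (at 0)"
      by (intro tendsto_mult tendsto_const) simp
    fix t :: real assume t: "t \<noteq> 0" "dist t 0 < 1"
    have "norm ((1 / t) *\<^sub>R (u (x + t *\<^sub>R ?a) - u x) * ?e x)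
        \<le> (C * exp R * 4 ^ CARD('a) * (cweight x * exp (- R * asum x))) * exp (R * asum x)"
      unfolding norm_mult R_def using ub[of t x] t norm_exp_cdot_le'[of z x] C(1) cweight_pos[of x]
      by (intro mult_mono) (auto simp: R_def)
    also have "\<dots> = C * exp R * 4 ^ CARD('a) * cweight x" by (simp add: mult.assoc flip: exp_add)
    finally show "norm ((1 / t) *\<^sub>R (u (x + t *\<^sub>R ?a) - u x) * ?e x) \<le> C * exp R * 4 ^ CARD('a) * cweight x" .
  qed measurable
  moreover have "((\<lambda>t. (1 / t) *\<^sub>R (exp (- \<i> * z $ j * of_real t) - exp (- \<i> * z $ j * of_real 0)) * CT u z)
      \<longlongrightarrow> (- \<i> * z $ j) * CT u z) (at 0)"
  proof (intro tendsto_mult tendsto_const)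
    have "((\<lambda>w. exp (- \<i> * z $ j * w)) has_field_derivative (- \<i> * z $ j)) (at (of_real 0))"
      by (auto intro!: derivative_eq_intros)
    from has_vector_derivative_real_field[OF this, of UNIV]
    show "((\<lambda>t. (1 / t) *\<^sub>R (exp (- \<i> * z $ j * of_real t) - exp (- \<i> * z $ j * of_real 0))) \<longlongrightarrow> - \<i> * z $ j) (at 0)"
      unfolding has_vector_derivative_at_0_iff .
  qed
  ultimately have "CT v z = (- \<i> * z $ j) * CT u z"
    unfolding eq using tendsto_unique[OF at_neq_bot] by blast
  then show ?thesis by (simp flip: mult.assoc)
qed

lemma power2_le_exp: "t \<ge> 0 \<Longrightarrow> t\<^sup>2 \<le> 2 * exp t" for t :: real
  using power_le_fact_exp[of t 2] by (simp add: fact_numeral)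

lemma exp_decay_bound_integrable:
  fixes u :: "real^'n::finite \<Rightarrow> complex" and v :: "real^'n \<Rightarrow> 'b::{banach,second_countable_topology}"
  assumes u: "exp_decay u" and [measurable]: "v \<in> borel_measurable borel"
    and v: "\<And>x. norm (v x) \<le> norm (u x) * exp (R * asum x)" and R: "R \<ge> 0"
  shows "integrable lborel v"
proof -
  obtain C where C: "C \<ge> 0" "\<And>x. norm (u x) * exp (R * asum x) \<le> C * cweight x"
    using exp_decayD[OF u R] by blast
  show ?thesis
  proof (rule Bochner_Integration.integrable_bound[OF integrable_mult_right[OF integrable_cweight, of C]])
    have "norm (v x) \<le> norm (C * cweight x)" for x
      using order_trans[OF v[of x] C(2)[of x]] C(1) by (simp add: abs_mult abs_of_pos[OF cweight_pos])
    then show "AE x in lborel. norm (v x) \<le> norm (C * cweight x)" by simp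
  qed measurable
qed

text \<open>Differentiation under the integral sign in all directions at once: \<open>f'\<close> is
  the integral of the linear term, and the Taylor remainder of the exponential gives an error of
  order \<open>(norm v)\<^sup>2\<close>.\<close>

lemma entire_CT:
  assumes u: "exp_decay u"
  shows "entire (CT u)"
  unfolding entire_def
proof
  fix z :: "complex^'a"
  have [measurable]: "u \<in> borel_measurable borel" using u by measurable
  let ?g = "\<lambda>j x. \<i> * of_real (x $ j) * u x"
  define f' where "f' v = (\<Sum>j\<in>UNIV. v $ j * CT (?g j) z)" for v :: "complex^'a"
  have g: "exp_decay (?g j)" for j
    using exp_decay_const[OF exp_decay_coord[OF u, of j], of \<i>] by (simp add: mult.assoc)
  have f'_int: "f' v = (LINT x|lborel. u x * (\<i> * cdot v x) * exp (\<i> * cdot z x))" for v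
  proof -
    have "f' v = (\<Sum>j\<in>UNIV. LINT x|lborel. v $ j * (?g j x * exp (\<i> * cdot z x)))"
      by (simp add: f'_def CT_def)
    also have "\<dots> = (LINT x|lborel. (\<Sum>j\<in>UNIV. v $ j * (?g j x * exp (\<i> * cdot z x))))"
      by (rule Bochner_Integration.integral_sum[symmetric]) (intro integrable_mult_right CT_integrable g)
    also have "\<dots> = (LINT x|lborel. u x * (\<i> * cdot v x) * exp (\<i> * cdot z x))"
      by (intro Bochner_Integration.integral_cong refl)
        (simp add: cdot_def sum_distrib_left sum_distrib_right mult_ac)
    finally show ?thesis .
  qed
  have lin: "f' (v + w) = f' v + f' w" "f' (c *s v) = c * f' v" "f' (r *\<^sub>R v) = r *\<^sub>R f' v" for v w c r
    by (simp_all add: f'_def sum.distrib distrib_right sum_distrib_left mult_ac scaleR_sum_right)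
  have blin: "bounded_linear f'"
  proof (rule bounded_linear_intro[OF lin(1,3)])
    fix v :: "complex^'a"
    have "norm (f' v) \<le> (\<Sum>j\<in>UNIV. norm v * norm (CT (?g j) z))"
      unfolding f'_def
      by (rule sum_norm_le) (auto simp: norm_mult intro!: mult_right_mono Finite_Cartesian_Product.norm_nth_le)
    then show "norm (f' v) \<le> norm v * (\<Sum>j\<in>UNIV. norm (CT (?g j) z))"
      by (simp add: sum_distrib_left)
  qed
  \<comment> \<open>One unit pays for the exponential in the Taylor remainder when
    \<open>norm v \<le> 1\<close>, the other for absorbing \<open>(asum x)\<^sup>2\<close>.\<close>
  define R where "R = norm z + 2"
  obtain C where C: "C \<ge> 0" "\<And>x. norm (u x) * exp (R * asum x) \<le> C * cweight x"
    using exp_decayD[OF u, of R] by (auto simp: R_def)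
  define M where "M = 2 * C * (LINT x|lborel. cweight (x::real^'a))"
  have rem: "norm (CT u (z + v) - CT u z - f' v) \<le> M * (norm v)\<^sup>2" if v: "norm v \<le> 1" for v
  proof -
    let ?r = "\<lambda>x. u x * exp (\<i> * cdot (z + v) x) - u x * exp (\<i> * cdot z x) - u x * (\<i> * cdot v x) * exp (\<i> * cdot z x)"
    have int: "integrable lborel (\<lambda>x. u x * (\<i> * cdot v x) * exp (\<i> * cdot z x))"
    proof (rule exp_decay_bound_integrable[OF u, of _ "norm v + norm z"])
      fix x
      have "norm (cdot v x) \<le> exp (norm v * asum x)"
        using norm_cdot_le[of v x] exp_ge_add_one_self[of "norm v * asum x"] by linarith
      then have "norm (\<i> * cdot v x) \<le> exp (norm v * asum x)" by (simp add: norm_mult)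
      then have "norm (\<i> * cdot v x) * norm (exp (\<i> * cdot z x)) \<le> exp (norm v * asum x) * exp (norm z * asum x)"
        by (intro mult_mono norm_exp_cdot_le') auto
      then have "norm (u x) * (norm (\<i> * cdot v x) * norm (exp (\<i> * cdot z x))) \<le> norm (u x) * (exp (norm v * asum x) * exp (norm z * asum x))"
        by (rule mult_left_mono) simp
      then show "norm (u x * (\<i> * cdot v x) * exp (\<i> * cdot z x)) \<le> norm (u x) * exp ((norm v + norm z) * asum x)"
        by (simp only: norm_mult distrib_right exp_add mult.assoc)
    qed auto
    have "CT u (z + v) - CT u z - f' v = (LINT x|lborel. ?r x)"
      unfolding f'_int CT_def
      by (subst Bochner_Integration.integral_diff[OF Bochner_Integration.integrable_diff[OF CT_integrable[OF u] CT_integrable[OF u]] int],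
          subst Bochner_Integration.integral_diff[OF CT_integrable[OF u] CT_integrable[OF u]]) simp
    then have "norm (CT u (z + v) - CT u z - f' v) \<le> (LINT x|lborel. norm (?r x))"
      by (simp only: integral_norm_bound)
    also have "\<dots> \<le> (LINT x|lborel. (2 * C * (norm v)\<^sup>2) * cweight (x::real^'a))"
    proof (rule integral_mono)
      show "integrable lborel (\<lambda>x. norm (?r x))"
        by (intro integrable_norm Bochner_Integration.integrable_diff CT_integrable u int)
      show "integrable lborel (\<lambda>x::real^'a. (2 * C * (norm v)\<^sup>2) * cweight x)"
        by (intro integrable_mult_right integrable_cweight)
      fix x
      let ?w = "\<i> * cdot v x"
      have nw: "norm ?w \<le> norm v * asum x" using norm_cdot_le[of v x] by (simp add: norm_mult)
      have nw1: "norm ?w \<le> asum x"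
        using order_trans[OF nw mult_right_mono[OF v asum_nonneg]] by simp
      have "norm (exp ?w - 1 - ?w) \<le> exp \<bar>Re ?w\<bar> * (norm ?w)\<^sup>2"
        using Taylor_exp[of ?w 1] by (simp add: power2_eq_square algebra_simps)
      also have "\<dots> \<le> exp (asum x) * (norm v * asum x)\<^sup>2"
        using nw nw1 abs_Re_le_cmod[of ?w] by (intro mult_mono power_mono) auto
      also have "\<dots> = (norm v)\<^sup>2 * (exp (asum x) * (asum x)\<^sup>2)" by (simp add: power_mult_distrib)
      also have "\<dots> \<le> (norm v)\<^sup>2 * (exp (asum x) * (2 * exp (asum x)))"
        by (intro mult_left_mono power2_le_exp asum_nonneg) auto
      finally have e: "norm (exp ?w - 1 - ?w) \<le> (norm v)\<^sup>2 * (exp (asum x) * (2 * exp (asum x)))" .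
      have "?r x = u x * (exp (\<i> * cdot z x) * (exp ?w - 1 - ?w))"
        by (simp add: cdot_add_left distrib_left exp_add algebra_simps)
      then have "norm (?r x) = norm (u x) * (norm (exp (\<i> * cdot z x)) * norm (exp ?w - 1 - ?w))"
        by (simp only: norm_mult)
      also have "\<dots> \<le> norm (u x) * (exp (norm z * asum x) * ((norm v)\<^sup>2 * (exp (asum x) * (2 * exp (asum x)))))"
        by (intro mult_left_mono mult_mono norm_exp_cdot_le' e) auto
      also have "\<dots> = 2 * (norm v)\<^sup>2 * (norm (u x) * exp (R * asum x))"
      proof -
        have "exp (R * asum x) = exp (norm z * asum x) * exp (asum x) * exp (asum x)"
          by (simp add: R_def distrib_right flip: exp_add)
        then show ?thesis by simp
      qed
      also have "\<dots> \<le> 2 * (norm v)\<^sup>2 * (C * cweight x)" by (intro mult_left_mono C) auto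
      finally show "norm (?r x) \<le> (2 * C * (norm v)\<^sup>2) * cweight x" by (simp add: mult_ac)
    qed
    also have "\<dots> = M * (norm v)\<^sup>2" by (simp add: M_def)
    finally show ?thesis .
  qed
  have "((\<lambda>v. norm (CT u (z + v) - CT u z - f' v) / norm v) \<longlongrightarrow> 0) (at 0)"
  proof (rule tendsto_sandwich[OF _ _ tendsto_const])
    show "eventually (\<lambda>v. norm (CT u (z + v) - CT u z - f' v) / norm v \<le> M * norm v) (at 0)"
      unfolding eventually_at
    proof (intro exI[of _ 1] conjI ballI impI)
      fix v :: "complex^'a" assume v: "v \<noteq> 0 \<and> dist v 0 < 1"
      then have "norm (CT u (z + v) - CT u z - f' v) \<le> (M * norm v) * norm v"
        using rem[of v] by (simp add: power2_eq_square mult.assoc)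
      then show "norm (CT u (z + v) - CT u z - f' v) / norm v \<le> M * norm v"
        using v by (simp add: divide_le_eq)
    qed auto
    show "((\<lambda>v::complex^'a. M * norm v) \<longlongrightarrow> 0) (at 0)"
      by (rule tendsto_eq_rhs[OF tendsto_mult[OF tendsto_const tendsto_norm[OF tendsto_ident_at]]]) simp
  qed auto
  then have "(CT u has_derivative f') (at z)"
    unfolding has_derivative_at using blin by blast
  then show "\<exists>f'. (CT u has_derivative f') (at z) \<and> (\<forall>c v. f' (c *s v) = c * f' v)"
    using lin(2) by blast
qed

text \<open>Finitely many absolutely convergent exponential series, multiplied out; the functions on
  the index type form the \<open>PiE\<close> set over which the product expands.\<close>

lemma has_sum_exp_prod:
  fixes w :: "'n::finite \<Rightarrow> 'b::{real_normed_field,banach,second_countable_topology}"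
  shows "((\<lambda>\<alpha>. \<Prod>j\<in>UNIV. w j ^ \<alpha> j /\<^sub>R fact (\<alpha> j)) has_sum (\<Prod>j\<in>UNIV. exp (w j))) UNIV"
proof -
  have s: "Infinite_Set_Sum.abs_summable_on (\<lambda>k. w j ^ k /\<^sub>R fact k) UNIV" for j
    unfolding abs_summable_on_nat_iff' by (rule summable_norm_exp)
  have U: "(\<Pi>\<^sub>E j\<in>(UNIV::'n set). (UNIV::nat set)) = UNIV" by (simp add: PiE_UNIV_domain)
  have as: "Infinite_Set_Sum.abs_summable_on (\<lambda>\<alpha>. \<Prod>j\<in>UNIV. w j ^ \<alpha> j /\<^sub>R fact (\<alpha> j)) UNIV"
    unfolding U[symmetric] by (rule abs_summable_on_prod_PiE) (simp_all add: s)
  have "infsetsum (\<lambda>\<alpha>. \<Prod>j\<in>UNIV. w j ^ \<alpha> j /\<^sub>R fact (\<alpha> j)) UNIV = (\<Prod>j\<in>UNIV. infsetsum (\<lambda>k. w j ^ k /\<^sub>R fact k) UNIV)"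
    unfolding U[symmetric] by (rule infsetsum_prod_PiE) (simp_all add: s)
  also have "\<dots> = (\<Prod>j\<in>UNIV. exp (w j))"
    by (simp add: infsetsum_nat'[OF s] exp_def)
  finally have eq: "infsum (\<lambda>\<alpha>. \<Prod>j\<in>UNIV. w j ^ \<alpha> j /\<^sub>R fact (\<alpha> j)) UNIV = (\<Prod>j\<in>UNIV. exp (w j))"
    using infsetsum_infsum[OF as] by simp
  have "(\<lambda>\<alpha>. \<Prod>j\<in>UNIV. w j ^ \<alpha> j /\<^sub>R fact (\<alpha> j)) summable_on UNIV"
    using as abs_summable_equivalent abs_summable_summable by blast
  then show ?thesis by (rule has_sum_infsum[THEN back_subst[where P="\<lambda>S. (_ has_sum S) _"], OF _ eq])
qed

text \<open>Termwise integration of the exponential series. The moduli of its terms sum to at most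
  \<open>exp (norm z * asum x)\<close>, which the decay of \<open>u\<close> outweighs; each
  integrated term is a Taylor term because derivatives of \<open>FT 1 u\<close> at 0 are moments of
  \<open>u\<close>.\<close>

lemma CT_eq_infsum:
  fixes u :: "real^'n::finite \<Rightarrow> complex"
  assumes u: "exp_decay u"
  shows "CT u z = (\<Sum>\<^sub>\<infinity>\<alpha>\<in>UNIV. mderiv \<alpha> (FT 1 u) 0 / of_real (mi_fact \<alpha>) * mi_power z \<alpha>)"
proof -
  have [measurable]: "u \<in> borel_measurable borel" using u by measurable
  let ?T = "\<lambda>x \<alpha>. \<Prod>j\<in>UNIV. (\<i> * (z $ j * of_real (x $ j))) ^ \<alpha> j /\<^sub>R fact (\<alpha> j)"
  let ?N = "\<lambda>x \<alpha>. \<Prod>j\<in>UNIV. (norm (z $ j) * \<bar>x $ j\<bar>) ^ \<alpha> j /\<^sub>R fact (\<alpha> j)"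
  have [measurable]: "(\<lambda>x. ?T x \<alpha>) \<in> borel_measurable borel" for \<alpha> by measurable
  have T: "(?T x has_sum exp (\<i> * cdot z x)) UNIV" for x
  proof -
    have "(\<Prod>j\<in>UNIV. exp (\<i> * (z $ j * of_real (x $ j)))) = exp (\<i> * cdot z x)"
      by (simp add: cdot_def sum_distrib_left exp_sum)
    then show ?thesis using has_sum_exp_prod[of "\<lambda>j. \<i> * (z $ j * of_real (x $ j))"] by simp
  qed
  have normT: "norm (?T x \<alpha>) = ?N x \<alpha>" for x \<alpha>
    by (simp add: norm_mult norm_power divide_inverse flip: prod_norm)
  have N: "(?N x has_sum exp (\<Sum>j\<in>UNIV. norm (z $ j) * \<bar>x $ j\<bar>)) UNIV" for x
    using has_sum_exp_prod[of "\<lambda>j. norm (z $ j) * \<bar>x $ j\<bar>"] by (simp add: exp_sum)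
  have Nle: "(\<Sum>\<alpha>\<in>S. norm (?T x \<alpha>)) \<le> exp (norm z * asum x)" if "finite S" for S x
  proof -
    have "(\<Sum>\<alpha>\<in>S. norm (?T x \<alpha>)) \<le> exp (\<Sum>j\<in>UNIV. norm (z $ j) * \<bar>x $ j\<bar>)"
      unfolding normT by (rule finite_sum_le_has_sum[OF N that]) (auto intro!: prod_nonneg)
    also have "\<dots> \<le> exp (norm z * asum x)"
      by (auto simp: asum_def sum_distrib_left intro!: sum_mono mult_right_mono Finite_Cartesian_Product.norm_nth_le)
    finally show ?thesis .
  qed
  define c where "c \<alpha> = (LINT x|lborel. u x * ?T x \<alpha>)" for \<alpha>
  have c: "c \<alpha> = mderiv \<alpha> (FT 1 u) 0 / of_real (mi_fact \<alpha>) * mi_power z \<alpha>" for \<alpha>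
  proof -
    have "mderiv \<alpha> (FT 1 u) 0 / of_real (mi_fact \<alpha>) * mi_power z \<alpha>
        = (mi_power z \<alpha> / of_real (mi_fact \<alpha>)) * (LINT x|lborel. (\<Prod>j\<in>UNIV. (\<i> * of_real (x $ j)) ^ \<alpha> j) * u x)"
      unfolding mderiv_FT[OF exp_decay_rapid[OF u]] by (simp add: FT_def)
    also have "\<dots> = (LINT x|lborel. (mi_power z \<alpha> / of_real (mi_fact \<alpha>)) * ((\<Prod>j\<in>UNIV. (\<i> * of_real (x $ j)) ^ \<alpha> j) * u x))"
      by simp
    also have "\<dots> = c \<alpha>"
      unfolding c_def
    proof (intro Bochner_Integration.integral_cong refl)
      fix x :: "real^'n"
      have "?T x \<alpha> = (mi_power z \<alpha> / of_real (mi_fact \<alpha>)) * (\<Prod>j\<in>UNIV. (\<i> * of_real (x $ j)) ^ \<alpha> j)"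
        unfolding mi_power_def mi_fact_def of_real_prod prod_dividef[symmetric] prod.distrib[symmetric]
        by (intro prod.cong refl) (simp add: scaleR_conv_of_real power_mult_distrib field_simps)
      then show "mi_power z \<alpha> / of_real (mi_fact \<alpha>) * ((\<Prod>j\<in>UNIV. (\<i> * of_real (x $ j)) ^ \<alpha> j) * u x) = u x * ?T x \<alpha>"
        by (simp only: mult_ac)
    qed
    finally show ?thesis by simp
  qed
  \<comment> \<open>The convergence theorem for integrals speaks of sequences, so the multi-indices
    are enumerated; infinitude of their set makes the enumeration a bijection.\<close>
  let ?e = "from_nat_into (UNIV :: ('n \<Rightarrow> nat) set)"
  have "infinite (UNIV :: ('n \<Rightarrow> nat) set)"
    by (metis finite_fun_UNIVD2 finite_UNIV infinite_UNIV_nat card_1_singleton_iff One_nat_def UNIV_I finite_imp_inj_to_nat_seg)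
  then have e: "bij_betw ?e UNIV UNIV" by (intro bij_betw_from_nat_into) auto
  have fin: "finite (?e ` {..<N})" for N by simp
  have inj: "inj_on ?e {..<N}" for N using e by (auto simp: bij_betw_def intro: inj_on_subset)
  have sum_norm: "(\<Sum>i<N. norm (?T x (?e i))) \<le> exp (norm z * asum x)" for N x
    using Nle[OF fin[of N], of x] by (simp add: sum.reindex[OF inj])
  have int: "integrable lborel (\<lambda>x. u x * ?T x \<alpha>)" for \<alpha>
  proof (rule exp_decay_bound_integrable[OF u, of _ "norm z"])
    show "norm (u x * ?T x \<alpha>) \<le> norm (u x) * exp (norm z * asum x)" for x
      unfolding norm_mult using Nle[of "{\<alpha>}" x] by (intro mult_left_mono) auto
  qed auto
  have "(\<lambda>i. c (?e i)) sums CT u z"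
    unfolding sums_def
  proof -
    have "(\<lambda>N. LINT x|lborel. (\<Sum>i<N. u x * ?T x (?e i))) \<longlonglongrightarrow> CT u z"
      unfolding CT_def
    proof (rule integral_dominated_convergence[where w="\<lambda>x. norm (u x * of_real (exp (norm z * asum x)))"])
      show "integrable lborel (\<lambda>x. norm (u x * of_real (exp (norm z * asum x))))"
        by (intro integrable_norm exp_decay_bound_integrable[OF u, of _ "norm z"]) (auto simp: norm_mult)
      show "AE x in lborel. (\<lambda>N. \<Sum>i<N. u x * ?T x (?e i)) \<longlonglongrightarrow> u x * exp (\<i> * cdot z x)"
      proof (rule AE_I2)
        fix x
        have "((\<lambda>i. ?T x (?e i)) has_sum exp (\<i> * cdot z x)) UNIV"
          using T[of x] by (subst has_sum_reindex_bij_betw[OF e])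
        from has_sum_imp_sums[OF this]
        show "(\<lambda>N. \<Sum>i<N. u x * ?T x (?e i)) \<longlonglongrightarrow> u x * exp (\<i> * cdot z x)"
          unfolding sums_def sum_distrib_left[symmetric] by (rule tendsto_mult_left)
      qed
      show "AE x in lborel. norm (\<Sum>i<N. u x * ?T x (?e i)) \<le> norm (u x * of_real (exp (norm z * asum x)))" for N
      proof (rule AE_I2)
        fix x
        have "norm (\<Sum>i<N. ?T x (?e i)) \<le> exp (norm z * asum x)"
          by (rule order_trans[OF norm_sum sum_norm])
        then have "norm (u x) * norm (\<Sum>i<N. ?T x (?e i)) \<le> norm (u x) * exp (norm z * asum x)"
          by (rule mult_left_mono) simp
        then show "norm (\<Sum>i<N. u x * ?T x (?e i)) \<le> norm (u x * of_real (exp (norm z * asum x)))"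
          by (simp only: sum_distrib_left[symmetric] norm_mult) simp
      qed
    qed measurable
    then show "(\<lambda>N. \<Sum>i<N. c (?e i)) \<longlonglongrightarrow> CT u z"
      unfolding c_def by (simp only: Bochner_Integration.integral_sum[OF int])
  qed
  \<comment> \<open>Absolute summability leads back from the chosen enumeration to the unordered
    sum.\<close>
  moreover have "summable (\<lambda>i. norm (c (?e i)))"
  proof (rule summableI_nonneg_bounded)
    fix N
    have "(\<Sum>i<N. norm (c (?e i))) \<le> (\<Sum>i<N. LINT x|lborel. norm (u x * ?T x (?e i)))"
      unfolding c_def by (intro sum_mono integral_norm_bound)
    also have "\<dots> = (LINT x|lborel. (\<Sum>i<N. norm (u x * ?T x (?e i))))"
      by (rule Bochner_Integration.integral_sum[symmetric]) (intro integrable_norm int)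
    also have "\<dots> \<le> (LINT x|lborel. norm (u x * of_real (exp (norm z * asum x))))"
    proof (rule integral_mono)
      show "integrable lborel (\<lambda>x. \<Sum>i<N. norm (u x * ?T x (?e i)))"
        by (intro Bochner_Integration.integrable_sum integrable_norm int)
      show "integrable lborel (\<lambda>x. norm (u x * of_real (exp (norm z * asum x))))"
        by (intro integrable_norm exp_decay_bound_integrable[OF u, of _ "norm z"]) (auto simp: norm_mult)
      show "(\<Sum>i<N. norm (u x * ?T x (?e i))) \<le> norm (u x * of_real (exp (norm z * asum x)))" for x
        unfolding norm_mult sum_distrib_left[symmetric] using sum_norm[of x N]
        by (intro mult_left_mono) auto
    qed
    finally show "(\<Sum>i<N. norm (c (?e i))) \<le> (LINT x|lborel. norm (u x * of_real (exp (norm z * asum x))))" .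
  qed simp
  ultimately have "((\<lambda>i. c (?e i)) has_sum CT u z) UNIV" by (rule norm_summable_imp_has_sum[rotated])
  then have "(c has_sum CT u z) UNIV" by (simp only: has_sum_reindex_bij_betw[OF e])
  then have "CT u z = infsum c UNIV" by (rule infsumI[symmetric])
  also have "\<dots> = (\<Sum>\<^sub>\<infinity>\<alpha>\<in>UNIV. mderiv \<alpha> (FT 1 u) 0 / of_real (mi_fact \<alpha>) * mi_power z \<alpha>)"
    by (rule infsum_cong) (rule c)
  finally show ?thesis .
qed

section \<open>Polynomial decay of the real transform and its derivatives\<close>

lemma mi_power_split: "mi_power y \<alpha> = y $ j ^ \<alpha> j * (\<Prod>i\<in>UNIV - {j}. y $ i ^ \<alpha> i)"
  unfolding mi_power_def by (rule prod.remove) auto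

lemma has_real_derivative_mi_power:
  fixes x :: "real^'n::finite"
  shows "((\<lambda>t. mi_power (x + t *\<^sub>R axis j 1) \<alpha>) has_real_derivative
      real (\<alpha> j) * mi_power (x + t *\<^sub>R axis j 1) (\<alpha>(j := \<alpha> j - 1))) (at t)"
proof -
  let ?c = "\<Prod>i\<in>UNIV - {j}. x $ i ^ \<alpha> i"
  have eq: "mi_power (x + s *\<^sub>R axis j 1) (\<alpha>(j := k)) = (x $ j + s) ^ k * ?c" for s k
    unfolding mi_power_split[of _ _ j]
    by (intro arg_cong2[where f="(*)"] prod.cong refl) (auto simp: axis_def)
  have "((\<lambda>t. (x $ j + t) ^ \<alpha> j * ?c) has_real_derivative real (\<alpha> j) * ((x $ j + t) ^ (\<alpha> j - 1) * ?c)) (at t)"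
    by (auto intro!: derivative_eq_intros)
  then show ?thesis unfolding eq[symmetric] by simp
qed

lemma mi_abs_upd: "mi_abs \<alpha> = \<alpha> j + mi_abs (\<alpha>(j := 0))"
proof -
  have "mi_abs \<alpha> = \<alpha> j + (\<Sum>i\<in>UNIV - {j}. \<alpha> i)" unfolding mi_abs_def by (rule sum.remove) auto
  moreover have "mi_abs (\<alpha>(j := 0)) = (\<alpha>(j := 0)) j + (\<Sum>i\<in>UNIV - {j}. (\<alpha>(j := 0)) i)"
    unfolding mi_abs_def by (rule sum.remove) auto
  moreover have "(\<Sum>i\<in>UNIV - {j}. (\<alpha>(j := 0)) i) = (\<Sum>i\<in>UNIV - {j}. \<alpha> i)" by (rule sum.cong) auto
  ultimately show ?thesis by simp
qed

lemma mi_fact_pred: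
  assumes "\<alpha> j > 0"
  shows "real (\<alpha> j) * mi_fact (\<alpha>(j := \<alpha> j - 1)) = mi_fact \<alpha>"
proof -
  have "mi_fact (\<alpha>(j := k)) = fact k * (\<Prod>i\<in>UNIV - {j}. fact (\<alpha> i))" for k
    unfolding mi_fact_def by (subst prod.remove[of _ j]) (auto intro!: prod.cong)
  from this[of "\<alpha> j"] this[of "\<alpha> j - 1"] show ?thesis
    using fact_reduce[OF assms, where 'a=real] by simp
qed

text \<open>Integrating by parts \<open>m\<close> times in direction \<open>j\<close> turns \<open>\<xi>\<^sub>j ^ m\<close> into at most \<open>m\<close>
  derivatives falling on \<open>x ^ \<alpha>\<close>, whence the truncated difference \<open>\<alpha> j - m\<close>.\<close>

lemma (in weight) FT_mi_power_decay:
  assumes F: "\<And>p. seq_decay h (K p) (F p)" "\<And>p. exp_decay (F p)"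
    and deriv: "\<And>p x t. ((\<lambda>t. F p (x + t *\<^sub>R axis j 1)) has_vector_derivative F (Suc p) (x + t *\<^sub>R axis j 1)) (at t)"
  shows "\<exists>C\<ge>0. \<forall>\<alpha> \<xi>. \<bar>\<xi> $ j\<bar> ^ m * norm (FT 1 (\<lambda>x. of_real (mi_power x \<alpha>) * F p x) \<xi>) \<le>
      C * (mi_fact \<alpha> * 2 ^ mi_abs \<alpha> * exp (- h (mi_vec (\<alpha>(j := \<alpha> j - m)))))"
\<comment> \<open>\<open>p\<close> varies because one of the two terms of the product rule passes
  from \<open>F p\<close> to \<open>F (Suc p)\<close>.\<close>
proof (induction m arbitrary: p)
  case 0
  let ?C = "8 ^ CARD('n) * K p * (LINT x|lborel. cweight (x::real^'n))"
  have C: "?C \<ge> 0"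
    using seq_decay_nonneg[OF F(1)[of p]]
    by (intro mult_nonneg_nonneg Bochner_Integration.integral_nonneg) (auto simp: less_imp_le[OF cweight_pos])
  have "norm (FT 1 (\<lambda>x. of_real (mi_power x \<alpha>) * F p x) \<xi>) \<le>
      ?C * (mi_fact \<alpha> * 2 ^ mi_abs \<alpha> * exp (- h (mi_vec \<alpha>)))" for \<alpha> \<xi>
  proof -
    have i: "integrable lborel (\<lambda>x. of_real (mi_power x \<alpha>) * F p x)"
      by (intro exp_decay_integrable exp_decay_mi_power F)
    have "norm (FT 1 (\<lambda>x. of_real (mi_power x \<alpha>) * F p x) \<xi>) \<le> (LINT x|lborel. norm (of_real (mi_power x \<alpha>) * F p x))"
      by (rule FT_bound[OF i])
    also have "\<dots> \<le> (LINT x|lborel. (8 ^ CARD('n) * K p * (mi_fact \<alpha> * 2 ^ mi_abs \<alpha> * exp (- h (mi_vec \<alpha>)))) * cweight (x::real^'n))"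
    proof (rule integral_mono[OF integrable_norm[OF i] integrable_mult_right[OF integrable_cweight]])
      fix x
      have "norm (of_real (mi_power x \<alpha>) * F p x) = (\<Prod>j\<in>UNIV. \<bar>x $ j\<bar> ^ \<alpha> j) * norm (F p x)"
        by (simp add: norm_mult abs_mi_power)
      also have "\<dots> \<le> 8 ^ CARD('n) * K p * cweight x * (mi_fact \<alpha> * 2 ^ mi_abs \<alpha> * exp (- h (mi_vec \<alpha>)))"
        by (rule seq_decay_cweight[OF F(1)])
      finally show "norm (of_real (mi_power x \<alpha>) * F p x) \<le>
          (8 ^ CARD('n) * K p * (mi_fact \<alpha> * 2 ^ mi_abs \<alpha> * exp (- h (mi_vec \<alpha>)))) * cweight x"
        by (simp only: mult_ac)
    qed
    finally show ?thesis by (simp add: mult_ac)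
  qed
  then show ?case using C by auto
next
  case (Suc m)
  obtain C where C: "C \<ge> 0" "\<And>\<alpha> \<xi>. \<bar>\<xi> $ j\<bar> ^ m * norm (FT 1 (\<lambda>x. of_real (mi_power x \<alpha>) * F p x) \<xi>) \<le>
      C * (mi_fact \<alpha> * 2 ^ mi_abs \<alpha> * exp (- h (mi_vec (\<alpha>(j := \<alpha> j - m)))))"
    using Suc[of p] by blast
  obtain D where D: "D \<ge> 0" "\<And>\<alpha> \<xi>. \<bar>\<xi> $ j\<bar> ^ m * norm (FT 1 (\<lambda>x. of_real (mi_power x \<alpha>) * F (Suc p) x) \<xi>) \<le>
      D * (mi_fact \<alpha> * 2 ^ mi_abs \<alpha> * exp (- h (mi_vec (\<alpha>(j := \<alpha> j - m)))))"
    using Suc[of "Suc p"] by blast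
  have "\<bar>\<xi> $ j\<bar> ^ Suc m * norm (FT 1 (\<lambda>x. of_real (mi_power x \<alpha>) * F p x) \<xi>) \<le>
      (C + D) * (mi_fact \<alpha> * 2 ^ mi_abs \<alpha> * exp (- h (mi_vec (\<alpha>(j := \<alpha> j - Suc m)))))" for \<alpha> \<xi>
  proof -
    let ?\<alpha> = "\<alpha>(j := \<alpha> j - 1)"
    let ?u = "\<lambda>x. of_real (mi_power x \<alpha>) * F p x"
    let ?v1 = "\<lambda>x. of_real (real (\<alpha> j)) * (of_real (mi_power x ?\<alpha>) * F p x)"
    let ?v2 = "\<lambda>x. of_real (mi_power x \<alpha>) * F (Suc p) x"
    let ?E = "exp (- h (mi_vec (\<alpha>(j := \<alpha> j - Suc m))))"
    have ed: "exp_decay ?u" "exp_decay ?v1" "exp_decay ?v2"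
      by (intro exp_decay_const exp_decay_mi_power F)+
    have hvd: "((\<lambda>t. ?u (x + t *\<^sub>R axis j 1)) has_vector_derivative ?v1 (x + t *\<^sub>R axis j 1) + ?v2 (x + t *\<^sub>R axis j 1)) (at t)" for x t
    proof -
      have "((\<lambda>t. complex_of_real (mi_power (x + t *\<^sub>R axis j 1) \<alpha>)) has_vector_derivative
          complex_of_real (real (\<alpha> j) * mi_power (x + t *\<^sub>R axis j 1) ?\<alpha>)) (at t)"
        by (rule has_vector_derivative_of_real[OF has_real_derivative_mi_power])
      from has_vector_derivative_mult[OF this deriv[of p x t]]
      show ?thesis by (simp add: add.commute mult.assoc)
    qed
    have "of_real (\<xi> $ j) * FT 1 ?u \<xi> = \<i> * CT (\<lambda>x. ?v1 x + ?v2 x) (cvec \<xi>)"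
    proof -
      have cv: "of_real (\<xi> $ j) = cvec \<xi> $ j" by (simp add: cvec_def)
      show ?thesis unfolding CT_cvec[symmetric] cv by (rule CT_by_parts[OF ed(1) exp_decay_add[OF ed(2,3)] hvd])
    qed
    also have "\<dots> = \<i> * (of_real (real (\<alpha> j)) * FT 1 (\<lambda>x. of_real (mi_power x ?\<alpha>) * F p x) \<xi> + FT 1 ?v2 \<xi>)"
      unfolding CT_add[OF ed(2,3)] CT_scale by (simp only: CT_cvec)
    finally have E: "of_real (\<xi> $ j) * FT 1 ?u \<xi> = \<i> * (of_real (real (\<alpha> j)) * FT 1 (\<lambda>x. of_real (mi_power x ?\<alpha>) * F p x) \<xi> + FT 1 ?v2 \<xi>)" .
    have "\<bar>\<xi> $ j\<bar> * norm (FT 1 ?u \<xi>) = norm (of_real (\<xi> $ j) * FT 1 ?u \<xi>)"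
      by (simp only: norm_mult norm_of_real)
    also have "\<dots> = norm (of_real (real (\<alpha> j)) * FT 1 (\<lambda>x. of_real (mi_power x ?\<alpha>) * F p x) \<xi> + FT 1 ?v2 \<xi>)"
      by (simp only: E norm_mult[of \<i>] norm_ii mult_1_left)
    also have "\<dots> \<le> real (\<alpha> j) * norm (FT 1 (\<lambda>x. of_real (mi_power x ?\<alpha>) * F p x) \<xi>) + norm (FT 1 ?v2 \<xi>)"
      using norm_triangle_ineq[of "of_real (real (\<alpha> j)) * FT 1 (\<lambda>x. of_real (mi_power x ?\<alpha>) * F p x) \<xi>" "FT 1 ?v2 \<xi>"]
      by (simp add: norm_mult)
    finally have "\<bar>\<xi> $ j\<bar> ^ m * (\<bar>\<xi> $ j\<bar> * norm (FT 1 ?u \<xi>)) \<le>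
        \<bar>\<xi> $ j\<bar> ^ m * (real (\<alpha> j) * norm (FT 1 (\<lambda>x. of_real (mi_power x ?\<alpha>) * F p x) \<xi>) + norm (FT 1 ?v2 \<xi>))"
      by (rule mult_left_mono) simp
    then have "\<bar>\<xi> $ j\<bar> ^ Suc m * norm (FT 1 ?u \<xi>) \<le>
        real (\<alpha> j) * (\<bar>\<xi> $ j\<bar> ^ m * norm (FT 1 (\<lambda>x. of_real (mi_power x ?\<alpha>) * F p x) \<xi>))
        + \<bar>\<xi> $ j\<bar> ^ m * norm (FT 1 ?v2 \<xi>)"
      by (simp add: algebra_simps)
    also have "\<dots> \<le> C * (mi_fact \<alpha> * 2 ^ mi_abs \<alpha> * ?E) + D * (mi_fact \<alpha> * 2 ^ mi_abs \<alpha> * ?E)"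
    proof (rule add_mono)
      show "real (\<alpha> j) * (\<bar>\<xi> $ j\<bar> ^ m * norm (FT 1 (\<lambda>x. of_real (mi_power x ?\<alpha>) * F p x) \<xi>)) \<le> C * (mi_fact \<alpha> * 2 ^ mi_abs \<alpha> * ?E)"
      \<comment> \<open>For \<open>\<alpha> j = 0\<close> the term vanishes. Otherwise the factor
        \<open>\<alpha> j\<close> restores the factorial, and the truncated differences compose:
        \<open>(\<alpha> j - 1) - m = \<alpha> j - Suc m\<close>.\<close>
      proof (cases "\<alpha> j = 0")
        case True
        then show ?thesis using C(1) mi_fact_pos[of \<alpha>] by simp
      next
        case False
        have "real (\<alpha> j) * (\<bar>\<xi> $ j\<bar> ^ m * norm (FT 1 (\<lambda>x. of_real (mi_power x ?\<alpha>) * F p x) \<xi>))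
          \<le> real (\<alpha> j) * (C * (mi_fact ?\<alpha> * 2 ^ mi_abs ?\<alpha> * exp (- h (mi_vec (?\<alpha>(j := ?\<alpha> j - m))))))"
          by (intro mult_left_mono C) auto
        also have "?\<alpha>(j := ?\<alpha> j - m) = \<alpha>(j := \<alpha> j - Suc m)" by auto
        also have "real (\<alpha> j) * (C * (mi_fact ?\<alpha> * 2 ^ mi_abs ?\<alpha> * ?E)) = C * (mi_fact \<alpha> * 2 ^ mi_abs ?\<alpha> * ?E)"
          using mi_fact_pred[of \<alpha> j] False by simp
        also have "\<dots> \<le> C * (mi_fact \<alpha> * 2 ^ mi_abs \<alpha> * ?E)"
        proof -
          have "mi_abs ?\<alpha> \<le> mi_abs \<alpha>" using mi_abs_upd[of \<alpha> j] mi_abs_upd[of ?\<alpha> j] by simp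
          then show ?thesis using C(1) mi_fact_pos[of \<alpha>]
            by (intro mult_left_mono mult_right_mono power_increasing) auto
        qed
        finally show ?thesis .
      qed
      \<comment> \<open>In the second term no power of \<open>x\<close> was lost; monotonicity of
        \<open>h\<close> weakens its bound to the common form.\<close>
      have "?E \<ge> exp (- h (mi_vec (\<alpha>(j := \<alpha> j - m))))"
        by (simp, rule mono) (auto simp: mi_vec_def nonneg_orthant_def)
      then have "D * (mi_fact \<alpha> * 2 ^ mi_abs \<alpha> * exp (- h (mi_vec (\<alpha>(j := \<alpha> j - m))))) \<le> D * (mi_fact \<alpha> * 2 ^ mi_abs \<alpha> * ?E)"
        using D(1) mi_fact_pos[of \<alpha>] by (intro mult_left_mono) auto
      then show "\<bar>\<xi> $ j\<bar> ^ m * norm (FT 1 ?v2 \<xi>) \<le> D * (mi_fact \<alpha> * 2 ^ mi_abs \<alpha> * ?E)"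
        using D(2)[of \<xi> \<alpha>] by linarith
    qed
    finally show ?thesis by (simp add: distrib_right)
  qed
  moreover have "C + D \<ge> 0" using C(1) D(1) by simp
  ultimately show ?case by blast
qed

text \<open>Compare with the maximum \<open>M\<close> of 1 and all \<open>c j\<close>: the left sum
  has \<open>CARD('n) + 1\<close> terms of size at most \<open>M\<close>, and \<open>M ^ m\<close>
  is itself one of the summands on the right.\<close>

lemma power_one_plus_sum_le:
  fixes c :: "'n::finite \<Rightarrow> real"
  assumes c: "\<And>j. c j \<ge> 0"
  shows "(1 + (\<Sum>j\<in>UNIV. c j)) ^ m \<le> (real CARD('n) + 1) ^ m * (1 + (\<Sum>j\<in>UNIV. c j ^ m))"
proof -
  define M where "M = Max (insert 1 (range c))"
  have "y \<le> M" if "y \<in> insert 1 (range c)" for y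
    unfolding M_def by (rule Max_ge[OF _ that]) simp
  then have M: "1 \<le> M" "\<And>j. c j \<le> M" by blast+
  have "1 + (\<Sum>j\<in>UNIV. c j) \<le> (real CARD('n) + 1) * M"
    using sum_bounded_above[of UNIV c M] M by (simp add: distrib_right)
  then have "(1 + (\<Sum>j\<in>UNIV. c j)) ^ m \<le> ((real CARD('n) + 1) * M) ^ m"
    using c by (intro power_mono add_nonneg_nonneg sum_nonneg) auto
  also have "\<dots> = (real CARD('n) + 1) ^ m * M ^ m" by (rule power_mult_distrib)
  also have "\<dots> \<le> (real CARD('n) + 1) ^ m * (1 + (\<Sum>j\<in>UNIV. c j ^ m))"
  proof (rule mult_left_mono)
    have "M \<in> insert 1 (range c)" unfolding M_def by (rule Max_in) auto
    then show "M ^ m \<le> 1 + (\<Sum>j\<in>UNIV. c j ^ m)"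
    proof
      assume "M \<in> range c"
      then obtain j where "M = c j" by blast
      moreover have "c j ^ m \<le> (\<Sum>j\<in>UNIV. c j ^ m)" using c by (intro member_le_sum) auto
      ultimately show ?thesis by simp
    qed (use c in \<open>simp add: sum_nonneg\<close>)
  qed simp
  finally show ?thesis .
qed

lemma norm_vec_le_sum: "norm z \<le> (\<Sum>j\<in>UNIV. norm (z $ j))" for z :: "'a::real_normed_vector^'n::finite"
  unfolding norm_vec_def by (rule L2_set_le_sum) simp

lemma norm_power_le:
  fixes z :: "'a::real_normed_vector^'n::finite"
  shows "(1 + norm z) ^ m \<le> (real CARD('n) + 1) ^ m * (1 + (\<Sum>j\<in>UNIV. norm (z $ j) ^ m))"
proof -
  have "(1 + norm z) ^ m \<le> (1 + (\<Sum>j\<in>UNIV. norm (z $ j))) ^ m"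
    by (intro power_mono add_left_mono norm_vec_le_sum) simp
  also have "\<dots> \<le> (real CARD('n) + 1) ^ m * (1 + (\<Sum>j\<in>UNIV. norm (z $ j) ^ m))"
    by (rule power_one_plus_sum_le) simp
  finally show ?thesis .
qed

section \<open>The two transforms\<close>

text \<open>With \<open>G_norm_le\<close>, this passes between suprema in
  \<open>[0, \<infinity>]\<close> and inequalities between reals, where the analysis takes
  place.\<close>

lemma G_norm_seq_decay:
  assumes "G_norm m h f < \<infinity>" "mi_abs \<alpha> \<le> m"
  shows "seq_decay h (enn2real (G_norm m h f)) (mderiv \<alpha> f)"
  unfolding seq_decay_def
proof (intro allI)
  fix x \<beta>
  let ?d = "mi_fact \<beta> * exp (- h (mi_vec \<beta>))"
  have d: "?d > 0" using mi_fact_pos[of \<beta>] by simp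
  have "ennreal (cmod (of_real (mi_power x \<beta>) * mderiv \<alpha> f x) / ?d) \<le> G_norm m h f"
    unfolding G_norm_def using assms(2) by (intro Sup_upper) blast
  also have "\<dots> = ennreal (enn2real (G_norm m h f))" using assms(1) by simp
  finally have "cmod (of_real (mi_power x \<beta>) * mderiv \<alpha> f x) / ?d \<le> enn2real (G_norm m h f)"
    by (simp add: ennreal_le_iff)
  then show "(\<Prod>j\<in>UNIV. \<bar>x $ j\<bar> ^ \<beta> j) * norm (mderiv \<alpha> f x) \<le> enn2real (G_norm m h f) * ?d"
    using d by (simp add: divide_le_eq norm_mult abs_mi_power)
qed

lemma G_norm_le:
  fixes f :: "real^'n::finite \<Rightarrow> complex"
  assumes "\<And>\<alpha>. mi_abs \<alpha> \<le> m \<Longrightarrow> seq_decay h K (mderiv \<alpha> f)"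
  shows "G_norm m h f \<le> ennreal K"
  unfolding G_norm_def
proof (rule Sup_least, clarify)
  fix x :: "real^'n" and \<beta> \<alpha> :: "'n \<Rightarrow> nat" assume \<alpha>: "mi_abs \<alpha> \<le> m"
  let ?d = "mi_fact \<beta> * exp (- h (mi_vec \<beta>))"
  have "?d > 0" using mi_fact_pos[of \<beta>] by simp
  moreover have "cmod (of_real (mi_power x \<beta>) * mderiv \<alpha> f x) \<le> K * ?d"
    using assms[OF \<alpha>] unfolding seq_decay_def by (simp add: norm_mult abs_mi_power)
  ultimately show "ennreal (cmod (of_real (mi_power x \<beta>) * mderiv \<alpha> f x) / ?d) \<le> ennreal K"
    by (intro ennreal_leI) (simp add: divide_le_eq)
qed

lemma E_norm_bound:
  assumes "E_norm m \<phi> F < \<infinity>"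
  shows "norm (F z) * (1 + norm z) ^ m \<le> enn2real (E_norm m \<phi> F) * exp (\<phi> (\<chi> j. Im (z $ j)))"
proof -
  let ?d = "exp (\<phi> (\<chi> j. Im (z $ j)))"
  have "ennreal (norm (F z) * (1 + norm z) ^ m / ?d) \<le> E_norm m \<phi> F"
    unfolding E_norm_def by (intro Sup_upper) blast
  also have "\<dots> = ennreal (enn2real (E_norm m \<phi> F))" using assms by simp
  finally have "norm (F z) * (1 + norm z) ^ m / ?d \<le> enn2real (E_norm m \<phi> F)"
    by (simp add: ennreal_le_iff)
  then show ?thesis by (simp add: divide_le_eq)
qed

lemma E_norm_le:
  assumes "\<And>z. norm (F z) * (1 + norm z) ^ m \<le> K * exp (\<phi> (\<chi> j. Im (z $ j)))"
  shows "E_norm m \<phi> F \<le> ennreal K"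
  unfolding E_norm_def
proof (rule Sup_least, clarify)
  fix z
  show "ennreal (norm (F z) * (1 + norm z) ^ m / exp (\<phi> (\<chi> j. Im (z $ j)))) \<le> ennreal K"
    using assms[of z] by (intro ennreal_leI) (simp add: divide_le_eq)
qed

text \<open>It takes a type argument, since the dimension is present only in the type.\<close>

definition fconst :: "'n::finite itself \<Rightarrow> real" where
  "fconst _ = 1 / sqrt (2 * pi) ^ CARD('n)"

lemma fconst_pos: "fconst TYPE('n::finite) > 0"
  by (simp add: fconst_def)

lemma fconst_square: "fconst TYPE('n::finite) * fconst TYPE('n) * (2 * pi) ^ CARD('n) = 1"
proof -
  have "sqrt (2 * pi) ^ CARD('n) * sqrt (2 * pi) ^ CARD('n) = (sqrt (2 * pi) * sqrt (2 * pi)) ^ CARD('n)"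
    by (rule power_mult_distrib[symmetric])
  also have "sqrt (2 * pi) * sqrt (2 * pi) = 2 * pi" by simp
  finally show ?thesis unfolding fconst_def by (simp add: field_simps)
qed

definition AF :: "(real^'n::finite \<Rightarrow> complex) \<Rightarrow> complex^'n \<Rightarrow> complex" where
  "AF f = CT (\<lambda>x. of_real (fconst TYPE('n)) * f x)"

lemma fourier_eq_FT: "fourier f = FT 1 (\<lambda>x. of_real (fconst TYPE('n)) * f x)"
  for f :: "real^'n::finite \<Rightarrow> complex"
  unfolding FT_scale[abs_def] by (simp add: fourier_def fconst_def FT_def inner_commute fun_eq_iff)

definition BT :: "(complex^'n::finite \<Rightarrow> complex) \<Rightarrow> real^'n \<Rightarrow> complex" where
  "BT F = FT (-1) (\<lambda>x. of_real (fconst TYPE('n)) * F (cvec x))"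

text \<open>The first factor comes from \<open>norm_power_le\<close>,
  \<open>1 + real CARD('n)\<close> counts the function itself and one pure derivative per
  coordinate, and the rest is the constant of \<open>CT_bound\<close>. No function enters, as
  continuity requires.\<close>

definition (in weight_triple) D :: "nat \<Rightarrow> real" where
  "D m = (real CARD('n) + 1) ^ m * (1 + real CARD('n)) *
     (24 ^ CARD('n) * exp (\<gamma> + \<gamma>') * (LINT x|lborel. cweight (x::real^'n)))"

locale G_function = weight_triple h h' h'' \<gamma> \<gamma>'
  for h h' h'' :: "real^'n::finite \<Rightarrow> real" and \<gamma> \<gamma>' :: real +
  fixes f :: "real^'n \<Rightarrow> complex"
  assumes f: "\<And>m. f \<in> G_m m h"
begin

definition K :: "nat \<Rightarrow> real" where "K m = enn2real (G_norm m h f)"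

lemma smooth: "C_diff m f" and G_norm_finite: "G_norm m h f < \<infinity>"
  using f[of m] by (auto simp: G_m_def)

lemma K_nonneg: "K m \<ge> 0"
  by (simp add: K_def)

lemma deriv_smooth: "C_diff m ((partial_deriv j ^^ p) f)"
  by (intro C_diff_iterate smooth)

lemma deriv_measurable [measurable]: "(partial_deriv j ^^ p) f \<in> borel_measurable borel"
  by (intro borel_measurable_continuous_onI C_diff_imp_continuous[OF deriv_smooth])

lemma deriv_seq_decay: "p \<le> m \<Longrightarrow> seq_decay h (K m) ((partial_deriv j ^^ p) f)"
  using G_norm_seq_decay[OF G_norm_finite, of "mi_single j p" m] by (simp add: mderiv_single K_def)

lemma deriv_exp_decay: "exp_decay ((partial_deriv j ^^ p) f)"
  by (rule seq_decay_imp_exp_decay[OF deriv_seq_decay[OF order_refl]]) measurable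

lemma f_measurable [measurable]: "f \<in> borel_measurable borel"
  using deriv_measurable[of 0] by simp

lemma f_seq_decay: "seq_decay h (K m) f"
  using deriv_seq_decay[of 0 m] by simp

lemma f_exp_decay: "exp_decay f"
  using deriv_exp_decay[of 0] by simp

lemma deriv_hvd: "((\<lambda>t. (partial_deriv j ^^ p) f (x + t *\<^sub>R axis j 1)) has_vector_derivative
    (partial_deriv j ^^ Suc p) f (x + t *\<^sub>R axis j 1)) (at t)"
  using C_diff_has_partial_deriv[OF deriv_smooth[of "Suc 0"]] by simp

lemma norm_CT_deriv: "norm (z $ j) ^ p * norm (CT f z) = norm (CT ((partial_deriv j ^^ p) f) z)"
proof (induction p)
  case (Suc p)
  have "norm (z $ j) ^ Suc p * norm (CT f z) = norm (z $ j * CT ((partial_deriv j ^^ p) f) z)"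
    using Suc by (simp add: norm_mult)
  also have "\<dots> = norm (\<i> * CT ((partial_deriv j ^^ Suc p) f) z)"
    by (simp only: CT_by_parts[OF deriv_exp_decay deriv_exp_decay deriv_hvd])
  finally show ?case by (simp add: norm_mult)
qed simp

text \<open>By \<open>norm_power_le\<close> the polynomial factor involves only the pure powers
  \<open>norm (z $ j) ^ m\<close>, and each of these is an \<open>m\<close>-fold integration by
  parts in one direction.\<close>

lemma CT_growth: "norm (CT f z) * (1 + norm z) ^ m \<le> D m * K m * exp (phi h'' (\<chi> j. Im (z $ j)))"
proof -
  let ?B = "(24 ^ CARD('n) * exp (\<gamma> + \<gamma>') * (LINT x|lborel. cweight (x::real^'n))) * K m * exp (phi h'' (\<chi> j. Im (z $ j)))"
  have 0: "norm (CT f z) \<le> ?B" by (rule CT_bound[OF f_seq_decay]) measurable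
  have j: "norm (z $ j) ^ m * norm (CT f z) \<le> ?B" for j
    unfolding norm_CT_deriv by (rule CT_bound[OF deriv_seq_decay]) auto
  have "(1 + norm z) ^ m * norm (CT f z) \<le>
      ((real CARD('n) + 1) ^ m * (1 + (\<Sum>j\<in>UNIV. norm (z $ j) ^ m))) * norm (CT f z)"
    by (intro mult_right_mono norm_power_le) simp
  also have "\<dots> = (real CARD('n) + 1) ^ m * (norm (CT f z) + (\<Sum>j\<in>UNIV. norm (z $ j) ^ m * norm (CT f z)))"
    by (simp add: algebra_simps sum_distrib_left)
  also have "\<dots> \<le> (real CARD('n) + 1) ^ m * (?B + (\<Sum>j\<in>(UNIV::'n set). ?B))"
    by (intro mult_left_mono add_mono sum_mono 0 j) auto
  also have "\<dots> = D m * K m * exp (phi h'' (\<chi> j. Im (z $ j)))"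
    by (simp add: D_def algebra_simps)
  finally show ?thesis by (simp add: mult_ac)
qed

lemma AF_eq: "AF f z = of_real (fconst TYPE('n)) * CT f z"
  by (simp add: AF_def CT_scale)

lemma AF_E_norm: "E_norm m (phi h'') (AF f) \<le> ennreal (fconst TYPE('n) * D m) * G_norm m h f"
proof -
  have "E_norm m (phi h'') (AF f) \<le> ennreal (fconst TYPE('n) * (D m * K m))"
  proof (rule E_norm_le)
    fix z
    have "norm (AF f z) * (1 + norm z) ^ m = fconst TYPE('n) * (norm (CT f z) * (1 + norm z) ^ m)"
      using fconst_pos[where 'n='n] by (simp add: AF_eq norm_mult)
    also have "\<dots> \<le> fconst TYPE('n) * (D m * K m * exp (phi h'' (\<chi> j. Im (z $ j))))"
      using fconst_pos[where 'n='n] by (intro mult_left_mono CT_growth) auto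
    finally show "norm (AF f z) * (1 + norm z) ^ m \<le> fconst TYPE('n) * (D m * K m) * exp (phi h'' (\<chi> j. Im (z $ j)))"
      by (simp add: mult_ac)
  qed
  also have "\<dots> = ennreal (fconst TYPE('n) * D m) * ennreal (K m)"
    using K_nonneg[of m] by (simp add: ennreal_mult'' flip: mult.assoc)
  also have "ennreal (K m) = G_norm m h f" using G_norm_finite[of m] by (simp add: K_def)
  finally show ?thesis .
qed

lemma scaled_exp_decay: "exp_decay (\<lambda>x. of_real (fconst TYPE('n)) * f x)"
  by (intro exp_decay_const f_exp_decay)

lemma AF_entire: "entire (AF f)"
  unfolding AF_def by (rule entire_CT[OF scaled_exp_decay])

lemma AF_mem: "AF f \<in> E_m m (phi h'')"
proof -
  have "E_norm m (phi h'') (AF f) < \<infinity>"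
    using order_le_less_trans[OF AF_E_norm] G_norm_finite[of m] by (auto simp: ennreal_mult_less_top)
  then show ?thesis using AF_entire by (simp add: E_m_def)
qed

lemma AF_cvec: "AF f (cvec x) = fourier f x"
  unfolding AF_def CT_cvec fourier_eq_FT ..

lemma AF_eq_infsum:
  "AF f z = (\<Sum>\<^sub>\<infinity>\<alpha>\<in>UNIV. mderiv \<alpha> (fourier f) 0 / of_real (mi_fact \<alpha>) * mi_power z \<alpha>)"
  unfolding AF_def fourier_eq_FT by (rule CT_eq_infsum[OF scaled_exp_decay])

lemma fourier_smooth: "C_diff m (fourier f)"
  unfolding fourier_eq_FT by (intro C_diff_FT exp_decay_rapid scaled_exp_decay)

text \<open>Integration by parts against a \<open>k\<close>-th power of \<open>\<xi> $ j\<close>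
  lowers coordinate \<open>j\<close> of \<alpha> in the weight by \<open>k\<close>. Condition 6
  restores it at the cost of the constant \<open>l + h ?e\<close> and one step; the second step
  absorbs the factor \<open>2 ^ mi_abs \<alpha>\<close>.\<close>

lemma fourier_E_smooth:
  assumes sub: "\<And>x y. x \<in> nonneg_orthant \<Longrightarrow> y \<in> nonneg_orthant \<Longrightarrow> h' (x + y) \<le> h x + h y + l"
  shows "fourier f \<in> E_smooth_m m h''"
proof -
  let ?c = "fconst TYPE('n)"
  define A where "A \<alpha> \<xi> = norm (FT 1 (\<lambda>x. of_real (mi_power x \<alpha>) * f x) \<xi>)" for \<alpha> \<xi>
  have bound: "\<exists>C\<ge>0. \<forall>\<alpha> \<xi>. \<bar>\<xi> $ j\<bar> ^ k * A \<alpha> \<xi> \<le> C * (mi_fact \<alpha> * exp (- h'' (mi_vec \<alpha>)))" for j k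
  proof -
    obtain C where C: "C \<ge> 0" "\<And>\<alpha> \<xi>. \<bar>\<xi> $ j\<bar> ^ k * A \<alpha> \<xi> \<le>
      C * (mi_fact \<alpha> * 2 ^ mi_abs \<alpha> * exp (- h (mi_vec (\<alpha>(j := \<alpha> j - k)))))"
      using P.A.FT_mi_power_decay[of K "\<lambda>p. (partial_deriv j ^^ p) f", OF deriv_seq_decay[OF order_refl] deriv_exp_decay deriv_hvd, of k 0]
      unfolding A_def by auto
    let ?e = "mi_vec (mi_single j k) :: real^'n"
    have "exp (- h (mi_vec (\<alpha>(j := \<alpha> j - k)))) \<le> exp (l + h ?e) * exp (- h' (mi_vec \<alpha>))" for \<alpha>
    proof -
      \<comment> \<open>Not an equality of arguments: for \<open>\<alpha> j < k\<close> the
        truncated difference makes the right one larger.\<close>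
      have "h' (mi_vec \<alpha>) \<le> h' (mi_vec (\<alpha>(j := \<alpha> j - k)) + ?e)"
        by (rule P.B.mono[OF mi_vec_orthant]) (auto simp: mi_vec_def mi_single_def)
      also have "\<dots> \<le> h (mi_vec (\<alpha>(j := \<alpha> j - k))) + h ?e + l" by (rule sub) auto
      finally show ?thesis by (simp flip: exp_add)
    qed
    then have "mi_fact \<alpha> * (2 ^ mi_abs \<alpha> * exp (- h (mi_vec (\<alpha>(j := \<alpha> j - k)))))
        \<le> mi_fact \<alpha> * (2 ^ mi_abs \<alpha> * (exp (l + h ?e) * exp (- h' (mi_vec \<alpha>))))" for \<alpha>
      using mi_fact_pos[of \<alpha>] by (intro mult_left_mono) auto
    also have "mi_fact \<alpha> * (2 ^ mi_abs \<alpha> * (exp (l + h ?e) * exp (- h' (mi_vec \<alpha>))))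
        = mi_fact \<alpha> * exp (l + h ?e) * (2 ^ mi_abs \<alpha> * exp (- h' (mi_vec \<alpha>)))" for \<alpha> by simp
    also have "mi_fact \<alpha> * exp (l + h ?e) * (2 ^ mi_abs \<alpha> * exp (- h' (mi_vec \<alpha>)))
        \<le> mi_fact \<alpha> * exp (l + h ?e) * (exp \<gamma>' * exp (- h'' (mi_vec \<alpha>)))" for \<alpha>
      using mi_fact_pos[of \<alpha>] by (intro mult_left_mono Q.exp_weight_le) auto
    finally have *: "C * (mi_fact \<alpha> * (2 ^ mi_abs \<alpha> * exp (- h (mi_vec (\<alpha>(j := \<alpha> j - k)))))) \<le>
        C * (mi_fact \<alpha> * exp (l + h ?e) * (exp \<gamma>' * exp (- h'' (mi_vec \<alpha>))))" for \<alpha>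
      using C(1) by (intro mult_left_mono) auto
    have "\<bar>\<xi> $ j\<bar> ^ k * A \<alpha> \<xi> \<le> (C * exp (l + h ?e) * exp \<gamma>') * (mi_fact \<alpha> * exp (- h'' (mi_vec \<alpha>)))" for \<alpha> \<xi>
      using order_trans[OF C(2)[of \<xi> \<alpha>], of "C * (mi_fact \<alpha> * exp (l + h ?e) * (exp \<gamma>' * exp (- h'' (mi_vec \<alpha>))))"] *[of \<alpha>]
      by (simp add: mult_ac)
    moreover have "C * exp (l + h ?e) * exp \<gamma>' \<ge> 0" using C(1) by simp
    ultimately show ?thesis by blast
  qed
  have "\<exists>C. \<forall>j. C j \<ge> 0 \<and> (\<forall>\<alpha> \<xi>. \<bar>\<xi> $ j\<bar> ^ m * A \<alpha> \<xi> \<le> C j * (mi_fact \<alpha> * exp (- h'' (mi_vec \<alpha>))))"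
    using bound[of _ m] by (intro choice) blast
  then obtain C where C: "\<And>j. C j \<ge> 0" "\<And>j \<alpha> \<xi>. \<bar>\<xi> $ j\<bar> ^ m * A \<alpha> \<xi> \<le> C j * (mi_fact \<alpha> * exp (- h'' (mi_vec \<alpha>)))"
    by blast
  obtain C0 where C0: "C0 \<ge> 0" "\<And>\<alpha> \<xi>. A \<alpha> \<xi> \<le> C0 * (mi_fact \<alpha> * exp (- h'' (mi_vec \<alpha>)))"
    using bound[of _ 0] by auto
  let ?M = "?c * ((real CARD('n) + 1) ^ m * (C0 + (\<Sum>j\<in>UNIV. C j)))"
  have "E_rho m h'' (fourier f) \<le> ennreal ?M"
    unfolding E_rho_def
  proof (rule Sup_least, clarify)
    fix \<xi> :: "real^'n" and \<alpha>
    let ?d = "mi_fact \<alpha> * exp (- h'' (mi_vec \<alpha>))"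
    have d: "?d > 0" using mi_fact_pos[of \<alpha>] by simp
    have "mderiv \<alpha> (fourier f) \<xi> = FT 1 (\<lambda>x. (\<i> ^ mi_abs \<alpha> * of_real ?c) * (of_real (mi_power x \<alpha>) * f x)) \<xi>"
      unfolding fourier_eq_FT mderiv_FT[OF exp_decay_rapid[OF scaled_exp_decay]]
      by (intro arg_cong[where f="\<lambda>g. FT 1 g \<xi>"] ext)
        (simp add: power_mult_distrib prod.distrib mi_power_def mi_abs_def power_sum)
    then have "norm (mderiv \<alpha> (fourier f) \<xi>) = ?c * A \<alpha> \<xi>"
      unfolding FT_scale A_def using fconst_pos[where 'n='n] by (simp add: norm_mult norm_power)
    then have "(1 + norm \<xi>) ^ m * norm (mderiv \<alpha> (fourier f) \<xi>) = ?c * ((1 + norm \<xi>) ^ m * A \<alpha> \<xi>)" by simp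
    also have "\<dots> \<le> ?c * (((real CARD('n) + 1) ^ m * (1 + (\<Sum>j\<in>UNIV. norm (\<xi> $ j) ^ m))) * A \<alpha> \<xi>)"
      using fconst_pos[where 'n='n] by (intro mult_left_mono mult_right_mono norm_power_le) (auto simp: A_def)
    also have "\<dots> = ?c * ((real CARD('n) + 1) ^ m * (A \<alpha> \<xi> + (\<Sum>j\<in>UNIV. \<bar>\<xi> $ j\<bar> ^ m * A \<alpha> \<xi>)))"
      by (simp add: distrib_right sum_distrib_right mult.assoc)
    also have "\<dots> \<le> ?c * ((real CARD('n) + 1) ^ m * (C0 * ?d + (\<Sum>j\<in>UNIV. C j * ?d)))"
      using fconst_pos[where 'n='n] by (intro mult_left_mono add_mono sum_mono C0 C) auto
    also have "\<dots> = ?M * ?d" by (simp add: sum_distrib_right distrib_right mult.assoc)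
    finally show "ennreal ((1 + norm \<xi>) ^ m * cmod (mderiv \<alpha> (fourier f) \<xi>) / ?d) \<le> ennreal ?M"
      using d by (intro ennreal_leI) (simp add: divide_le_eq)
  qed
  then have "E_rho m h'' (fourier f) < \<infinity>" by (rule order_le_less_trans) simp
  then show ?thesis using fourier_smooth by (simp add: E_smooth_m_def)
qed

end

section \<open>Entire functions on complex lines and contour shifts\<close>

lemma entire_continuous: "entire F \<Longrightarrow> continuous_on UNIV F"
  unfolding entire_def continuous_on_eq_continuous_at[OF open_UNIV]
  by (blast dest: has_derivative_continuous)

text \<open>By the chain rule and complex homogeneity, the derivative along the line is
  multiplication by \<open>f' w\<close>.\<close>

lemma entire_holomorphic_line:
  assumes "entire F"
  shows "(\<lambda>\<tau>. F (z + \<tau> *s w)) holomorphic_on UNIV"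
  unfolding holomorphic_on_def field_differentiable_def
proof
  fix \<tau> :: complex
  obtain f' where f': "(F has_derivative f') (at (z + \<tau> *s w))" "\<And>c v. f' (c *s v) = c * f' v"
    using assms unfolding entire_def by blast
  have "bounded_linear (\<lambda>h. h *s w)"
    by (rule bounded_linear_intro[where K="\<Sum>j\<in>UNIV. norm (w $ j)"])
      (auto simp: vec_eq_iff distrib_right norm_mult sum_distrib_left intro!: order_trans[OF norm_vec_le_sum])
  then have "((\<lambda>\<tau>. z + \<tau> *s w) has_derivative (\<lambda>h. h *s w)) (at \<tau>)"
    using has_derivative_add[OF has_derivative_const bounded_linear_imp_has_derivative] by fastforce
  from has_derivative_compose[OF this f'(1)]
  have "((\<lambda>\<tau>. F (z + \<tau> *s w)) has_derivative (\<lambda>h. f' (h *s w))) (at \<tau>)" .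
  moreover have "(\<lambda>h. f' (h *s w)) = (*) (f' w)" by (simp add: fun_eq_iff f'(2) mult.commute)
  ultimately have "((\<lambda>\<tau>. F (z + \<tau> *s w)) has_derivative (*) (f' w)) (at \<tau>)" by simp
  then show "\<exists>f'. ((\<lambda>\<tau>. F (z + \<tau> *s w)) has_field_derivative f') (at \<tau> within UNIV)"
    unfolding has_field_derivative_def by auto
qed

lemma cvec_nth [simp]: "cvec x $ j = of_real (x $ j)"
  by (simp add: cvec_def)

lemma cvec_add: "cvec x + of_real a *s cvec y = cvec (x + a *\<^sub>R y)"
  by (simp add: vec_eq_iff)

lemma continuous_cvec: "continuous_on UNIV (cvec :: real^'n::finite \<Rightarrow> complex^'n)"
  unfolding cvec_def by (intro continuous_intros)

text \<open>On the complex line through \<open>cvec x\<close> in direction \<open>cvec y\<close>,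
  with \<open>x\<close> and \<open>y\<close> the real and imaginary parts of \<open>z\<close>, the
  difference is holomorphic in one variable and vanishes for real parameters, hence everywhere; the
  parameter \<open>\<i>\<close> gives \<open>z\<close>.\<close>

lemma entire_eqI:
  assumes F: "entire F" and E: "entire E" and eq: "\<And>x. F (cvec x) = E (cvec x)"
  shows "F = E"
proof
  fix z :: "complex^'a"
  define x where "x = (\<chi> j. Re (z $ j))"
  define y where "y = (\<chi> j. Im (z $ j))"
  have z: "z = cvec x + \<i> *s cvec y" by (simp add: vec_eq_iff x_def y_def complex_eq_iff)
  let ?u = "\<lambda>\<tau>. F (cvec x + \<tau> *s cvec y) - E (cvec x + \<tau> *s cvec y)"
  have lim: "(0::complex) islimpt \<real>"
    unfolding islimpt_approachable
  proof (intro allI impI)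
    fix e :: real assume "e > 0"
    then have "complex_of_real (e / 2) \<noteq> 0 \<and> dist (complex_of_real (e / 2)) 0 < e" by simp
    then show "\<exists>x'\<in>\<real>. x' \<noteq> (0::complex) \<and> dist x' 0 < e" using Reals_of_real by blast
  qed
  have hol: "?u holomorphic_on UNIV"
    by (intro holomorphic_on_diff entire_holomorphic_line F E)
  have "?u \<i> = 0"
  proof (rule analytic_continuation[OF hol open_UNIV connected_UNIV subset_UNIV UNIV_I lim _ UNIV_I])
    fix t :: complex assume "t \<in> \<real>"
    then obtain a where t: "t = of_real a" by (auto elim: Reals_cases)
    show "?u t = 0" unfolding t cvec_add eq by simp
  qed
  then show "F z = E z" by (simp add: z)
qed

text \<open>The translation invariance makes the integral constant along real directions of \<open>\<tau>\<close>; being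
  holomorphic in \<open>\<tau>\<close>, it is constant.\<close>

lemma integral_contour_shift:
  fixes u :: "complex \<Rightarrow> real^'n::finite \<Rightarrow> complex"
  assumes hol: "\<And>x. (\<lambda>\<tau>. u \<tau> x) holomorphic_on UNIV"
    and meas [measurable]: "\<And>\<tau>. u \<tau> \<in> borel_measurable borel"
    and bound: "\<And>R. \<exists>C. \<forall>x \<tau>. norm \<tau> \<le> R \<longrightarrow> norm (u \<tau> x) \<le> C * cweight x"
    and trans: "\<And>\<tau> a x. u (\<tau> + of_real a) x = u \<tau> (a *\<^sub>R \<eta> + x)"
  shows "(LINT x|lborel. u \<tau> x) = (LINT x|lborel. u 0 x)"
proof -
  define K where "K \<tau> = (LINT x|lborel. u \<tau> x)" for \<tau>
  have transK: "K (\<tau> + of_real a) = K \<tau>" for \<tau> a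
    unfolding K_def trans by (rule lborel_integral_translate) measurable
  have int: "integrable lborel (u \<tau>)" for \<tau>
  proof -
    obtain C where C: "\<And>x. norm (u \<tau> x) \<le> C * cweight x" using bound[of "norm \<tau>"] by blast
    show ?thesis
    proof (rule Bochner_Integration.integrable_bound[OF integrable_mult_right[OF integrable_cweight, of C]])
      have "norm (u \<tau> x) \<le> norm (C * cweight x)" for x
        using order_trans[OF C[of x] abs_ge_self] by simp
      then show "AE x in lborel. norm (u \<tau> x) \<le> norm (C * cweight x)" by simp
    qed measurable
  qed
  define \<delta> where "\<delta> i = 1 / real (Suc i)" for i :: nat
  have \<delta>0: "\<delta> i \<noteq> 0" for i by (simp add: \<delta>_def)
  have \<delta>lim: "filterlim (\<lambda>i. complex_of_real (\<delta> i)) (at 0) sequentially"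
  proof -
    have "\<delta> \<longlonglongrightarrow> 0" unfolding \<delta>_def by (rule lim_1_over_n[THEN LIMSEQ_Suc])
    then have "(\<lambda>i. complex_of_real (\<delta> i)) \<longlonglongrightarrow> of_real 0" by (rule tendsto_of_real)
    then show ?thesis using \<delta>0 by (simp add: filterlim_at)
  qed
  \<comment> \<open>The complex derivative exists by dominated convergence; along real increments
    the quotients vanish by \<open>transK\<close>, so its value is 0.\<close>
  have "(K has_field_derivative 0) (at \<tau>0)" for \<tau>0
  proof -
    \<comment> \<open>The margin 2 leaves room for increments of size below 1 and for Cauchy's
      estimate on circles of radius 1 around the moved points.\<close>
    obtain C where C: "\<And>x \<tau>. norm \<tau> \<le> norm \<tau>0 + 2 \<Longrightarrow> norm (u \<tau> x) \<le> C * cweight x"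
      using bound[of "norm \<tau>0 + 2"] by blast
    define u' where "u' x = deriv (\<lambda>\<tau>. u \<tau> x) \<tau>0" for x
    have der: "((\<lambda>\<tau>. u \<tau> x) has_field_derivative deriv (\<lambda>\<tau>. u \<tau> x) \<tau>) (at \<tau>)" for x \<tau>
      using hol by (rule holomorphic_derivI) auto
    have lim: "((\<lambda>\<epsilon>. (u (\<tau>0 + \<epsilon>) x - u \<tau>0 x) / \<epsilon>) \<longlongrightarrow> u' x) (at 0)" for x
      using der[of x \<tau>0] unfolding u'_def DERIV_def .
    have cauchy: "norm (deriv (\<lambda>\<tau>. u \<tau> x) \<tau>) \<le> C * cweight x" if "\<tau> \<in> ball \<tau>0 1" for x \<tau>
    proof -
      have "norm ((deriv ^^ 1) (\<lambda>\<tau>. u \<tau> x) \<tau>) \<le> fact 1 * (C * cweight x) / 1 ^ 1"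
      proof (rule Cauchy_inequality)
        show "(\<lambda>\<tau>. u \<tau> x) holomorphic_on ball \<tau> 1"
          using hol by (rule holomorphic_on_subset) simp
        show "continuous_on (cball \<tau> 1) (\<lambda>\<tau>. u \<tau> x)"
          using holomorphic_on_imp_continuous_on[OF hol] by (rule continuous_on_subset) simp
        fix w assume "norm (\<tau> - w) = 1"
        then have "norm w \<le> norm \<tau> + 1"
          using norm_triangle_sub[of w \<tau>] by (simp add: norm_minus_commute)
        moreover have "norm \<tau> \<le> norm \<tau>0 + 1"
          using that norm_triangle_sub[of \<tau> \<tau>0] by (simp add: dist_norm norm_minus_commute)
        ultimately show "norm (u w x) \<le> C * cweight x" by (intro C) simp
      qed simp
      then show ?thesis by simp
    qed
    \<comment> \<open>Measurability in \<open>x\<close> of the derivative in \<tau> comes from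
      writing it as a limit of difference quotients.\<close>
    have [measurable]: "u' \<in> borel_measurable borel"
    proof (rule borel_measurable_LIMSEQ_metric)
      show "(\<lambda>x. (u (\<tau>0 + of_real (\<delta> i)) x - u \<tau>0 x) / of_real (\<delta> i)) \<in> borel_measurable borel" for i
        by measurable
      show "(\<lambda>i. (u (\<tau>0 + of_real (\<delta> i)) x - u \<tau>0 x) / of_real (\<delta> i)) \<longlonglongrightarrow> u' x" for x
        by (rule filterlim_compose[OF lim \<delta>lim])
    qed
    have "((\<lambda>\<epsilon>. LINT x|lborel. (u (\<tau>0 + \<epsilon>) x - u \<tau>0 x) / \<epsilon>) \<longlongrightarrow> (LINT x|lborel. u' x)) (at 0)"
    proof (rule integral_dominated_tendsto_at[OF _ _ integrable_mult_right[OF integrable_cweight, of C] lim zero_less_one])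
      fix \<epsilon> :: complex and x assume \<epsilon>: "\<epsilon> \<noteq> 0" "dist \<epsilon> 0 < 1"
      have "norm (u (\<tau>0 + \<epsilon>) x - u \<tau>0 x) \<le> (C * cweight x) * norm (\<tau>0 + \<epsilon> - \<tau>0)"
      proof (rule field_differentiable_bound[OF convex_ball[of \<tau>0 1]])
        show "((\<lambda>\<tau>. u \<tau> x) has_field_derivative deriv (\<lambda>\<tau>. u \<tau> x) \<tau>) (at \<tau> within ball \<tau>0 1)" for \<tau>
          by (rule has_field_derivative_at_within[OF der])
      qed (use \<epsilon> cauchy in \<open>auto simp: dist_norm\<close>)
      then show "norm ((u (\<tau>0 + \<epsilon>) x - u \<tau>0 x) / \<epsilon>) \<le> C * cweight x"
        using \<epsilon> by (simp add: norm_divide divide_le_eq)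
    qed measurable
    also have "(\<lambda>\<epsilon>. LINT x|lborel. (u (\<tau>0 + \<epsilon>) x - u \<tau>0 x) / \<epsilon>) = (\<lambda>\<epsilon>. (K (\<tau>0 + \<epsilon>) - K \<tau>0) / \<epsilon>)"
      by (simp add: K_def Bochner_Integration.integral_diff[OF int int])
    finally have lim: "((\<lambda>\<epsilon>. (K (\<tau>0 + \<epsilon>) - K \<tau>0) / \<epsilon>) \<longlongrightarrow> (LINT x|lborel. u' x)) (at 0)" .
    have "(\<lambda>i. (K (\<tau>0 + of_real (\<delta> i)) - K \<tau>0) / of_real (\<delta> i)) \<longlonglongrightarrow> (LINT x|lborel. u' x)"
      by (rule filterlim_compose[OF lim \<delta>lim])
    then have "(\<lambda>i::nat. 0) \<longlonglongrightarrow> (LINT x|lborel. u' x)" unfolding transK by simp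
    then have "(LINT x|lborel. u' x) = 0" by (rule LIMSEQ_unique[OF _ tendsto_const])
    with lim show ?thesis unfolding DERIV_def by simp
  qed
  then obtain c where "\<And>\<tau>. K \<tau> = c"
    using has_field_derivative_zero_constant[of UNIV K] by auto
  then show ?thesis unfolding K_def by metis
qed

text \<open>Each factor \<open>1 + (Re (z $ j))\<^sup>2\<close> is at most
  \<open>(1 + norm z)\<^sup>2\<close>. An integrable factor thus costs \<open>2 * CARD('n)\<close>
  powers of the polynomial weight, the origin of the norm index \<open>m + 2 * CARD('n)\<close>
  below.\<close>

lemma cweight_le_power:
  fixes z :: "complex^'n::finite"
  shows "1 \<le> cweight (\<chi> j. Re (z $ j)) * (1 + norm z) ^ (2 * CARD('n))"
proof -
  have cw: "cweight (\<chi> j. Re (z $ j)) * (\<Prod>j\<in>UNIV. 1 + (Re (z $ j))\<^sup>2) = 1"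
    unfolding cweight_def prod.distrib[symmetric]
    by (rule prod.neutral) (auto simp: add_nonneg_eq_0_iff)
  have "(\<Prod>j\<in>UNIV. 1 + (Re (z $ j))\<^sup>2) \<le> (\<Prod>j\<in>(UNIV::'n set). (1 + norm z)\<^sup>2)"
  proof (intro prod_mono conjI)
    fix j
    have "\<bar>Re (z $ j)\<bar> \<le> norm z"
      using abs_Re_le_cmod Finite_Cartesian_Product.norm_nth_le by (rule order_trans)
    then have "(Re (z $ j))\<^sup>2 \<le> (norm z)\<^sup>2" by (simp add: abs_le_square_iff[symmetric])
    moreover have "(1 + norm z)\<^sup>2 = 1 + (norm z)\<^sup>2 + 2 * norm z" by (simp add: power2_sum)
    ultimately show "1 + (Re (z $ j))\<^sup>2 \<le> (1 + norm z)\<^sup>2" using norm_ge_zero[of z] by linarith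
  qed simp
  also have "\<dots> = (1 + norm z) ^ (2 * CARD('n))" by (simp add: power_mult)
  finally have "cweight (\<chi> j. Re (z $ j)) * (\<Prod>j\<in>UNIV. 1 + (Re (z $ j))\<^sup>2)
      \<le> cweight (\<chi> j. Re (z $ j)) * (1 + norm z) ^ (2 * CARD('n))"
    by (intro mult_left_mono) (simp_all add: less_imp_le[OF cweight_pos])
  then show ?thesis by (simp only: cw)
qed

section \<open>From entire functions back to the real space\<close>

context weight_pair
begin

definition W :: real where
  "W = fconst TYPE('n) * (LINT x|lborel. cweight (x::real^'n)) * exp \<gamma>"

lemma W_pos: "W \<ge> 0"
  unfolding W_def using fconst_pos[where 'n='n]
  by (intro mult_nonneg_nonneg Bochner_Integration.integral_nonneg) (auto simp: less_imp_le[OF cweight_pos])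

end

locale E_function = weight_pair h h' \<gamma>
  for h h' :: "real^'n::finite \<Rightarrow> real" and \<gamma> :: real +
  fixes F :: "complex^'n \<Rightarrow> complex"
  assumes F: "\<And>m. F \<in> E_m m (phi h)"
begin

definition P :: "nat \<Rightarrow> real" where "P m = enn2real (E_norm m (phi h) F)"

lemma F_entire: "entire F" and E_norm_finite: "E_norm m (phi h) F < \<infinity>"
  using F[of m] by (auto simp: E_m_def)

lemma P_nonneg: "P m \<ge> 0"
  by (simp add: P_def)

lemma F_bound:
  "norm (F z) * (1 + norm z) ^ m \<le> P (m + 2 * CARD('n)) * cweight (\<chi> j. Re (z $ j)) * exp (phi h (\<chi> j. Im (z $ j)))"
proof -
  let ?cw = "cweight (\<chi> j. Re (z $ j))"
  have "(norm (F z) * (1 + norm z) ^ m) * 1 \<le> (norm (F z) * (1 + norm z) ^ m) * (?cw * (1 + norm z) ^ (2 * CARD('n)))"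
    by (intro mult_left_mono cweight_le_power) simp
  also have "\<dots> = ?cw * (norm (F z) * (1 + norm z) ^ (m + 2 * CARD('n)))"
    by (simp add: power_add)
  also have "\<dots> \<le> ?cw * (P (m + 2 * CARD('n)) * exp (phi h (\<chi> j. Im (z $ j))))"
    unfolding P_def by (intro mult_left_mono E_norm_bound E_norm_finite less_imp_le[OF cweight_pos])
  finally show ?thesis by (simp add: mult_ac)
qed

text \<open>At \<open>z = cvec x\<close> this is, up to the constant, the integrand of
  \<open>mderiv \<alpha> (BT F) \<xi>\<close>; being entire in \<open>z\<close>, it allows the
  contour to be moved.\<close>

definition \<Phi> :: "('n \<Rightarrow> nat) \<Rightarrow> real^'n \<Rightarrow> complex^'n \<Rightarrow> complex" where
  "\<Phi> \<alpha> \<xi> z = (\<Prod>j\<in>UNIV. (- \<i> * z $ j) ^ \<alpha> j) * F z * exp (- \<i> * cdot z \<xi>)"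

lemma \<Phi>_continuous: "continuous_on UNIV (\<Phi> \<alpha> \<xi>)"
  unfolding \<Phi>_def cdot_def by (intro continuous_intros entire_continuous[OF F_entire])

lemma \<Phi>_bound:
  assumes "mi_abs \<alpha> \<le> m"
  shows "norm (\<Phi> \<alpha> \<xi> z) \<le> P (m + 2 * CARD('n)) * cweight (\<chi> j. Re (z $ j)) * exp (phi h (\<chi> j. Im (z $ j)))
      * exp (Im (cdot z \<xi>))"
proof -
  have "norm (\<Prod>j\<in>UNIV. (- \<i> * z $ j) ^ \<alpha> j) = (\<Prod>j\<in>UNIV. norm (z $ j) ^ \<alpha> j)"
    by (simp add: norm_mult norm_power flip: prod_norm)
  also have "\<dots> \<le> (\<Prod>j\<in>UNIV. (1 + norm z) ^ \<alpha> j)"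
  proof (intro prod_mono conjI power_mono)
    show "norm (z $ j) \<le> 1 + norm z" for j
      using Finite_Cartesian_Product.norm_nth_le[of z j] by linarith
  qed auto
  also have "\<dots> = (1 + norm z) ^ mi_abs \<alpha>" by (simp add: mi_abs_def power_sum)
  also have "\<dots> \<le> (1 + norm z) ^ m" using assms by (intro power_increasing) auto
  finally have 1: "norm (\<Prod>j\<in>UNIV. (- \<i> * z $ j) ^ \<alpha> j) \<le> (1 + norm z) ^ m" .
  have 2: "norm (exp (- \<i> * cdot z \<xi>)) = exp (Im (cdot z \<xi>))" by (simp add: norm_exp_eq_Re)
  have "norm (\<Phi> \<alpha> \<xi> z) = norm (\<Prod>j\<in>UNIV. (- \<i> * z $ j) ^ \<alpha> j) * norm (F z) * exp (Im (cdot z \<xi>))"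
    unfolding \<Phi>_def norm_mult 2 ..
  also have "\<dots> \<le> (1 + norm z) ^ m * norm (F z) * exp (Im (cdot z \<xi>))"
    by (intro mult_right_mono 1) auto
  also have "\<dots> = (norm (F z) * (1 + norm z) ^ m) * exp (Im (cdot z \<xi>))" by simp
  also have "\<dots> \<le> (P (m + 2 * CARD('n)) * cweight (\<chi> j. Re (z $ j)) * exp (phi h (\<chi> j. Im (z $ j)))) * exp (Im (cdot z \<xi>))"
    by (intro mult_right_mono F_bound) auto
  finally show ?thesis .
qed

lemma \<Phi>_bound_line:
  assumes "mi_abs \<alpha> \<le> m"
  shows "norm (\<Phi> \<alpha> \<xi> (cvec x + \<tau> *s cvec \<eta>)) \<le>
    P (m + 2 * CARD('n)) * cweight (x + Re \<tau> *\<^sub>R \<eta>) * exp (phi h (Im \<tau> *\<^sub>R \<eta>)) * exp (Im \<tau> * (\<eta> \<bullet> \<xi>))"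
proof -
  let ?z = "cvec x + \<tau> *s cvec \<eta>"
  have "(\<chi> j. Re (?z $ j)) = x + Re \<tau> *\<^sub>R \<eta>" "(\<chi> j. Im (?z $ j)) = Im \<tau> *\<^sub>R \<eta>"
    by (simp_all add: vec_eq_iff)
  moreover have "Im (cdot ?z \<xi>) = Im \<tau> * (\<eta> \<bullet> \<xi>)"
    by (simp add: Im_cdot inner_vec_def sum_distrib_left mult.assoc)
  ultimately show ?thesis using \<Phi>_bound[OF assms, of \<xi> ?z] by simp
qed

lemma \<Phi>_line_measurable [measurable]: "(\<lambda>x. \<Phi> \<alpha> \<xi> (cvec x + \<tau> *s cvec \<eta>)) \<in> borel_measurable borel"
proof (rule borel_measurable_continuous_onI)
  have "continuous_on UNIV (\<lambda>x::real^'n. cvec x + \<tau> *s cvec \<eta>)"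
    by (intro continuous_intros continuous_cvec)
  from continuous_on_compose2[OF \<Phi>_continuous this]
  show "continuous_on UNIV (\<lambda>x. \<Phi> \<alpha> \<xi> (cvec x + \<tau> *s cvec \<eta>))" by simp
qed

text \<open>The factor \<open>\<i>\<close> is replaced by a complex parameter \<tau>, whose real
  part merely translates \<open>x\<close>: the invariance that \<open>integral_contour_shift\<close>
  exploits. Its bound must be uniform for bounded \<tau>, hence \<open>cweight_shift\<close> and the
  monotonicity of \<open>phi h\<close>.\<close>

lemma \<Phi>_shift: "(LINT x|lborel. \<Phi> \<alpha> \<xi> (cvec x)) = (LINT x|lborel. \<Phi> \<alpha> \<xi> (cvec x + \<i> *s cvec \<eta>))"
proof -
  let ?u = "\<lambda>\<tau> x. \<Phi> \<alpha> \<xi> (cvec x + \<tau> *s cvec \<eta>)"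
  have "(LINT x|lborel. ?u \<i> x) = (LINT x|lborel. ?u 0 x)"
  proof (rule integral_contour_shift)
    show "(\<lambda>\<tau>. ?u \<tau> x) holomorphic_on UNIV" for x
    proof -
      have "(\<lambda>\<tau>. \<Prod>j\<in>UNIV. (- \<i> * (cvec x + \<tau> *s cvec \<eta>) $ j) ^ \<alpha> j) holomorphic_on UNIV"
        by (simp, intro holomorphic_intros)
      moreover have "(\<lambda>\<tau>. exp (- \<i> * cdot (cvec x + \<tau> *s cvec \<eta>) \<xi>)) holomorphic_on UNIV"
        unfolding cdot_add_left cdot_scale_left by (intro holomorphic_intros)
      ultimately show ?thesis
        unfolding \<Phi>_def by (intro holomorphic_on_mult entire_holomorphic_line[OF F_entire])
    qed
    show "\<exists>C. \<forall>x \<tau>. norm \<tau> \<le> R \<longrightarrow> norm (?u \<tau> x) \<le> C * cweight x" for R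
    proof -
      let ?C = "P (mi_abs \<alpha> + 2 * CARD('n)) * (\<Prod>j\<in>UNIV. 2 * (1 + (R * \<eta> $ j)\<^sup>2)) * exp (phi h (R *\<^sub>R \<eta>)) * exp (R * \<bar>\<eta> \<bullet> \<xi>\<bar>)"
      have "norm (?u \<tau> x) \<le> ?C * cweight x" if \<tau>: "norm \<tau> \<le> R" for x \<tau>
      proof -
        have R: "\<bar>Re \<tau>\<bar> \<le> R" "\<bar>Im \<tau>\<bar> \<le> R" "R \<ge> 0"
          using \<tau> abs_Re_le_cmod[of \<tau>] abs_Im_le_cmod[of \<tau>] norm_ge_zero[of \<tau>] by linarith+
        have "cweight (x + Re \<tau> *\<^sub>R \<eta>) \<le> (\<Prod>j\<in>UNIV. 2 * (1 + ((Re \<tau> *\<^sub>R \<eta>) $ j)\<^sup>2)) * cweight x"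
          by (rule cweight_shift)
        also have "\<dots> \<le> (\<Prod>j\<in>UNIV. 2 * (1 + (R * \<eta> $ j)\<^sup>2)) * cweight x"
        proof (intro mult_right_mono prod_mono conjI)
          fix j
          have "\<bar>Re \<tau> * \<eta> $ j\<bar> \<le> \<bar>R * \<eta> $ j\<bar>" using R by (simp add: abs_mult mult_right_mono)
          then have "(Re \<tau> * \<eta> $ j)\<^sup>2 \<le> (R * \<eta> $ j)\<^sup>2" by (simp only: abs_le_square_iff)
          then show "2 * (1 + ((Re \<tau> *\<^sub>R \<eta>) $ j)\<^sup>2) \<le> 2 * (1 + (R * \<eta> $ j)\<^sup>2)" by simp
        qed (auto simp: less_imp_le[OF cweight_pos] add_nonneg_nonneg)
        finally have 1: "cweight (x + Re \<tau> *\<^sub>R \<eta>) \<le> (\<Prod>j\<in>UNIV. 2 * (1 + (R * \<eta> $ j)\<^sup>2)) * cweight x" .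
        have 2: "exp (phi h (Im \<tau> *\<^sub>R \<eta>)) \<le> exp (phi h (R *\<^sub>R \<eta>))"
          using R by (simp, intro A.phi_mono) (simp add: abs_mult mult_right_mono)
        have "Im \<tau> * (\<eta> \<bullet> \<xi>) \<le> \<bar>Im \<tau>\<bar> * \<bar>\<eta> \<bullet> \<xi>\<bar>" by (metis abs_ge_self abs_mult)
        also have "\<dots> \<le> R * \<bar>\<eta> \<bullet> \<xi>\<bar>" using R by (intro mult_right_mono) auto
        finally have 3: "exp (Im \<tau> * (\<eta> \<bullet> \<xi>)) \<le> exp (R * \<bar>\<eta> \<bullet> \<xi>\<bar>)" by simp
        have "norm (?u \<tau> x) \<le> P (mi_abs \<alpha> + 2 * CARD('n)) * cweight (x + Re \<tau> *\<^sub>R \<eta>) * exp (phi h (Im \<tau> *\<^sub>R \<eta>)) * exp (Im \<tau> * (\<eta> \<bullet> \<xi>))"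
          by (rule \<Phi>_bound_line[OF order_refl])
        also have "\<dots> \<le> P (mi_abs \<alpha> + 2 * CARD('n)) * ((\<Prod>j\<in>UNIV. 2 * (1 + (R * \<eta> $ j)\<^sup>2)) * cweight x) * exp (phi h (R *\<^sub>R \<eta>)) * exp (R * \<bar>\<eta> \<bullet> \<xi>\<bar>)"
          using 1 2 3 P_nonneg
          by (intro mult_mono mult_left_mono mult_nonneg_nonneg prod_nonneg) (auto simp: less_imp_le[OF cweight_pos])
        finally show ?thesis by (simp add: mult_ac)
      qed
      then show ?thesis by blast
    qed
    show "?u (\<tau> + of_real a) x = ?u \<tau> (a *\<^sub>R \<eta> + x)" for \<tau> a x
    proof -
      have "cvec x + (\<tau> + of_real a) *s cvec \<eta> = cvec (a *\<^sub>R \<eta> + x) + \<tau> *s cvec \<eta>"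
        by (simp add: vec_eq_iff algebra_simps)
      then show ?thesis by (rule arg_cong)
    qed
  qed measurable
  then show ?thesis by simp
qed

lemma F_cvec_measurable [measurable]: "(\<lambda>x. F (cvec x)) \<in> borel_measurable borel"
  using continuous_on_compose2[OF entire_continuous[OF F_entire] continuous_cvec]
  by (intro borel_measurable_continuous_onI) simp

lemma F_cvec_bound: "norm (F (cvec x)) * (1 + norm (cvec x)) ^ m \<le> P (m + 2 * CARD('n)) * cweight x * exp (phi h 0)"
proof -
  have "(\<chi> j. Re (cvec x $ j)) = x" "(\<chi> j. Im (cvec x $ j)) = 0" by (simp_all add: vec_eq_iff)
  then show ?thesis using F_bound[of "cvec x" m] by simp
qed

lemma F_cvec_rapid: "rapid (\<lambda>x. F (cvec x))"
  unfolding rapid_def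
proof
  fix \<beta> :: "'n \<Rightarrow> nat"
  let ?m = "mi_abs \<beta>"
  show "integrable lborel (\<lambda>x. of_real (mi_power x \<beta>) * F (cvec x))"
  proof (rule Bochner_Integration.integrable_bound[OF integrable_mult_right[OF integrable_cweight, of "P (?m + 2 * CARD('n)) * exp (phi h 0)"]])
    have "norm (of_real (mi_power x \<beta>) * F (cvec x)) \<le> norm (P (?m + 2 * CARD('n)) * exp (phi h 0) * cweight x)" for x
    proof -
      have "\<bar>mi_power x \<beta>\<bar> \<le> (\<Prod>j\<in>UNIV. (1 + norm (cvec x)) ^ \<beta> j)"
        unfolding abs_mi_power
      proof (intro prod_mono conjI power_mono)
        show "\<bar>x $ j\<bar> \<le> 1 + norm (cvec x)" for j
          using Finite_Cartesian_Product.norm_nth_le[of "cvec x" j] by simp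
      qed auto
      also have "\<dots> = (1 + norm (cvec x)) ^ ?m" by (simp add: mi_abs_def power_sum)
      finally have "\<bar>mi_power x \<beta>\<bar> * norm (F (cvec x)) \<le> (1 + norm (cvec x)) ^ ?m * norm (F (cvec x))"
        by (rule mult_right_mono) simp
      also have "\<dots> \<le> P (?m + 2 * CARD('n)) * cweight x * exp (phi h 0)"
        using F_cvec_bound[of x ?m] by (simp add: mult.commute)
      finally show ?thesis
        using P_nonneg by (simp add: norm_mult abs_mult abs_of_pos[OF cweight_pos] mult_ac)
    qed
    then show "AE x in lborel. norm (of_real (mi_power x \<beta>) * F (cvec x)) \<le> norm (P (?m + 2 * CARD('n)) * exp (phi h 0) * cweight x)"
      by simp
  qed measurable
qed

lemma BT_smooth: "C_diff m (BT F)"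
  unfolding BT_def by (intro C_diff_FT rapid_scale F_cvec_rapid)

lemma mderiv_BT: "mderiv \<alpha> (BT F) \<xi> = of_real (fconst TYPE('n)) * (LINT x|lborel. \<Phi> \<alpha> \<xi> (cvec x))"
proof -
  have "mderiv \<alpha> (BT F) \<xi> = FT (-1) (\<lambda>x. of_real (fconst TYPE('n)) * ((\<Prod>j\<in>UNIV. (- \<i> * of_real (x $ j)) ^ \<alpha> j) * F (cvec x))) \<xi>"
    unfolding BT_def mderiv_FT[OF rapid_scale[OF F_cvec_rapid]]
    by (intro arg_cong[where f="\<lambda>g. FT (-1) g \<xi>"] ext) (simp add: mult_ac)
  also have "\<dots> = of_real (fconst TYPE('n)) * (LINT x|lborel. \<Phi> \<alpha> \<xi> (cvec x))"
    unfolding FT_scale unfolding FT_def \<Phi>_def cdot_cvec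
    by (intro arg_cong2[where f="(*)"] Bochner_Integration.integral_cong refl)
      (simp_all add: inner_commute)
  finally show ?thesis .
qed

text \<open>After the shift the kernel contributes a decaying exponential of the sum of
  \<open>r $ j * \<bar>\<xi> $ j\<bar>\<close>, while the power of \<xi> is bounded by the growing
  one, as a single term of its series; the two cancel. What remains depends on \<open>r\<close>
  alone, and \<open>optimal_radii\<close> chooses \<open>r\<close> from \<beta>, not from
  \<xi>.\<close>

lemma BT_seq_decay:
  assumes \<alpha>: "mi_abs \<alpha> \<le> m"
  shows "seq_decay h' (W * P (m + 2 * CARD('n))) (mderiv \<alpha> (BT F))"
  unfolding seq_decay_def
proof (intro allI)
  fix \<xi> :: "real^'n" and \<beta> :: "'n \<Rightarrow> nat"
  let ?c = "fconst TYPE('n)" and ?P = "P (m + 2 * CARD('n))" and ?I = "LINT x|lborel. cweight (x::real^'n)"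
  have I0: "?I \<ge> 0" by (intro Bochner_Integration.integral_nonneg) (simp add: less_imp_le[OF cweight_pos])
  obtain r where r: "\<And>j. r $ j \<ge> 1"
      "exp (phi h r) / (\<Prod>j\<in>UNIV. (r $ j) ^ \<beta> j) \<le> exp \<gamma> * exp (- h' (mi_vec \<beta>))"
    using optimal_radii[of \<beta>] by blast
  have r0: "r $ j > 0" for j using r(1)[of j] by linarith
  \<comment> \<open>Where \<open>\<xi> $ j = 0\<close> the sign is 0 and that coordinate is not
    shifted; since \<open>phi h\<close> is monotone, \<open>r\<close> still controls the
    growth.\<close>
  define \<eta> where "\<eta> = (\<chi> j. - sgn (\<xi> $ j) * r $ j)"
  have \<eta>\<xi>: "\<eta> \<bullet> \<xi> = - (\<Sum>j\<in>UNIV. r $ j * \<bar>\<xi> $ j\<bar>)"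
    by (simp add: \<eta>_def inner_vec_def sum_negf abs_sgn mult_ac)
  have phi: "phi h \<eta> \<le> phi h r"
    by (rule A.phi_mono) (use r0 in \<open>auto simp: \<eta>_def abs_mult abs_sgn_eq abs_of_pos less_imp_le\<close>)
  let ?B = "?P * exp (phi h r) * exp (- (\<Sum>j\<in>UNIV. r $ j * \<bar>\<xi> $ j\<bar>))"
  have b: "norm (\<Phi> \<alpha> \<xi> (cvec x + \<i> *s cvec \<eta>)) \<le> ?B * cweight x" for x
  proof -
    have "norm (\<Phi> \<alpha> \<xi> (cvec x + \<i> *s cvec \<eta>)) \<le> ?P * cweight x * exp (phi h \<eta>) * exp (\<eta> \<bullet> \<xi>)"
      using \<Phi>_bound_line[OF \<alpha>, of \<xi> x \<i> \<eta>] by simp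
    also have "\<dots> \<le> ?P * cweight x * exp (phi h r) * exp (\<eta> \<bullet> \<xi>)"
      using phi P_nonneg by (intro mult_right_mono mult_left_mono) (auto simp: less_imp_le[OF cweight_pos])
    finally show ?thesis unfolding \<eta>\<xi> by (simp add: mult_ac)
  qed
  have "norm (LINT x|lborel. \<Phi> \<alpha> \<xi> (cvec x + \<i> *s cvec \<eta>)) \<le> (LINT x|lborel. ?B * cweight (x::real^'n))"
  proof (rule Bochner_Integration.integral_norm_bound_integral)
    show int: "integrable lborel (\<lambda>x::real^'n. ?B * cweight x)"
      by (intro integrable_mult_right integrable_cweight)
    show "integrable lborel (\<lambda>x. \<Phi> \<alpha> \<xi> (cvec x + \<i> *s cvec \<eta>))"
    proof (rule Bochner_Integration.integrable_bound[OF int])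
      show "AE x in lborel. norm (\<Phi> \<alpha> \<xi> (cvec x + \<i> *s cvec \<eta>)) \<le> norm (?B * cweight x)"
        by (intro AE_I2 order_trans[OF b]) simp
    qed measurable
  qed (rule b)
  then have n: "norm (mderiv \<alpha> (BT F) \<xi>) \<le> ?c * (?B * ?I)"
    unfolding mderiv_BT \<Phi>_shift[of \<alpha> \<xi> \<eta>] using fconst_pos[where 'n='n] by (simp add: norm_mult)
  have "(\<Prod>j\<in>UNIV. \<bar>\<xi> $ j\<bar> ^ \<beta> j) \<le> (\<Prod>j\<in>UNIV. fact (\<beta> j) * exp (r $ j * \<bar>\<xi> $ j\<bar>) / r $ j ^ \<beta> j)"
  proof (intro prod_mono conjI)
    fix j
    have "(r $ j * \<bar>\<xi> $ j\<bar>) ^ \<beta> j \<le> fact (\<beta> j) * exp (r $ j * \<bar>\<xi> $ j\<bar>)"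
      using r0[of j] by (intro power_le_fact_exp) simp
    then show "\<bar>\<xi> $ j\<bar> ^ \<beta> j \<le> fact (\<beta> j) * exp (r $ j * \<bar>\<xi> $ j\<bar>) / r $ j ^ \<beta> j"
      using r0[of j] by (simp add: le_divide_eq power_mult_distrib mult.commute)
  qed simp
  also have "\<dots> = mi_fact \<beta> * exp (\<Sum>j\<in>UNIV. r $ j * \<bar>\<xi> $ j\<bar>) / (\<Prod>j\<in>UNIV. r $ j ^ \<beta> j)"
    by (simp add: prod.distrib prod_dividef mi_fact_def exp_sum)
  finally have p: "(\<Prod>j\<in>UNIV. \<bar>\<xi> $ j\<bar> ^ \<beta> j) \<le> \<dots>" .
  have "(\<Prod>j\<in>UNIV. \<bar>\<xi> $ j\<bar> ^ \<beta> j) * norm (mderiv \<alpha> (BT F) \<xi>) \<le>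
      (mi_fact \<beta> * exp (\<Sum>j\<in>UNIV. r $ j * \<bar>\<xi> $ j\<bar>) / (\<Prod>j\<in>UNIV. r $ j ^ \<beta> j)) * (?c * (?B * ?I))"
    using n p r0 mi_fact_pos[of \<beta>]
    by (intro mult_mono divide_nonneg_nonneg prod_nonneg) (auto simp: less_imp_le)
  also have "\<dots> = (?c * ?I * ?P) * mi_fact \<beta> * (exp (phi h r) / (\<Prod>j\<in>UNIV. r $ j ^ \<beta> j))"
    by (simp add: exp_minus)
  also have "\<dots> \<le> (?c * ?I * ?P) * mi_fact \<beta> * (exp \<gamma> * exp (- h' (mi_vec \<beta>)))"
    using P_nonneg[of "m + 2 * CARD('n)"] I0 mi_fact_pos[of \<beta>] fconst_pos[where 'n='n] by (intro mult_left_mono r) auto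
  finally show "(\<Prod>j\<in>UNIV. \<bar>\<xi> $ j\<bar> ^ \<beta> j) * norm (mderiv \<alpha> (BT F) \<xi>) \<le> W * ?P * (mi_fact \<beta> * exp (- h' (mi_vec \<beta>)))"
    by (simp add: W_def mult_ac)
qed

lemma BT_G_norm: "G_norm m h' (BT F) \<le> ennreal W * E_norm (m + 2 * CARD('n)) (phi h) F"
proof -
  have "G_norm m h' (BT F) \<le> ennreal (W * P (m + 2 * CARD('n)))"
    by (intro G_norm_le BT_seq_decay)
  also have "\<dots> = ennreal W * ennreal (P (m + 2 * CARD('n)))"
    using W_pos P_nonneg by (intro ennreal_mult)
  also have "ennreal (P (m + 2 * CARD('n))) = E_norm (m + 2 * CARD('n)) (phi h) F"
    using E_norm_finite by (simp add: P_def)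
  finally show ?thesis .
qed

lemma BT_mem: "BT F \<in> G_m m h'"
proof -
  have "G_norm m h' (BT F) < \<infinity>"
    using order_le_less_trans[OF BT_G_norm] E_norm_finite by (auto simp: ennreal_mult_less_top)
  then show ?thesis using BT_smooth by (simp add: G_m_def)
qed

end

section \<open>Assembling the isomorphism\<close>

lemma C_diff_zero: "C_diff m (\<lambda>_. 0)"
proof (induction m)
  case (Suc m)
  have "partial_deriv j (\<lambda>_. 0) = (\<lambda>_. 0)" for j :: 'a
    by (intro ext partial_deriv_eqI) simp
  then show ?case using Suc by simp
qed simp

lemma mderiv_zero: "mderiv \<alpha> (\<lambda>_. 0) = (\<lambda>_. 0)"
  using mderiv_scale[OF C_diff_zero order_refl, of \<alpha> 0] by simp

lemma seq_decay_add:
  fixes u v :: "real^'n::finite \<Rightarrow> complex"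
  assumes "seq_decay h K u" "seq_decay h L v"
  shows "seq_decay h (K + L) (\<lambda>x. u x + v x)"
  unfolding seq_decay_def
proof (intro allI)
  fix x :: "real^'n" and \<beta> :: "'n \<Rightarrow> nat"
  let ?p = "\<Prod>j\<in>UNIV. \<bar>x $ j\<bar> ^ \<beta> j"
  have "?p * norm (u x + v x) \<le> ?p * norm (u x) + ?p * norm (v x)"
    unfolding distrib_left[symmetric] by (intro mult_left_mono norm_triangle_ineq prod_nonneg) auto
  then show "?p * norm (u x + v x) \<le> (K + L) * (mi_fact \<beta> * exp (- h (mi_vec \<beta>)))"
    using assms[unfolded seq_decay_def, rule_format, of x \<beta>] by (simp add: distrib_right)
qed

lemma seq_decay_scale:
  fixes u :: "real^'n::finite \<Rightarrow> complex"
  assumes "seq_decay h K u"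
  shows "seq_decay h (norm c * K) (\<lambda>x. c * u x)"
  unfolding seq_decay_def
proof (intro allI)
  fix x :: "real^'n" and \<beta> :: "'n \<Rightarrow> nat"
  have "norm c * ((\<Prod>j\<in>UNIV. \<bar>x $ j\<bar> ^ \<beta> j) * norm (u x)) \<le> norm c * (K * (mi_fact \<beta> * exp (- h (mi_vec \<beta>))))"
    using assms unfolding seq_decay_def by (intro mult_left_mono) auto
  then show "(\<Prod>j\<in>UNIV. \<bar>x $ j\<bar> ^ \<beta> j) * norm (c * u x) \<le> norm c * K * (mi_fact \<beta> * exp (- h (mi_vec \<beta>)))"
    by (simp add: norm_mult mult_ac)
qed

lemma G_norm_zero: "G_norm m h (\<lambda>_. 0) = 0"
proof -
  have "G_norm m h (\<lambda>_. 0) \<le> ennreal 0"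
    by (rule G_norm_le) (simp add: mderiv_zero seq_decay_def)
  then show ?thesis by simp
qed

lemma G_norm_triangle:
  assumes "C_diff m f" "C_diff m g"
  shows "G_norm m h (\<lambda>x. f x + g x) \<le> G_norm m h f + G_norm m h g"
proof (cases "G_norm m h f < \<infinity> \<and> G_norm m h g < \<infinity>")
  case True
  let ?a = "enn2real (G_norm m h f)" and ?b = "enn2real (G_norm m h g)"
  have "G_norm m h (\<lambda>x. f x + g x) \<le> ennreal (?a + ?b)"
  proof (rule G_norm_le)
    fix \<alpha> :: "'a \<Rightarrow> nat" assume \<alpha>: "mi_abs \<alpha> \<le> m"
    show "seq_decay h (?a + ?b) (mderiv \<alpha> (\<lambda>x. f x + g x))"
      unfolding mderiv_add[OF assms \<alpha>] using True \<alpha> by (intro seq_decay_add G_norm_seq_decay) auto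
  qed
  also have "\<dots> = ennreal ?a + ennreal ?b" by (simp add: ennreal_plus)
  also have "\<dots> = G_norm m h f + G_norm m h g" using True by simp
  finally show ?thesis .
qed (auto simp: not_less top_unique)

lemma G_norm_scale_finite:
  assumes "C_diff m f" "G_norm m h f < \<infinity>"
  shows "G_norm m h (\<lambda>x. c * f x) < \<infinity>"
proof -
  have "G_norm m h (\<lambda>x. c * f x) \<le> ennreal (norm c * enn2real (G_norm m h f))"
    by (rule G_norm_le) (use assms in \<open>auto simp: mderiv_scale intro!: seq_decay_scale G_norm_seq_decay\<close>)
  then show ?thesis by (rule order_le_less_trans) simp
qed

lemma E_norm_zero: "E_norm m \<phi> (\<lambda>_. 0) = 0"
proof -
  have "E_norm m \<phi> (\<lambda>_. 0) \<le> ennreal 0" by (rule E_norm_le) simp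
  then show ?thesis by simp
qed

lemma E_norm_triangle: "E_norm m \<phi> (\<lambda>z. f z + g z) \<le> E_norm m \<phi> f + E_norm m \<phi> g"
proof (cases "E_norm m \<phi> f < \<infinity> \<and> E_norm m \<phi> g < \<infinity>")
  case True
  let ?a = "enn2real (E_norm m \<phi> f)" and ?b = "enn2real (E_norm m \<phi> g)"
  have "E_norm m \<phi> (\<lambda>z. f z + g z) \<le> ennreal (?a + ?b)"
  proof (rule E_norm_le)
    fix z
    have "norm (f z + g z) * (1 + norm z) ^ m \<le> norm (f z) * (1 + norm z) ^ m + norm (g z) * (1 + norm z) ^ m"
      unfolding distrib_right[symmetric] by (intro mult_right_mono norm_triangle_ineq) auto
    then show "norm (f z + g z) * (1 + norm z) ^ m \<le> (?a + ?b) * exp (\<phi> (\<chi> j. Im (z $ j)))"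
      using E_norm_bound[of m \<phi> f z] E_norm_bound[of m \<phi> g z] True by (simp add: distrib_right)
  qed
  also have "\<dots> = ennreal ?a + ennreal ?b" by (simp add: ennreal_plus)
  also have "\<dots> = E_norm m \<phi> f + E_norm m \<phi> g" using True by simp
  finally show ?thesis .
qed (auto simp: not_less top_unique)

lemma E_norm_scale_finite:
  assumes "E_norm m \<phi> f < \<infinity>"
  shows "E_norm m \<phi> (\<lambda>z. c * f z) < \<infinity>"
proof -
  have "E_norm m \<phi> (\<lambda>z. c * f z) \<le> ennreal (norm c * enn2real (E_norm m \<phi> f))"
  proof (rule E_norm_le)
    fix z
    show "norm (c * f z) * (1 + norm z) ^ m \<le> norm c * enn2real (E_norm m \<phi> f) * exp (\<phi> (\<chi> j. Im (z $ j)))"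
      using mult_left_mono[OF E_norm_bound[OF assms, of z] norm_ge_zero[of c]] by (simp add: norm_mult mult_ac)
  qed
  then show ?thesis by (rule order_le_less_trans) simp
qed

lemma entire_zero: "entire (\<lambda>_. 0)"
  unfolding entire_def by (intro allI exI[of _ "\<lambda>_. 0"]) auto

lemma entire_add:
  assumes "entire f" "entire g"
  shows "entire (\<lambda>z. f z + g z)"
  unfolding entire_def
proof
  fix z
  obtain f' g' where "(f has_derivative f') (at z)" "\<And>c v. f' (c *s v) = c * f' v"
    "(g has_derivative g') (at z)" "\<And>c v. g' (c *s v) = c * g' v"
    using assms unfolding entire_def by meson
  then show "\<exists>d. ((\<lambda>z. f z + g z) has_derivative d) (at z) \<and> (\<forall>c v. d (c *s v) = c * d v)"
    by (intro exI[of _ "\<lambda>v. f' v + g' v"]) (auto intro: has_derivative_add simp: distrib_left)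
qed

lemma entire_scale:
  assumes "entire f"
  shows "entire (\<lambda>z. c * f z)"
  unfolding entire_def
proof
  fix z
  obtain f' where "(f has_derivative f') (at z)" "\<And>c v. f' (c *s v) = c * f' v"
    using assms unfolding entire_def by meson
  then show "\<exists>d. ((\<lambda>z. c * f z) has_derivative d) (at z) \<and> (\<forall>c v. d (c *s v) = c * d v)"
    by (intro exI[of _ "\<lambda>v. c * f' v"]) (auto intro: has_derivative_mult_right)
qed

lemma G_m_add: "f \<in> G_m m h \<Longrightarrow> g \<in> G_m m h \<Longrightarrow> (\<lambda>x. f x + g x) \<in> G_m m h"
  using order_le_less_trans[OF G_norm_triangle[of m f g h], of top] by (simp add: G_m_def C_diff_add)

lemma E_m_add: "f \<in> E_m m \<phi> \<Longrightarrow> g \<in> E_m m \<phi> \<Longrightarrow> (\<lambda>z. f z + g z) \<in> E_m m \<phi>"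
  using order_le_less_trans[OF E_norm_triangle[of m \<phi> f g], of top] by (simp add: E_m_def entire_add)

lemma G_m_scale: "f \<in> G_m m h \<Longrightarrow> (\<lambda>x. c * f x) \<in> G_m m h"
  using G_norm_scale_finite[of m f h c] by (simp add: G_m_def C_diff_scale)

lemma E_m_scale: "f \<in> E_m m \<phi> \<Longrightarrow> (\<lambda>z. c * f z) \<in> E_m m \<phi>"
  using E_norm_scale_finite[of m \<phi> f c] by (simp add: E_m_def entire_scale)

lemma fun_subspace_G: "fun_subspace (\<Inter>m. G_m m h)"
  unfolding fun_subspace_def
proof (intro conjI ballI allI INT_I)
  show "(\<lambda>_. 0) \<in> G_m m h" for m by (simp add: G_m_def C_diff_zero G_norm_zero)
qed (auto intro: G_m_add G_m_scale)

lemma fun_subspace_E: "fun_subspace (\<Inter>m. E_m m \<phi>)"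
  unfolding fun_subspace_def
proof (intro conjI ballI allI INT_I)
  show "(\<lambda>_. 0) \<in> E_m m \<phi>" for m by (simp add: E_m_def entire_zero E_norm_zero)
qed (auto intro: E_m_add E_m_scale)

lemma topspace_G_top: "topspace (G_top h) = (\<Inter>m. G_m m h)"
  unfolding G_top_def by (rule topspace_seminorm_topology) (rule G_norm_zero)

lemma topspace_E_top: "topspace (E_top \<phi>) = (\<Inter>m. E_m m \<phi>)"
  unfolding E_top_def by (rule topspace_seminorm_topology) (rule E_norm_zero)

text \<open>Two members lie in a common step, the one with the larger index, and are added
  there.\<close>

lemma fun_subspace_UN_chain:
  fixes V :: "nat \<Rightarrow> ('a \<Rightarrow> complex) set"
  assumes sub: "\<And>\<nu>. \<nu> \<ge> 1 \<Longrightarrow> fun_subspace (V \<nu>)"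
    and chain: "\<And>\<nu>. \<nu> \<ge> 1 \<Longrightarrow> V \<nu> \<subseteq> V (Suc \<nu>)"
  shows "fun_subspace (\<Union>\<nu>\<in>{1..}. V \<nu>)"
proof -
  have le: "V \<mu> \<subseteq> V \<nu>" if "1 \<le> \<mu>" "\<mu> \<le> \<nu>" for \<mu> \<nu>
    using that(2)
  proof (induction \<nu> rule: dec_induct)
    case (step \<nu>)
    with that(1) chain[of \<nu>] show ?case by auto
  qed simp
  show ?thesis
    unfolding fun_subspace_def
  proof (intro conjI ballI allI)
    show "(\<lambda>_. 0) \<in> (\<Union>\<nu>\<in>{1..}. V \<nu>)" using fun_subspace_zero[OF sub[of 1]] by auto
    fix f assume "f \<in> (\<Union>\<nu>\<in>{1..}. V \<nu>)"
    then obtain \<mu> where \<mu>: "\<mu> \<ge> 1" "f \<in> V \<mu>" by auto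
    show "(\<lambda>x. c * f x) \<in> (\<Union>\<nu>\<in>{1..}. V \<nu>)" for c
      using fun_subspace_scale[OF sub[OF \<mu>(1)] \<mu>(2)] \<mu>(1) by auto
    fix g assume "g \<in> (\<Union>\<nu>\<in>{1..}. V \<nu>)"
    then obtain \<nu> where \<nu>: "\<nu> \<ge> 1" "g \<in> V \<nu>" by auto
    have m: "max \<mu> \<nu> \<ge> 1" using \<mu> by simp
    have "f \<in> V (max \<mu> \<nu>)" "g \<in> V (max \<mu> \<nu>)" using le[of \<mu> "max \<mu> \<nu>"] le[of \<nu> "max \<mu> \<nu>"] \<mu> \<nu> by auto
    from fun_subspace_add[OF sub[OF m] this] m
    show "(\<lambda>x. f x + g x) \<in> (\<Union>\<nu>\<in>{1..}. V \<nu>)" by auto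
  qed
qed

context weight_pair
begin

lemma G_m_subset: "G_m m h \<subseteq> G_m m h'"
proof
  fix f assume f: "f \<in> G_m m h"
  let ?K = "enn2real (G_norm m h f)"
  have "G_norm m h' f \<le> ennreal (?K * exp \<gamma>)"
  proof (rule G_norm_le)
    fix \<alpha> :: "'n \<Rightarrow> nat" assume \<alpha>: "mi_abs \<alpha> \<le> m"
    have sd: "seq_decay h ?K (mderiv \<alpha> f)" using f \<alpha> by (intro G_norm_seq_decay) (auto simp: G_m_def)
    show "seq_decay h' (?K * exp \<gamma>) (mderiv \<alpha> f)"
      unfolding seq_decay_def
    proof (intro allI)
      fix x :: "real^'n" and \<beta> :: "'n \<Rightarrow> nat"
      have "exp (- h (mi_vec \<beta>)) \<le> exp \<gamma> * exp (- h' (mi_vec \<beta>))"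
        using weight_le[OF mi_vec_orthant, of \<beta>] by (simp flip: exp_add)
      then have "?K * (mi_fact \<beta> * exp (- h (mi_vec \<beta>))) \<le> ?K * (mi_fact \<beta> * (exp \<gamma> * exp (- h' (mi_vec \<beta>))))"
        using mi_fact_pos[of \<beta>] by (intro mult_left_mono) auto
      then show "(\<Prod>j\<in>UNIV. \<bar>x $ j\<bar> ^ \<beta> j) * norm (mderiv \<alpha> f x) \<le> ?K * exp \<gamma> * (mi_fact \<beta> * exp (- h' (mi_vec \<beta>)))"
        using sd[unfolded seq_decay_def, rule_format, of x \<beta>] by (simp add: mult_ac)
    qed
  qed
  then have "G_norm m h' f < \<infinity>" by (rule order_le_less_trans) simp
  then show "f \<in> G_m m h'" using f by (simp add: G_m_def)
qed

lemma E_m_subset: "E_m m (phi h) \<subseteq> E_m m (phi h')"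
proof
  fix f assume f: "f \<in> E_m m (phi h)"
  let ?K = "enn2real (E_norm m (phi h) f)"
  have "E_norm m (phi h') f \<le> ennreal (?K * exp \<gamma>)"
  proof (rule E_norm_le)
    fix z :: "complex^'n"
    let ?y = "\<chi> j. Im (z $ j)"
    have "norm (f z) * (1 + norm z) ^ m \<le> ?K * exp (phi h ?y)"
      using f by (intro E_norm_bound) (simp add: E_m_def)
    also have "\<dots> \<le> ?K * exp (phi h' ?y + \<gamma>)"
      using phi_le[of ?y] by (intro mult_left_mono) auto
    finally show "norm (f z) * (1 + norm z) ^ m \<le> ?K * exp \<gamma> * exp (phi h' ?y)"
      by (simp add: exp_add mult_ac)
  qed
  then have "E_norm m (phi h') f < \<infinity>" by (rule order_le_less_trans) simp
  then show "f \<in> E_m m (phi h')" using f by (simp add: E_m_def)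
qed

lemma BT_bounded: "\<exists>C>0. \<forall>F\<in>(\<Inter>m. E_m m (phi h)). G_norm m h' (BT F) \<le> ennreal C * E_norm (m + 2 * CARD('n)) (phi h) F"
proof (intro exI conjI ballI)
  \<comment> \<open>\<open>W\<close> is only known to be nonnegative, while the continuity criterion
    asks for a positive constant.\<close>
  show "W + 1 > 0" using W_pos by simp
  fix F assume F: "F \<in> (\<Inter>m. E_m m (phi h))"
  interpret E_function h h' \<gamma> F by unfold_locales (use F in auto)
  show "G_norm m h' (BT F) \<le> ennreal (W + 1) * E_norm (m + 2 * CARD('n)) (phi h) F"
    by (rule order_trans[OF BT_G_norm mult_right_mono]) (auto intro: ennreal_leI)
qed

end

lemma (in weight_triple) AF_bounded:
  "\<exists>C>0. \<forall>f\<in>(\<Inter>m. G_m m h). E_norm m (phi h'') (AF f) \<le> ennreal C * G_norm m h f"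
proof (intro exI conjI ballI)
  let ?C = "fconst TYPE('n) * D m"
  show "max ?C 1 > 0" by simp
  fix f assume f: "f \<in> (\<Inter>m. G_m m h)"
  interpret G_function h h' h'' \<gamma> \<gamma>' f by unfold_locales (use f in auto)
  show "E_norm m (phi h'') (AF f) \<le> ennreal (max ?C 1) * G_norm m h f"
    by (rule order_trans[OF AF_E_norm mult_right_mono]) (auto intro: ennreal_leI)
qed

section \<open>Linearity and mutual inversion of the two maps\<close>

lemma FT_add: "integrable lborel f \<Longrightarrow> integrable lborel g \<Longrightarrow> FT s (\<lambda>x. f x + g x) \<xi> = FT s f \<xi> + FT s g \<xi>"
  unfolding FT_def distrib_right by (rule Bochner_Integration.integral_add) (rule FT_integrable, assumption)+

lemma AF_add:
  assumes "exp_decay f" "exp_decay g"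
  shows "AF (\<lambda>x. f x + g x) = (\<lambda>z. AF f z + AF g z)"
  unfolding AF_def distrib_left by (intro ext CT_add exp_decay_const assms)

lemma AF_scale: "AF (\<lambda>x. c * f x) = (\<lambda>z. c * AF f z)"
  by (rule ext) (simp add: AF_def CT_scale)

lemma BT_add:
  assumes "rapid (\<lambda>x. F (cvec x))" "rapid (\<lambda>x. G (cvec x))"
  shows "BT (\<lambda>z. F z + G z) = (\<lambda>\<xi>. BT F \<xi> + BT G \<xi>)"
  unfolding BT_def distrib_left by (intro ext FT_add integrable_mult_right rapid_integrable assms)

lemma BT_scale: "BT (\<lambda>z. c * F z) = (\<lambda>\<xi>. c * BT F \<xi>)"
  by (rule ext) (simp add: BT_def FT_scale)

lemma cweight_le_1: "cweight x \<le> 1"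
  unfolding cweight_def by (intro prod_le_1 conjI) (auto simp: inverse_le_1_iff add_nonneg_nonneg)

text \<open>Inversion requires the transform to be integrable over the real space. This is left as a
  hypothesis, to be supplied by the rapid decay of \<open>AF f\<close> along the reals.\<close>

lemma (in G_function) BT_AF:
  assumes "integrable lborel (\<lambda>x. AF f (cvec x))"
  shows "BT (AF f) = f"
proof
  fix x :: "real^'n"
  let ?c = "fconst TYPE('n)"
  let ?g = "\<lambda>x. of_real ?c * f x"
  have b: "norm (?g x) \<le> ?c * K 0 * (mi_fact (\<lambda>_::'n. 0) * exp (- h (mi_vec (\<lambda>_. 0))))" for x
  proof -
    have "norm (f x) \<le> K 0 * (mi_fact (\<lambda>_::'n. 0) * exp (- h (mi_vec (\<lambda>_. 0))))"
      using f_seq_decay[of 0, unfolded seq_decay_def, rule_format, of x "\<lambda>_. 0"] by simp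
    from mult_left_mono[OF this, of ?c] show ?thesis
      using fconst_pos[where 'n='n] by (simp add: norm_mult)
  qed
  have ghat: "(\<lambda>x. AF f (cvec x)) = FT 1 ?g" by (simp add: AF_cvec fourier_eq_FT)
  have "BT (AF f) x = of_real ?c * FT (-1) (FT 1 ?g) x"
    unfolding BT_def FT_scale ghat ..
  also have "FT (-1) (FT 1 ?g) x = (LINT \<xi>|lborel. FT 1 ?g \<xi> * iexp (- 1 * (x \<bullet> \<xi>)))"
    unfolding FT_def[of "-1"] by (simp add: inner_commute)
  also have "\<dots> = of_real ((2 * pi) ^ CARD('n)) * ?g x"
  proof (rule fourier_inversion)
    show "continuous_on UNIV ?g" by (intro continuous_intros C_diff_imp_continuous smooth)
    show "integrable lborel ?g" by (rule exp_decay_integrable[OF scaled_exp_decay])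
    show "integrable lborel (FT 1 ?g)" using assms unfolding ghat .
    show "FT 1 ?g \<xi> = (LINT x|lborel. ?g x * iexp (1 * (x \<bullet> \<xi>)))" for \<xi> by (simp only: FT_def)
  qed (use b in auto)
  also have "of_real ?c * (of_real ((2 * pi) ^ CARD('n)) * ?g x) = of_real (?c * ?c * (2 * pi) ^ CARD('n)) * f x"
    by (simp only: of_real_mult mult_ac)
  finally show "BT (AF f) x = f x" by (simp only: fconst_square of_real_1 mult_1_left)
qed

text \<open>Inversion gives the identity at real points only; both sides are entire, so
  \<open>entire_eqI\<close> extends it. The hypothesis lets \<open>BT F\<close> be transformed at
  complex points.\<close>

lemma (in E_function) AF_BT:
  assumes BT: "exp_decay (BT F)"
  shows "AF (BT F) = F"
proof (rule entire_eqI)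
  show "entire (AF (BT F))" unfolding AF_def by (intro entire_CT exp_decay_const BT)
  show "entire F" by (rule F_entire)
  fix x :: "real^'n"
  let ?c = "fconst TYPE('n)"
  let ?g = "\<lambda>x. of_real ?c * F (cvec x)"
  have b: "norm (?g x) \<le> ?c * (P (2 * CARD('n)) * exp (phi h 0))" for x
  proof -
    have "norm (F (cvec x)) \<le> P (2 * CARD('n)) * exp (phi h 0) * cweight x"
      using F_cvec_bound[of x 0] by (simp add: mult_ac)
    also have "\<dots> \<le> P (2 * CARD('n)) * exp (phi h 0) * 1"
      using P_nonneg by (intro mult_left_mono cweight_le_1) auto
    finally have "norm (F (cvec x)) \<le> P (2 * CARD('n)) * exp (phi h 0)" by simp
    from mult_left_mono[OF this, of ?c] show ?thesis
      using fconst_pos[where 'n='n] by (simp add: norm_mult)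
  qed
  have "AF (BT F) (cvec x) = of_real ?c * FT 1 (FT (-1) ?g) x"
    unfolding AF_def CT_cvec FT_scale BT_def ..
  also have "FT 1 (FT (-1) ?g) x = (LINT \<xi>|lborel. FT (-1) ?g \<xi> * iexp (- (- 1) * (x \<bullet> \<xi>)))"
    unfolding FT_def[of 1] by (simp add: inner_commute)
  also have "\<dots> = of_real ((2 * pi) ^ CARD('n)) * ?g x"
  proof (rule fourier_inversion)
    show "continuous_on UNIV ?g"
      using continuous_on_compose2[OF entire_continuous[OF F_entire] continuous_cvec]
      by (intro continuous_on_mult continuous_on_const) simp
    show "integrable lborel ?g" by (intro integrable_mult_right rapid_integrable F_cvec_rapid)
    show "integrable lborel (FT (-1) ?g)" using exp_decay_integrable[OF BT] unfolding BT_def .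
    show "FT (-1) ?g \<xi> = (LINT x|lborel. ?g x * iexp (- 1 * (x \<bullet> \<xi>)))" for \<xi> by (simp only: FT_def)
  qed (use b in auto)
  also have "of_real ?c * (of_real ((2 * pi) ^ CARD('n)) * ?g x) = of_real (?c * ?c * (2 * pi) ^ CARD('n)) * F (cvec x)"
    by (simp only: of_real_mult mult_ac)
  finally show "AF (BT F) (cvec x) = F (cvec x)" by (simp only: fconst_square of_real_1 mult_1_left)
qed

theorem theorem2:
  fixes h :: "nat \<Rightarrow> real^'n::finite \<Rightarrow> real"
  assumes convex: "\<And>\<nu>. \<nu> \<ge> 1 \<Longrightarrow> convex_on UNIV (h \<nu>)"
    and even: "\<And>\<nu> x. \<nu> \<ge> 1 \<Longrightarrow> h \<nu> x = h \<nu> (\<chi> j. \<bar>x $ j\<bar>)"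
    and nondecreasing: "\<And>\<nu> x j t. \<nu> \<ge> 1 \<Longrightarrow> x \<in> nonneg_orthant \<Longrightarrow> x $ j \<le> t \<Longrightarrow>
          h \<nu> x \<le> h \<nu> (\<chi> i. if i = j then t else x $ i)"
    and superlinear: "\<And>\<nu>. \<nu> \<ge> 1 \<Longrightarrow> filterlim (\<lambda>x. h \<nu> x / norm x) at_top at_infinity"
    and upper_bound: "\<And>\<nu> M. \<nu> \<ge> 1 \<Longrightarrow> M > 0 \<Longrightarrow> \<exists>A>0. \<forall>x\<in>nonneg_orthant.
          h \<nu> x \<le> (\<Sum>j | x $ j \<noteq> 0. x $ j * ln (x $ j / M)) + A"
    and decrease: "\<And>\<nu>. \<nu> \<ge> 1 \<Longrightarrow> \<exists>\<gamma>. \<forall>x\<in>nonneg_orthant.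
          h \<nu> x - h (Suc \<nu>) x \<ge> ln 2 * (\<Sum>j\<in>UNIV. x $ j) - \<gamma>"
    and subadditive: "\<And>\<nu>. \<nu> \<ge> 1 \<Longrightarrow> \<exists>l. \<forall>x\<in>nonneg_orthant. \<forall>y\<in>nonneg_orthant.
          h (Suc \<nu>) (x + y) \<le> h \<nu> x + h \<nu> y + l"
  shows "tvs_isomorphism (G_lim_top h) (E_lim_top (\<lambda>\<nu>. phi (h \<nu>)))
           (entire_extension h \<circ> fourier)"
proof -
  obtain \<gamma> where \<gamma>: "\<And>\<nu> x. \<nu> \<ge> 1 \<Longrightarrow> x \<in> nonneg_orthant \<Longrightarrow>
      h \<nu> x - h (Suc \<nu>) x \<ge> ln 2 * (\<Sum>j\<in>UNIV. x $ j) - \<gamma> \<nu>"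
    using decrease by metis
  have w: "weight (h \<nu>)" if "\<nu> \<ge> 1" for \<nu>
  proof
    show "h \<nu> x = h \<nu> (vabs x)" for x unfolding vabs_def by (rule even[OF that])
  qed (use that convex nondecreasing superlinear in auto)
  have wp: "weight_pair (h \<nu>) (h (Suc \<nu>)) (\<gamma> \<nu>)" if "\<nu> \<ge> 1" for \<nu>
    unfolding weight_pair_def weight_pair_axioms_def using w that \<gamma> by auto
  have wt: "weight_triple (h \<nu>) (h (Suc \<nu>)) (h (Suc (Suc \<nu>))) (\<gamma> \<nu>) (\<gamma> (Suc \<nu>))" if "\<nu> \<ge> 1" for \<nu>
    unfolding weight_triple_def using wp that by simp
  have Gf: "G_function (h \<nu>) (h (Suc \<nu>)) (h (Suc (Suc \<nu>))) (\<gamma> \<nu>) (\<gamma> (Suc \<nu>)) f"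
    if "\<nu> \<ge> 1" "f \<in> (\<Inter>m. G_m m (h \<nu>))" for \<nu> f
    unfolding G_function_def G_function_axioms_def using wt that by simp
  have Ef: "E_function (h \<nu>) (h (Suc \<nu>)) (\<gamma> \<nu>) F"
    if "\<nu> \<ge> 1" "F \<in> (\<Inter>m. E_m m (phi (h \<nu>)))" for \<nu> F
    unfolding E_function_def E_function_axioms_def using wp that by simp
  define VG where "VG = (\<Union>\<nu>\<in>{1..}. \<Inter>m. G_m m (h \<nu>))"
  define VE where "VE = (\<Union>\<nu>\<in>{1..}. \<Inter>m. E_m m (phi (h \<nu>)))"
  have VG: "VG = (\<Union>\<nu>\<in>{1..}. topspace (G_top (h \<nu>)))" by (simp add: VG_def topspace_G_top)
  have VE: "VE = (\<Union>\<nu>\<in>{1..}. topspace (E_top (phi (h \<nu>))))" by (simp add: VE_def topspace_E_top)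
  have subG: "fun_subspace VG"
    unfolding VG_def
    by (rule fun_subspace_UN_chain[OF fun_subspace_G]) (use weight_pair.G_m_subset[OF wp] in blast)
  have subE: "fun_subspace VE"
    unfolding VE_def
    by (rule fun_subspace_UN_chain[OF fun_subspace_E]) (use weight_pair.E_m_subset[OF wp] in blast)
  note limG = lc_inductive_limit_facts[OF VG subG, folded G_lim_top_def]
  note limE = lc_inductive_limit_facts[OF VE subE, folded E_lim_top_def]
  have G_ed: "exp_decay f" if f: "f \<in> VG" for f
  proof -
    obtain \<nu> where \<nu>: "\<nu> \<ge> 1" "f \<in> (\<Inter>m. G_m m (h \<nu>))" using f unfolding VG_def by auto
    show ?thesis by (rule G_function.f_exp_decay[OF Gf[OF \<nu>]])
  qed
  have E_rapid: "rapid (\<lambda>x. F (cvec x))" if F: "F \<in> VE" for F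
  proof -
    obtain \<nu> where \<nu>: "\<nu> \<ge> 1" "F \<in> (\<Inter>m. E_m m (phi (h \<nu>)))" using F unfolding VE_def by auto
    show ?thesis by (rule E_function.F_cvec_rapid[OF Ef[OF \<nu>]])
  qed
  have linA: "linear_map_on VG AF"
    unfolding linear_map_on_def by (simp add: AF_add AF_scale G_ed)
  have linB: "linear_map_on VE BT"
    unfolding linear_map_on_def by (simp add: BT_add BT_scale E_rapid)
  have AF_in: "AF f \<in> (\<Inter>m. E_m m (phi (h (Suc (Suc \<nu>)))))" if "\<nu> \<ge> 1" "f \<in> (\<Inter>m. G_m m (h \<nu>))" for \<nu> f
    using G_function.AF_mem[OF Gf[OF that]] by blast
  have BT_in: "BT F \<in> (\<Inter>m. G_m m (h (Suc \<nu>)))" if "\<nu> \<ge> 1" "F \<in> (\<Inter>m. E_m m (phi (h \<nu>)))" for \<nu> F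
    using E_function.BT_mem[OF Ef[OF that]] by blast
  have AF_VE: "AF f \<in> VE" if f: "f \<in> VG" for f
  proof -
    obtain \<nu> where \<nu>: "\<nu> \<ge> 1" "f \<in> (\<Inter>m. G_m m (h \<nu>))" using f unfolding VG_def by auto
    from AF_in[OF this] show ?thesis unfolding VE_def by (intro UN_I[of "Suc (Suc \<nu>)"]) auto
  qed
  have BT_VG: "BT F \<in> VG" if F: "F \<in> VE" for F
  proof -
    obtain \<nu> where \<nu>: "\<nu> \<ge> 1" "F \<in> (\<Inter>m. E_m m (phi (h \<nu>)))" using F unfolding VE_def by auto
    from BT_in[OF this] show ?thesis unfolding VG_def by (intro UN_I[of "Suc \<nu>"]) auto
  qed
  \<comment> \<open>On step \<nu>, \<open>AF\<close> is continuous into step \<nu> + 2, whose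
    inclusion into the limit is continuous; the universal property assembles these maps.\<close>
  have contA: "continuous_map (G_lim_top h) (E_lim_top (\<lambda>\<nu>. phi (h \<nu>))) AF"
    unfolding G_lim_top_def
  proof (rule continuous_map_lc_inductive_limit[OF VG subG linA limE(2)])
    fix \<nu> :: nat assume \<nu>: "\<nu> \<in> {1..}"
    then have \<nu>1: "\<nu> \<ge> 1" by simp
    let ?V = "\<Inter>m. G_m m (h \<nu>)" and ?W = "\<Inter>m. E_m m (phi (h (Suc (Suc \<nu>))))"
    have "?V \<subseteq> VG" using \<nu> unfolding VG_def by blast
    then have lin: "linear_map_on ?V AF" using linA unfolding linear_map_on_def by blast
    have "continuous_map (G_top (h \<nu>)) (E_top (phi (h (Suc (Suc \<nu>))))) AF"
      unfolding G_top_def E_top_def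
    proof (rule continuous_map_seminorm_topology[where p="\<lambda>m. G_norm m (h \<nu>)" and q="\<lambda>m. E_norm m (phi (h (Suc (Suc \<nu>))))",
          OF fun_subspace_G fun_subspace_E lin _ G_norm_zero E_norm_zero E_norm_triangle])
      show "AF ` ?V \<subseteq> ?W" using AF_in[OF \<nu>1] by blast
      show "\<exists>k. \<exists>C>0. \<forall>f\<in>?V. E_norm m (phi (h (Suc (Suc \<nu>)))) (AF f) \<le> ennreal C * G_norm k (h \<nu>) f" for m
        using weight_triple.AF_bounded[OF wt[OF \<nu>1]] by blast
    qed
    from continuous_map_compose[OF this limE(3)[of "Suc (Suc \<nu>)"]]
    show "continuous_map (G_top (h \<nu>)) (E_lim_top (\<lambda>\<nu>. phi (h \<nu>))) AF" by simp
  qed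
  have contB: "continuous_map (E_lim_top (\<lambda>\<nu>. phi (h \<nu>))) (G_lim_top h) BT"
    unfolding E_lim_top_def
  proof (rule continuous_map_lc_inductive_limit[OF VE subE linB limG(2)])
    fix \<nu> :: nat assume \<nu>: "\<nu> \<in> {1..}"
    then have \<nu>1: "\<nu> \<ge> 1" by simp
    let ?V = "\<Inter>m. E_m m (phi (h \<nu>))" and ?W = "\<Inter>m. G_m m (h (Suc \<nu>))"
    have "?V \<subseteq> VE" using \<nu> unfolding VE_def by blast
    then have lin: "linear_map_on ?V BT" using linB unfolding linear_map_on_def by blast
    have "continuous_map (E_top (phi (h \<nu>))) (G_top (h (Suc \<nu>))) BT"
      unfolding G_top_def E_top_def
    proof (rule continuous_map_seminorm_topology[where p="\<lambda>m. E_norm m (phi (h \<nu>))" and q="\<lambda>m. G_norm m (h (Suc \<nu>))",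
          OF fun_subspace_E fun_subspace_G lin _ E_norm_zero G_norm_zero])
      show "BT ` ?V \<subseteq> ?W" using BT_in[OF \<nu>1] by blast
      show "G_norm m (h (Suc \<nu>)) (\<lambda>x. f x + g x) \<le> G_norm m (h (Suc \<nu>)) f + G_norm m (h (Suc \<nu>)) g"
        if "f \<in> ?W" "g \<in> ?W" for m f g
        using that by (intro G_norm_triangle) (auto simp: G_m_def)
      show "\<exists>k. \<exists>C>0. \<forall>F\<in>?V. G_norm m (h (Suc \<nu>)) (BT F) \<le> ennreal C * E_norm k (phi (h \<nu>)) F" for m
        using weight_pair.BT_bounded[OF wp[OF \<nu>1]] by blast
    qed
    from continuous_map_compose[OF this limG(3)[of "Suc \<nu>"]]
    show "continuous_map (E_top (phi (h \<nu>))) (G_lim_top h) BT" by simp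
  qed
  have BT_AF: "BT (AF f) = f" if f: "f \<in> VG" for f
  proof -
    obtain \<nu> where \<nu>: "\<nu> \<ge> 1" "f \<in> (\<Inter>m. G_m m (h \<nu>))" using f unfolding VG_def by auto
    \<comment> \<open>Integrability of \<open>AF f\<close> over the real space follows from its
      membership in \<open>VE\<close>.\<close>
    show ?thesis
      by (rule G_function.BT_AF[OF Gf[OF \<nu>]]) (rule rapid_integrable[OF E_rapid[OF AF_VE[OF f]]])
  qed
  have AF_BT: "AF (BT F) = F" if F: "F \<in> VE" for F
  proof -
    obtain \<nu> where \<nu>: "\<nu> \<ge> 1" "F \<in> (\<Inter>m. E_m m (phi (h \<nu>)))" using F unfolding VE_def by auto
    show ?thesis by (rule E_function.AF_BT[OF Ef[OF \<nu>] G_ed[OF BT_VG[OF F]]])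
  qed
  have "homeomorphic_maps (G_lim_top h) (E_lim_top (\<lambda>\<nu>. phi (h \<nu>))) AF BT"
    unfolding homeomorphic_maps_def using contA contB BT_AF AF_BT limG(1) limE(1) by simp
  then have homeo: "homeomorphic_map (G_lim_top h) (E_lim_top (\<lambda>\<nu>. phi (h \<nu>))) AF"
    by (rule homeomorphic_maps_imp_map)
  \<comment> \<open>\<open>entire_extension h\<close> gives the series only on its domain, so
    membership of \<open>fourier f\<close> is established before the series is identified with
    \<open>AF f\<close>.\<close>
  have ext: "AF f = (entire_extension h \<circ> fourier) f" if f: "f \<in> VG" for f
  proof -
    obtain \<nu> where \<nu>: "\<nu> \<ge> 1" "f \<in> (\<Inter>m. G_m m (h \<nu>))" using f unfolding VG_def by auto
    obtain l where l: "\<And>x y. x \<in> nonneg_orthant \<Longrightarrow> y \<in> nonneg_orthant \<Longrightarrow>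
        h (Suc \<nu>) (x + y) \<le> h \<nu> x + h \<nu> y + l"
      using subadditive[OF \<nu>(1)] by blast
    have "fourier f \<in> (\<Inter>m. E_smooth_m m (h (Suc (Suc \<nu>))))"
      using G_function.fourier_E_smooth[OF Gf[OF \<nu>] l] by blast
    then have "fourier f \<in> E_smooth_union h"
      unfolding E_smooth_union_def by (intro UN_I[of "Suc (Suc \<nu>)"]) auto
    then show ?thesis
      by (simp add: fun_eq_iff entire_extension_def G_function.AF_eq_infsum[OF Gf[OF \<nu>]])
  qed
  have "homeomorphic_map (G_lim_top h) (E_lim_top (\<lambda>\<nu>. phi (h \<nu>))) (entire_extension h \<circ> fourier)"
    by (rule homeomorphic_map_eq[OF homeo]) (use ext limG(1) in blast)
  moreover have "linear_map_on VG (entire_extension h \<circ> fourier)"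
    by (rule linear_map_on_cong[OF subG linA ext])
  ultimately show ?thesis
    using limG(1,2) limE(2)
    unfolding tvs_isomorphism_def linear_map_on_def locally_convex_tvs_def by simp
qed

end
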